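(* (a) Given a pair of jointly Gaussian $\mathcal{D}_0$-GAFs $(\Phi(z),\Psi(z))$, there exists a norm contraction $\mathbf{T}:L^2(\mathbb{D})\to L^2(\mathbb{D})$ such that \[ \text{(i)}\qquad \mathbb{E}\,\Phi(z)\Psi(w)=zw\,\langle\mathbf{T}\,\bar{\mathrm{s}}_z,\mathrm{s}_w\rangle_{\mathbb{D}},\qquad z,w\in\mathbb{D}. \] (b) Given a norm contraction $\mathbf{T}$ on $L^2(\mathbb{D})$, there exists a pair of jointly Gaussian $\mathcal{D}_0$-GAFs $(\Phi(z),\Psi(z))$ such that (i) holds.
   Context: $\mathbb{D}=\{z\in\mathbb{C}:|z|<1\}$; $dA=\frac1\pi\,dx\,dy$ is normalized area measure; $L^2(\mathbb{D})$ is the complex $L^2$ space with respect to $dA$, with $\langle f,g\rangle_{\mathbb{D}}=\int_{\mathbb{D}}f\,\bar g\,dA$. A norm contraction is a $\mathbb{C}$-linear operator of norm $\le1$. For $z\in\mathbb{D}$, $\mathrm{s}_z(\zeta)=\frac{1}{1-\bar z\zeta}$ is the Szegő kernel, and $\bar{\mathrm{s}}_z$ is the function $\zeta\mapsto\overline{\mathrm{s}_z(\zeta)}$. A Gaussian Hilbert space $\mathfrak{G}$ is a closed ($\mathbb{C}$-linear) subspace of $L^2(\Omega,dP)$, for a probability space $(\Omega,dP)$, each of whose elements has a complex Gaussian distribution with mean $0$ (real and imaginary parts are jointly Gaussian with mean $0$); $\mathfrak{G}$ is assumed conjugation-invariant ($\gamma\in\mathfrak{G}\iff\bar\gamma\in\mathfrak{G}$).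 $\mathbb{E}$ denotes expectation, $\mathbb{E}\gamma=\int_\Omega\gamma\,dP$. A standard complex Gaussian variable is a mean-zero complex Gaussian $\gamma$ with $\mathbb{E}(\gamma^2)=0$ and $\mathbb{E}(|\gamma|^2)=1$. A pair of jointly Gaussian $\mathcal{D}_0$-GAFs is a pair $(\Phi,\Psi)$ of random analytic functions on $\mathbb{D}$, \[ \Phi(z)=\sum_{j=1}^{+\infty}\frac{\alpha_j}{\sqrt{j}}\,z^j,\qquad \Psi(z)=\sum_{j=1}^{+\infty}\frac{\beta_j}{\sqrt{j}}\,z^j, \] where $\alpha_1,\alpha_2,\ldots$ are i.i.d. standard complex Gaussian variables, $\beta_1,\beta_2,\ldots$ are i.i.d. standard complex Gaussian variables, and all the $\alpha_j$ and $\beta_j$ are taken from one and the same Gaussian Hilbert space $\mathfrak{G}$ (no assumption is made on the correlations between the $\alpha_j$ and the $\beta_k$). In (b), the existence statement includes the choice of the (sufficiently large) Gaussian Hilbert space. *)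

theory Defs
  imports "HOL-Probability.Probability"
begin

text \<open>
  Elements of a complex \<open>L\<^sup>2\<close> space are represented by square-integrable functions;
  two functions that agree almost everywhere stand for the same element.
\<close>

definition L2 :: "'a measure \<Rightarrow> ('a \<Rightarrow> complex) set" where
  "L2 M = {f \<in> borel_measurable M. integrable M (\<lambda>x. (cmod (f x))\<^sup>2)}"

definition L2_inner :: "'a measure \<Rightarrow> ('a \<Rightarrow> complex) \<Rightarrow> ('a \<Rightarrow> complex) \<Rightarrow> complex" where
  "L2_inner M f g = (LINT x|M. f x * cnj (g x))"

definition L2_norm :: "'a measure \<Rightarrow> ('a \<Rightarrow> complex) \<Rightarrow> real" where
  "L2_norm M f = sqrt (LINT x|M. (cmod (f x))\<^sup>2)"

text \<open>
  An operator acts on representatives. The second clause says that it descends to classes of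
  functions modulo almost-everywhere equality, and the next two that it is complex linear there.
  Values outside \<open>L2 M\<close> are irrelevant.
\<close>

definition L2_linear_operator ::
    "'a measure \<Rightarrow> (('a \<Rightarrow> complex) \<Rightarrow> ('a \<Rightarrow> complex)) \<Rightarrow> bool" where
  "L2_linear_operator M T \<longleftrightarrow>
     (\<forall>f\<in>L2 M. T f \<in> L2 M) \<and>
     (\<forall>f\<in>L2 M. \<forall>g\<in>L2 M. (AE x in M. f x = g x) \<longrightarrow> (AE x in M. T f x = T g x)) \<and>
     (\<forall>f\<in>L2 M. \<forall>g\<in>L2 M. AE x in M. T (\<lambda>y. f y + g y) x = T f x + T g x) \<and>
     (\<forall>c. \<forall>f\<in>L2 M. AE x in M. T (\<lambda>y. c * f y) x = c * T f x)"

definition norm_contraction ::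
    "'a measure \<Rightarrow> (('a \<Rightarrow> complex) \<Rightarrow> ('a \<Rightarrow> complex)) \<Rightarrow> bool" where
  "norm_contraction M T \<longleftrightarrow>
     L2_linear_operator M T \<and> (\<forall>f\<in>L2 M. L2_norm M (T f) \<le> L2_norm M f)"

abbreviation unit_disk :: "complex set" where
  "unit_disk \<equiv> ball 0 1"

definition disk_area :: "complex measure" where
  "disk_area = density (restrict_space lborel unit_disk) (\<lambda>_. ennreal (1 / pi))"

definition szego :: "complex \<Rightarrow> complex \<Rightarrow> complex" where
  "szego z \<zeta> = 1 / (1 - cnj z * \<zeta>)"

text \<open>The constant \<open>0\<close> counts as a (degenerate) Gaussian variable.\<close>

definition centered_gaussian :: "'a measure \<Rightarrow> ('a \<Rightarrow> real) \<Rightarrow> bool" where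
  "centered_gaussian M X \<longleftrightarrow> X \<in> borel_measurable M \<and>
     ((AE \<omega> in M. X \<omega> = 0) \<or> (\<exists>\<sigma>>0. distributed M lborel X (normal_density 0 \<sigma>)))"

text \<open>
  Joint Gaussianity of the real and imaginary parts: every real linear combination of them is
  Gaussian.
\<close>

definition centered_complex_gaussian :: "'a measure \<Rightarrow> ('a \<Rightarrow> complex) \<Rightarrow> bool" where
  "centered_complex_gaussian M \<gamma> \<longleftrightarrow>
     (\<forall>a b :: real. centered_gaussian M (\<lambda>\<omega>. a * Re (\<gamma> \<omega>) + b * Im (\<gamma> \<omega>)))"

definition standard_complex_gaussian :: "'a measure \<Rightarrow> ('a \<Rightarrow> complex) \<Rightarrow> bool" where
  "standard_complex_gaussian M \<gamma> \<longleftrightarrow>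
     centered_complex_gaussian M \<gamma> \<and>
     (LINT \<omega>|M. (\<gamma> \<omega>)\<^sup>2) = 0 \<and> (LINT \<omega>|M. (cmod (\<gamma> \<omega>))\<^sup>2) = 1"

text \<open>
  The closedness clause, applied to constant sequences, also makes \<open>G\<close> a union of classes
  modulo almost-everywhere equality.
\<close>

definition gaussian_hilbert_space :: "'a measure \<Rightarrow> ('a \<Rightarrow> complex) set \<Rightarrow> bool" where
  "gaussian_hilbert_space M G \<longleftrightarrow>
     prob_space M \<and>
     G \<subseteq> L2 M \<and>
     (\<lambda>_. 0) \<in> G \<and>
     (\<forall>f\<in>G. \<forall>g\<in>G. (\<lambda>\<omega>. f \<omega> + g \<omega>) \<in> G) \<and>
     (\<forall>c. \<forall>f\<in>G. (\<lambda>\<omega>. c * f \<omega>) \<in> G) \<and>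
     (\<forall>X. \<forall>f\<in>L2 M. (\<forall>n::nat. X n \<in> G) \<longrightarrow>
        (\<lambda>n. L2_norm M (\<lambda>\<omega>. X n \<omega> - f \<omega>)) \<longlonglongrightarrow> 0 \<longrightarrow> f \<in> G) \<and>
     (\<forall>f. f \<in> G \<longleftrightarrow> (\<lambda>\<omega>. cnj (f \<omega>)) \<in> G) \<and>
     (\<forall>f\<in>G. centered_complex_gaussian M f)"

definition random_analytic_function ::
    "'a measure \<Rightarrow> (complex \<Rightarrow> 'a \<Rightarrow> complex) \<Rightarrow> bool" where
  "random_analytic_function M F \<longleftrightarrow>
     (\<forall>z\<in>unit_disk. F z \<in> borel_measurable M) \<and>
     (AE \<omega> in M. (\<lambda>z. F z \<omega>) analytic_on unit_disk)"

text \<open>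
  The coefficient sequence \<open>\<alpha>\<close> is indexed by the positive integers; \<open>\<alpha> 0\<close> plays no role.
  Identical distribution is implied, since the two moments determine the law of a standard
  complex Gaussian variable.
\<close>

definition D0_GAF :: "'a measure \<Rightarrow> ('a \<Rightarrow> complex) set \<Rightarrow> (complex \<Rightarrow> 'a \<Rightarrow> complex) \<Rightarrow> bool" where
  "D0_GAF M G \<Phi> \<longleftrightarrow>
     random_analytic_function M \<Phi> \<and>
     (\<exists>\<alpha> :: nat \<Rightarrow> 'a \<Rightarrow> complex.
        (\<forall>j\<ge>1. \<alpha> j \<in> G \<and> standard_complex_gaussian M (\<alpha> j)) \<and>
        prob_space.indep_vars M (\<lambda>_. borel) \<alpha> {1..} \<and>
        (AE \<omega> in M. \<forall>z\<in>unit_disk.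
           (\<lambda>j. \<alpha> (Suc j) \<omega> / of_real (sqrt (real (Suc j))) * z ^ Suc j) sums \<Phi> z \<omega>))"

definition jointly_gaussian_D0_GAFs ::
    "'a measure \<Rightarrow> ('a \<Rightarrow> complex) set \<Rightarrow> (complex \<Rightarrow> 'a \<Rightarrow> complex) \<Rightarrow>
     (complex \<Rightarrow> 'a \<Rightarrow> complex) \<Rightarrow> bool" where
  "jointly_gaussian_D0_GAFs M G \<Phi> \<Psi> \<longleftrightarrow>
     gaussian_hilbert_space M G \<and> D0_GAF M G \<Phi> \<and> D0_GAF M G \<Psi>"

definition correlation_identity ::
    "'a measure \<Rightarrow> (complex \<Rightarrow> 'a \<Rightarrow> complex) \<Rightarrow> (complex \<Rightarrow> 'a \<Rightarrow> complex) \<Rightarrow>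
     ((complex \<Rightarrow> complex) \<Rightarrow> (complex \<Rightarrow> complex)) \<Rightarrow> bool" where
  "correlation_identity M \<Phi> \<Psi> T \<longleftrightarrow>
     (\<forall>z\<in>unit_disk. \<forall>w\<in>unit_disk.
        (LINT \<omega>|M. \<Phi> z \<omega> * \<Psi> w \<omega>) =
          z * w * L2_inner disk_area (T (\<lambda>\<zeta>. cnj (szego z \<zeta>))) (szego w))"

end

theory Submission
  imports Defs
begin

text \<open>
  Since \<open>s\<^sub>w = \<Sum> cnj w\<^sup>k e\<^sub>k / sqrt (k + 1)\<close> in the orthonormal basis \<open>e\<^sub>k(\<zeta>) = sqrt (k + 1) \<zeta>\<^sup>k\<close> of
  the Bergman space, the identity says exactly that \<open>\<langle>T (cnj e\<^sub>j), e\<^sub>k\<rangle> = E(\<alpha>\<^bsub>j+1\<^esub> \<beta>\<^bsub>k+1\<^esub>)\<close> for all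
  \<open>j, k\<close>. For (a), these covariances form a contractive matrix by Bessel's inequality, as
  \<open>(\<alpha>\<^sub>j)\<close> and \<open>(cnj \<beta>\<^sub>k)\<close> are orthonormal; it is the matrix of an operator from the span of the
  \<open>cnj e\<^sub>j\<close> to the span of the \<open>e\<^sub>k\<close>. For (b), contractivity of \<open>T\<close> makes the prescribed Gram
  matrix of \<open>\<alpha>\<^sub>1, cnj \<beta>\<^sub>1, \<alpha>\<^sub>2, cnj \<beta>\<^sub>2, \<dots>\<close> positive, so it has a Cholesky factorisation. Its rows
  exhibit every \<open>\<alpha>\<^sub>j\<close> and \<open>\<beta>\<^sub>k\<close> as a finite combination of independent standard complex Gaussians,
  and no infinite Gaussian series or operator square root is needed. Orthogonality then gives
  independence through characteristic functions.
\<close>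

section \<open>Square-integrable functions\<close>

text \<open>The identity constrains only the moments E(\<alpha>_j \<beta>_k), taken without a
  conjugate, whereas Bessel's inequality and Gram matrices speak of inner products; hence the
  conjugates of the \<beta>_k in both directions. In (b) the moments E(\<alpha>_j cnj \<beta>_k)
  remain free and are made 0. The family \<alpha>_1, cnj \<beta>_1, \<alpha>_2, ... is then jointly
  circular: E(v_m v_n) = 0 for any two members, so the law of every real linear form depends on the
  Gram matrix alone. Interleaving gives one sequence indexed by the natural numbers, so every row of
  a triangular factor is finite. The shift between \<alpha>_(j+1) and e_j comes from z^(j+1) / sqrt
  (j+1) = z * (z^j / sqrt (j+1)), which also produces the factor zw. Operators are linear only up to
  null sets that depend on the functions involved. Statements about a given T are therefore made
  through inner products and norms, while the T constructed for (a) is given by pointwise series and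
  is linear at every point of the disk.\<close>

lemma L2_iff: "f \<in> L2 M \<longleftrightarrow> f \<in> borel_measurable M \<and> integrable M (\<lambda>x. (cmod (f x))\<^sup>2)"
  by (simp add: L2_def)

lemma L2_measurable: "f \<in> L2 M \<Longrightarrow> f \<in> borel_measurable M"
  by (simp add: L2_def)

lemma L2_square_integrable: "f \<in> L2 M \<Longrightarrow> integrable M (\<lambda>x. (cmod (f x))\<^sup>2)"
  by (simp add: L2_def)

lemma L2_zero [simp]: "(\<lambda>_. 0) \<in> L2 M"
  by (simp add: L2_iff)

lemma L2_scale:
  assumes "f \<in> L2 M"
  shows "(\<lambda>x. c * f x) \<in> L2 M"
  using assms by (auto simp: L2_iff norm_mult power_mult_distrib)

lemma L2_cnj:
  assumes "f \<in> L2 M"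
  shows "(\<lambda>x. cnj (f x)) \<in> L2 M"
proof -
  have "(\<lambda>x. cnj (f x)) \<in> borel_measurable M"
    by (rule measurable_compose[OF L2_measurable[OF assms] borel_measurable_continuous_onI])
       (intro continuous_intros)
  thus ?thesis using assms by (simp add: L2_iff)
qed

lemma L2_bound:
  assumes "f \<in> L2 M" "g \<in> borel_measurable M" "AE x in M. cmod (g x) \<le> cmod (f x)"
  shows "g \<in> L2 M"
proof -
  have "integrable M (\<lambda>x. (cmod (g x))\<^sup>2)"
    using assms(3)
    by (intro Bochner_Integration.integrable_bound[OF L2_square_integrable[OF assms(1)]])
       (use assms(2) in \<open>auto simp: power_mono elim!: eventually_mono\<close>)
  with assms(2) show ?thesis by (simp add: L2_iff)
qed

lemma L2_add:
  assumes f: "f \<in> L2 M" and g: "g \<in> L2 M"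
  shows "(\<lambda>x. f x + g x) \<in> L2 M"
proof -
  have "(cmod (f x + g x))\<^sup>2 \<le> 2 * (cmod (f x))\<^sup>2 + 2 * (cmod (g x))\<^sup>2" for x
  proof -
    have "(cmod (f x + g x))\<^sup>2 \<le> (cmod (f x) + cmod (g x))\<^sup>2"
      by (simp add: power_mono norm_triangle_ineq)
    also have "\<dots> \<le> 2 * (cmod (f x))\<^sup>2 + 2 * (cmod (g x))\<^sup>2"
      using zero_le_power2[of "cmod (f x) - cmod (g x)"] by (simp add: power2_eq_square algebra_simps)
    finally show ?thesis .
  qed
  moreover have "integrable M (\<lambda>x. 2 * (cmod (f x))\<^sup>2 + 2 * (cmod (g x))\<^sup>2)"
    using f g by (simp add: L2_iff)
  ultimately have "integrable M (\<lambda>x. (cmod (f x + g x))\<^sup>2)"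
    using L2_measurable[OF f] L2_measurable[OF g]
    by (elim Bochner_Integration.integrable_bound) auto
  with L2_measurable[OF f] L2_measurable[OF g] show ?thesis by (simp add: L2_iff)
qed

lemma L2_diff:
  assumes "f \<in> L2 M" "g \<in> L2 M"
  shows "(\<lambda>x. f x - g x) \<in> L2 M"
  using L2_add[OF assms(1) L2_scale[OF assms(2), of "- 1"]] by simp

lemma L2_sum:
  assumes "\<And>i. i \<in> I \<Longrightarrow> f i \<in> L2 M"
  shows "(\<lambda>x. \<Sum>i\<in>I. f i x) \<in> L2 M"
  using assms by (induction I rule: infinite_finite_induct) (auto intro: L2_add)

lemma L2_lincomb:
  assumes "\<And>i. i \<in> I \<Longrightarrow> f i \<in> L2 M"
  shows "(\<lambda>x. \<Sum>i\<in>I. c i * f i x) \<in> L2 M"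
  by (intro L2_sum L2_scale assms)

lemma L2_norm_nonneg [simp]: "0 \<le> L2_norm M f"
  by (simp add: L2_norm_def)

lemma L2_norm_square: "(L2_norm M f)\<^sup>2 = (LINT x|M. (cmod (f x))\<^sup>2)"
  by (simp add: L2_norm_def)

lemma L2_norm_scale: "L2_norm M (\<lambda>x. c * f x) = cmod c * L2_norm M f"
  by (simp add: L2_norm_def norm_mult power_mult_distrib real_sqrt_mult)

lemma L2_norm_minus_commute: "L2_norm M (\<lambda>x. f x - g x) = L2_norm M (\<lambda>x. g x - f x)"
  by (simp add: L2_norm_def norm_minus_commute)

lemma L2_norm_cong_AE:
  assumes "f \<in> L2 M" "g \<in> L2 M" "AE x in M. f x = g x"
  shows "L2_norm M f = L2_norm M g"
proof -
  have "(LINT x|M. (cmod (f x))\<^sup>2) = (LINT x|M. (cmod (g x))\<^sup>2)"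
    by (rule integral_cong_AE)
       (use assms in \<open>auto simp: L2_iff elim!: eventually_mono\<close>)
  thus ?thesis by (simp add: L2_norm_def)
qed

lemma L2_norm_mono_AE:
  assumes "f \<in> L2 M" "g \<in> borel_measurable M" "AE x in M. cmod (g x) \<le> cmod (f x)"
  shows "L2_norm M g \<le> L2_norm M f"
proof -
  have "(LINT x|M. (cmod (g x))\<^sup>2) \<le> (LINT x|M. (cmod (f x))\<^sup>2)"
    by (rule integral_mono_AE)
       (use L2_bound[OF assms] assms in \<open>auto simp: L2_iff power_mono elim!: eventually_mono\<close>)
  thus ?thesis by (simp add: L2_norm_def)
qed

lemma nn_integral_L2:
  assumes "f \<in> L2 M"
  shows "(\<integral>\<^sup>+x. ennreal ((cmod (f x))\<^sup>2) \<partial>M) = ennreal ((L2_norm M f)\<^sup>2)"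
  using assms by (simp add: L2_norm_square nn_integral_eq_integral L2_iff)

text \<open>The form in which Fatou's lemma delivers its estimates: a bound on the extended integral
  gives membership and the norm bound together.\<close>

lemma nn_integral_L2_bound:
  assumes "f \<in> borel_measurable M" "(\<integral>\<^sup>+x. ennreal ((cmod (f x))\<^sup>2) \<partial>M) \<le> ennreal (c\<^sup>2)" "0 \<le> c"
  shows "f \<in> L2 M" "L2_norm M f \<le> c"
proof -
  have "(\<integral>\<^sup>+x. ennreal ((cmod (f x))\<^sup>2) \<partial>M) < \<infinity>"
    using assms(2) by (rule order.strict_trans1) simp
  thus f: "f \<in> L2 M"
    using assms(1) by (auto simp: L2_iff intro!: integrableI_nonneg)
  from assms(2) have "(L2_norm M f)\<^sup>2 \<le> c\<^sup>2"
    by (simp add: nn_integral_L2[OF f])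
  thus "L2_norm M f \<le> c" using \<open>0 \<le> c\<close> by (rule power2_le_imp_le)
qed

lemma L2_norm_eq_0_AE:
  assumes "f \<in> L2 M" "L2_norm M f = 0"
  shows "AE x in M. f x = 0"
proof -
  have "(LINT x|M. (cmod (f x))\<^sup>2) = 0" using assms(2) by (simp add: L2_norm_def)
  hence "AE x in M. (cmod (f x))\<^sup>2 = 0"
    using integral_nonneg_eq_0_iff_AE[OF L2_square_integrable[OF assms(1)]] by simp
  thus ?thesis by simp
qed

section \<open>Cauchy-Schwarz and the calculus of the inner product\<close>

lemma L2_product_integrable:
  assumes f: "f \<in> L2 M" and g: "g \<in> L2 M"
  shows "integrable M (\<lambda>x. f x * g x)"
proof -
  have "norm (f x * g x) \<le> (cmod (f x))\<^sup>2 + (cmod (g x))\<^sup>2" for x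
    using zero_le_power2[of "cmod (f x) - cmod (g x)"] mult_nonneg_nonneg[of "cmod (f x)" "cmod (g x)"]
    unfolding norm_mult power2_diff
    by (simp only: mult.assoc) (smt (verit) norm_ge_zero)
  moreover have "integrable M (\<lambda>x. (cmod (f x))\<^sup>2 + (cmod (g x))\<^sup>2)"
    using f g by (simp add: L2_iff)
  ultimately show ?thesis
    using L2_measurable[OF f] L2_measurable[OF g]
    by (elim Bochner_Integration.integrable_bound) auto
qed

text \<open>With a and b the two norms, the pointwise bound |fg| <= (b/2a)|f|^2 + (a/2b)|g|^2
  integrates to ab/2 + ab/2. The modulus stays inside the integral because the triangle inequality
  and the continuity of characteristic functions use this stronger form.\<close>

lemma L2_Cauchy_Schwarz_cmod:
  assumes f: "f \<in> L2 M" and g: "g \<in> L2 M"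
  shows "(LINT x|M. cmod (f x * g x)) \<le> L2_norm M f * L2_norm M g"
proof (cases "L2_norm M f = 0 \<or> L2_norm M g = 0")
  case True
  then have "AE x in M. f x * g x = 0"
  proof
    assume "L2_norm M f = 0"
    from L2_norm_eq_0_AE[OF f this] show ?thesis by (auto elim!: eventually_mono)
  next
    assume "L2_norm M g = 0"
    from L2_norm_eq_0_AE[OF g this] show ?thesis by (auto elim!: eventually_mono)
  qed
  then have "(LINT x|M. cmod (f x * g x)) = (LINT x|M. 0)"
    using L2_measurable[OF f] L2_measurable[OF g]
    by (intro integral_cong_AE) (auto elim!: eventually_mono simp: norm_mult)
  thus ?thesis by simp
next
  case False
  define a b where "a = L2_norm M f" and "b = L2_norm M g"
  have ab: "a > 0" "b > 0"
    using False L2_norm_nonneg[of M f] L2_norm_nonneg[of M g] by (simp_all add: a_def b_def less_le)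
  have "(LINT x|M. cmod (f x * g x))
      \<le> (LINT x|M. (b / (2 * a)) * (cmod (f x))\<^sup>2 + (a / (2 * b)) * (cmod (g x))\<^sup>2)"
  proof (rule integral_mono)
    show "integrable M (\<lambda>x. cmod (f x * g x))"
      using L2_product_integrable[OF f g] by (rule integrable_norm)
    show "integrable M (\<lambda>x. (b / (2 * a)) * (cmod (f x))\<^sup>2 + (a / (2 * b)) * (cmod (g x))\<^sup>2)"
      using f g by (simp add: L2_iff)
    show "cmod (f x * g x) \<le> (b / (2 * a)) * (cmod (f x))\<^sup>2 + (a / (2 * b)) * (cmod (g x))\<^sup>2" for x
      using zero_le_power2[of "b * cmod (f x) - a * cmod (g x)"] ab
      by (simp add: norm_mult field_simps power2_eq_square)
  qed
  also have "\<dots> = (b / (2 * a)) * a\<^sup>2 + (a / (2 * b)) * b\<^sup>2"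
    using f g by (simp add: L2_iff a_def b_def L2_norm_square)
  also have "\<dots> = a * b" using ab by (simp add: field_simps power2_eq_square)
  finally show ?thesis by (simp add: a_def b_def)
qed

lemma L2_inner_integrable:
  assumes "f \<in> L2 M" "g \<in> L2 M"
  shows "integrable M (\<lambda>x. f x * cnj (g x))"
  by (intro L2_product_integrable L2_cnj assms)

lemma L2_norm_cnj [simp]: "L2_norm M (\<lambda>x. cnj (f x)) = L2_norm M f"
  by (simp add: L2_norm_def)

lemma L2_Cauchy_Schwarz:
  assumes "f \<in> L2 M" "g \<in> L2 M"
  shows "cmod (L2_inner M f g) \<le> L2_norm M f * L2_norm M g"
proof -
  have "cmod (L2_inner M f g) \<le> (LINT x|M. cmod (f x * cnj (g x)))"
    unfolding L2_inner_def by (rule integral_norm_bound)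
  also have "\<dots> \<le> L2_norm M f * L2_norm M g"
    using L2_Cauchy_Schwarz_cmod[OF assms(1) L2_cnj[OF assms(2)]] by simp
  finally show ?thesis .
qed

lemma L2_inner_self: "L2_inner M f f = of_real ((L2_norm M f)\<^sup>2)"
  unfolding L2_inner_def L2_norm_square
  by (simp only: complex_norm_square[symmetric] integral_complex_of_real flip: of_real_power)

lemma L2_inner_cnj_commute: "L2_inner M g f = cnj (L2_inner M f g)"
  unfolding L2_inner_def
  by (subst Bochner_Integration.integral_cnj[symmetric]) (simp add: mult.commute)

lemma L2_inner_scale_left: "L2_inner M (\<lambda>x. c * f x) g = c * L2_inner M f g"
  by (simp add: L2_inner_def mult.assoc)

lemma L2_inner_scale_right: "L2_inner M f (\<lambda>x. c * g x) = cnj c * L2_inner M f g"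
  by (simp add: L2_inner_def mult.left_commute)

lemma L2_inner_add_left:
  assumes "f \<in> L2 M" "g \<in> L2 M" "h \<in> L2 M"
  shows "L2_inner M (\<lambda>x. f x + g x) h = L2_inner M f h + L2_inner M g h"
  using assms by (simp add: L2_inner_def distrib_right L2_inner_integrable)

lemma L2_inner_diff_left:
  assumes "f \<in> L2 M" "g \<in> L2 M" "h \<in> L2 M"
  shows "L2_inner M (\<lambda>x. f x - g x) h = L2_inner M f h - L2_inner M g h"
  using assms by (simp add: L2_inner_def left_diff_distrib L2_inner_integrable)

lemma L2_inner_lincomb_left:
  assumes "\<And>i. i \<in> I \<Longrightarrow> f i \<in> L2 M" "h \<in> L2 M"
  shows "L2_inner M (\<lambda>x. \<Sum>i\<in>I. c i * f i x) h = (\<Sum>i\<in>I. c i * L2_inner M (f i) h)"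
proof -
  have "L2_inner M (\<lambda>x. \<Sum>i\<in>I. c i * f i x) h = (LINT x|M. (\<Sum>i\<in>I. c i * (f i x * cnj (h x))))"
    by (simp add: L2_inner_def sum_distrib_right mult.assoc)
  also have "\<dots> = (\<Sum>i\<in>I. c i * L2_inner M (f i) h)"
    using assms unfolding L2_inner_def
    by (subst Bochner_Integration.integral_sum) (auto intro!: L2_inner_integrable)
  finally show ?thesis .
qed

lemma L2_inner_lincomb_right:
  assumes "\<And>i. i \<in> I \<Longrightarrow> f i \<in> L2 M" "h \<in> L2 M"
  shows "L2_inner M h (\<lambda>x. \<Sum>i\<in>I. c i * f i x) = (\<Sum>i\<in>I. cnj (c i) * L2_inner M h (f i))"
proof -
  have "L2_inner M h (\<lambda>x. \<Sum>i\<in>I. c i * f i x) = cnj (\<Sum>i\<in>I. c i * L2_inner M (f i) h)"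
    by (subst L2_inner_cnj_commute) (simp add: L2_inner_lincomb_left assms)
  also have "\<dots> = (\<Sum>i\<in>I. cnj (c i) * L2_inner M h (f i))"
    by (simp flip: L2_inner_cnj_commute)
  finally show ?thesis .
qed

lemma L2_inner_cong_AE:
  assumes "f \<in> L2 M" "g \<in> L2 M" "h \<in> L2 M" "AE x in M. f x = g x"
  shows "L2_inner M f h = L2_inner M g h"
  unfolding L2_inner_def
  using assms(4)
  by (intro integral_cong_AE borel_measurable_integrable L2_inner_integrable assms(1-3))
     (auto elim!: eventually_mono)

lemma L2_inner_add_right:
  assumes "f \<in> L2 M" "g \<in> L2 M" "h \<in> L2 M"
  shows "L2_inner M h (\<lambda>x. f x + g x) = L2_inner M h f + L2_inner M h g"
  using L2_inner_add_left[OF assms] by (metis L2_inner_cnj_commute complex_cnj_add)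

lemma L2_inner_cnj_cnj: "L2_inner M (\<lambda>x. cnj (f x)) (\<lambda>x. cnj (g x)) = cnj (L2_inner M f g)"
  unfolding L2_inner_def by (subst Bochner_Integration.integral_cnj[symmetric]) simp

lemma L2_norm_triangle:
  assumes f: "f \<in> L2 M" and g: "g \<in> L2 M"
  shows "L2_norm M (\<lambda>x. f x + g x) \<le> L2_norm M f + L2_norm M g"
proof (rule power2_le_imp_le)
  have "(cmod (f x + g x))\<^sup>2 \<le> (cmod (f x))\<^sup>2 + 2 * cmod (f x * g x) + (cmod (g x))\<^sup>2" for x
  proof -
    have "(cmod (f x + g x))\<^sup>2 \<le> (cmod (f x) + cmod (g x))\<^sup>2"
      by (simp add: power_mono norm_triangle_ineq)
    thus ?thesis by (simp add: power2_eq_square algebra_simps norm_mult)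
  qed
  hence "(L2_norm M (\<lambda>x. f x + g x))\<^sup>2
      \<le> (LINT x|M. (cmod (f x))\<^sup>2 + 2 * cmod (f x * g x) + (cmod (g x))\<^sup>2)"
    unfolding L2_norm_square
    using L2_square_integrable[OF L2_add[OF f g]] L2_square_integrable[OF f]
      L2_square_integrable[OF g] L2_product_integrable[OF f g]
    by (intro integral_mono) auto
  also have "\<dots> = (L2_norm M f)\<^sup>2 + 2 * (LINT x|M. cmod (f x * g x)) + (L2_norm M g)\<^sup>2"
    using L2_square_integrable[OF f] L2_square_integrable[OF g] L2_product_integrable[OF f g]
    by (simp add: L2_norm_square)
  also have "\<dots> \<le> (L2_norm M f + L2_norm M g)\<^sup>2"
    using L2_Cauchy_Schwarz_cmod[OF f g] by (simp add: power2_eq_square algebra_simps)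
  finally show "(L2_norm M (\<lambda>x. f x + g x))\<^sup>2 \<le> (L2_norm M f + L2_norm M g)\<^sup>2" .
qed simp

lemma L2_norm_triangle_diff:
  assumes "f \<in> L2 M" "g \<in> L2 M" "h \<in> L2 M"
  shows "L2_norm M (\<lambda>x. f x - h x) \<le> L2_norm M (\<lambda>x. f x - g x) + L2_norm M (\<lambda>x. g x - h x)"
  using L2_norm_triangle[OF L2_diff[OF assms(1,2)] L2_diff[OF assms(2,3)]] by simp

lemma L2_norm_sum:
  assumes "\<And>i. i \<in> I \<Longrightarrow> f i \<in> L2 M"
  shows "L2_norm M (\<lambda>x. \<Sum>i\<in>I. f i x) \<le> (\<Sum>i\<in>I. L2_norm M (f i))"
  using assms
proof (induction I rule: infinite_finite_induct)
  case (insert i I)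
  have "L2_norm M (\<lambda>x. \<Sum>j\<in>insert i I. f j x) = L2_norm M (\<lambda>x. f i x + (\<Sum>j\<in>I. f j x))"
    using insert by simp
  also have "\<dots> \<le> L2_norm M (f i) + L2_norm M (\<lambda>x. \<Sum>j\<in>I. f j x)"
    using insert by (intro L2_norm_triangle L2_sum) auto
  also have "\<dots> \<le> (\<Sum>j\<in>insert i I. L2_norm M (f j))" using insert by simp
  finally show ?case .
qed (simp_all add: L2_norm_def)

section \<open>Convergence in norm and convergence of series\<close>

lemma L2_inner_tendsto_left:
  assumes X: "\<And>n. X n \<in> L2 M" and f: "f \<in> L2 M" and g: "g \<in> L2 M"
    and lim: "(\<lambda>n. L2_norm M (\<lambda>x. X n x - f x)) \<longlonglongrightarrow> 0"
  shows "(\<lambda>n. L2_inner M (X n) g) \<longlonglongrightarrow> L2_inner M f g"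
proof (rule LIM_zero_cancel, rule tendsto_0_le[where K = "L2_norm M g", OF lim], rule always_eventually, rule allI)
  fix n
  have "L2_inner M (X n) g - L2_inner M f g = L2_inner M (\<lambda>x. X n x - f x) g"
    by (simp add: L2_inner_diff_left X f g)
  thus "norm (L2_inner M (X n) g - L2_inner M f g)
      \<le> norm (L2_norm M (\<lambda>x. X n x - f x)) * L2_norm M g"
    using L2_Cauchy_Schwarz[OF L2_diff[OF X f] g] by simp
qed

lemma L2_inner_tendsto_right:
  assumes "\<And>n. X n \<in> L2 M" "f \<in> L2 M" "g \<in> L2 M"
    and "(\<lambda>n. L2_norm M (\<lambda>x. X n x - f x)) \<longlonglongrightarrow> 0"
  shows "(\<lambda>n. L2_inner M g (X n)) \<longlonglongrightarrow> L2_inner M g f"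
  using tendsto_cnj[OF L2_inner_tendsto_left[OF assms]]
  by (simp flip: L2_inner_cnj_commute)

lemma L2_norm_tendsto:
  assumes X: "\<And>n. X n \<in> L2 M" and f: "f \<in> L2 M"
    and lim: "(\<lambda>n. L2_norm M (\<lambda>x. X n x - f x)) \<longlonglongrightarrow> 0"
  shows "(\<lambda>n. L2_norm M (X n)) \<longlonglongrightarrow> L2_norm M f"
proof (rule LIM_zero_cancel, rule tendsto_0_le[where K = 1, OF lim], rule always_eventually, rule allI)
  fix n
  show "norm (L2_norm M (X n) - L2_norm M f) \<le> norm (L2_norm M (\<lambda>x. X n x - f x)) * 1"
    using L2_norm_triangle[OF L2_diff[OF X[of n] f] f] L2_norm_triangle[OF L2_diff[OF f X[of n]] X[of n]]
    by (simp add: L2_norm_minus_commute[of M f] abs_le_iff)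
qed

text \<open>Fatou's lemma for |X_n - X_m|^2 with m fixed and n tending to infinity transfers the
  Cauchy estimate to |f - X_m|. A single m then puts f = (f - X_m) + X_m into the space.\<close>

lemma L2_limit_of_Cauchy:
  assumes X: "\<And>n. X n \<in> L2 M" and f: "f \<in> borel_measurable M"
    and lim: "AE x in M. (\<lambda>n. X n x) \<longlonglongrightarrow> f x"
    and Cauchy: "\<And>e. e > 0 \<Longrightarrow> \<exists>N. \<forall>m\<ge>N. \<forall>n\<ge>N. L2_norm M (\<lambda>x. X n x - X m x) \<le> e"
  shows "f \<in> L2 M" and "(\<lambda>n. L2_norm M (\<lambda>x. X n x - f x)) \<longlonglongrightarrow> 0"
proof -
  note [measurable] = f L2_measurable[OF X]
  have tail: "(\<lambda>x. f x - X m x) \<in> L2 M \<and> L2_norm M (\<lambda>x. f x - X m x) \<le> e"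
    if e: "e > 0" and N: "\<forall>n\<ge>N. L2_norm M (\<lambda>x. X n x - X m x) \<le> e" for e m N
  proof -
    have "(\<integral>\<^sup>+x. ennreal ((cmod (f x - X m x))\<^sup>2) \<partial>M)
        = (\<integral>\<^sup>+x. liminf (\<lambda>n. ennreal ((cmod (X n x - X m x))\<^sup>2)) \<partial>M)"
    proof (rule nn_integral_cong_AE, use lim in eventually_elim)
      fix x assume "(\<lambda>n. X n x) \<longlonglongrightarrow> f x"
      hence "(\<lambda>n. ennreal ((cmod (X n x - X m x))\<^sup>2)) \<longlonglongrightarrow> ennreal ((cmod (f x - X m x))\<^sup>2)"
        by (intro tendsto_intros tendsto_ennrealI)
      thus "ennreal ((cmod (f x - X m x))\<^sup>2) = liminf (\<lambda>n. ennreal ((cmod (X n x - X m x))\<^sup>2))"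
        by (rule lim_imp_Liminf[symmetric, rotated]) simp
    qed
    also have "\<dots> \<le> liminf (\<lambda>n. \<integral>\<^sup>+x. ennreal ((cmod (X n x - X m x))\<^sup>2) \<partial>M)"
      by (rule nn_integral_liminf) simp
    also have "\<dots> \<le> limsup (\<lambda>n. \<integral>\<^sup>+x. ennreal ((cmod (X n x - X m x))\<^sup>2) \<partial>M)"
      by (rule Liminf_le_Limsup) simp
    also have "\<dots> \<le> ennreal (e\<^sup>2)"
    proof (rule Limsup_bounded, rule eventually_sequentiallyI[of N])
      fix n assume "N \<le> n"
      show "(\<integral>\<^sup>+x. ennreal ((cmod (X n x - X m x))\<^sup>2) \<partial>M) \<le> ennreal (e\<^sup>2)"
        unfolding nn_integral_L2[OF L2_diff[OF X X]]
        using N \<open>N \<le> n\<close> by (intro ennreal_leI power_mono) auto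
    qed
    finally show ?thesis
      using nn_integral_L2_bound[of "\<lambda>x. f x - X m x" M e] e by simp
  qed
  obtain N where "\<forall>m\<ge>N. \<forall>n\<ge>N. L2_norm M (\<lambda>x. X n x - X m x) \<le> 1"
    using Cauchy[of 1] by auto
  hence "(\<lambda>x. f x - X N x) \<in> L2 M" using tail[of 1 N N] by simp
  from L2_add[OF this X[of N]] show "f \<in> L2 M" by simp
  show "(\<lambda>n. L2_norm M (\<lambda>x. X n x - f x)) \<longlonglongrightarrow> 0"
  proof (rule LIMSEQ_I)
    fix r :: real assume r: "r > 0"
    obtain N where "\<forall>m\<ge>N. \<forall>n\<ge>N. L2_norm M (\<lambda>x. X n x - X m x) \<le> r / 2"
      using Cauchy[of "r / 2"] r by auto
    hence "L2_norm M (\<lambda>x. f x - X m x) \<le> r / 2" if "m \<ge> N" for m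
      using tail[of "r / 2" N m] r that by auto
    hence "\<forall>m\<ge>N. norm (L2_norm M (\<lambda>x. X m x - f x) - 0) < r"
      using r by (force simp: L2_norm_minus_commute[of M _ f])
    thus "\<exists>N. \<forall>m\<ge>N. norm (L2_norm M (\<lambda>x. X m x - f x) - 0) < r" by blast
  qed
qed

text \<open>The exponent p covers two kinds of series: p = 1 when the norms of the terms are
  summable, and p = 2 for orthogonal series, where the squares of the norms add up.\<close>

lemma L2_limit_of_partial_sums:
  assumes f: "\<And>n. f n \<in> L2 M" and F: "F \<in> borel_measurable M" "AE x in M. (\<lambda>n. f n x) sums F x"
    and tails: "\<And>m n. m \<le> n \<Longrightarrow> L2_norm M (\<lambda>x. \<Sum>i=m..<n. f i x) ^ p \<le> (\<Sum>i=m..<n. b i)"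
    and b: "summable b" "\<And>n. 0 \<le> b n" and p: "p > 0"
  shows "F \<in> L2 M" and "(\<lambda>n. L2_norm M (\<lambda>x. (\<Sum>i<n. f i x) - F x)) \<longlonglongrightarrow> 0"
proof -
  have Cauchy: "\<exists>N. \<forall>m\<ge>N. \<forall>n\<ge>N. L2_norm M (\<lambda>x. (\<Sum>i<n. f i x) - (\<Sum>i<m. f i x)) \<le> e" if e: "e > 0" for e
  proof -
    \<comment> \<open>The Cauchy criterion for \<open>b\<close> is used at e ^ p, since the tails
      control only the p-th power of the norm.\<close>
    have "e ^ p > 0" using e by simp
    then obtain N where N: "\<And>m n. m \<ge> N \<Longrightarrow> norm (\<Sum>k=m..n. b k) < e ^ p"
      using summable_partial_sum_bound[OF b(1)] by blast
    have *: "L2_norm M (\<lambda>x. (\<Sum>i<n. f i x) - (\<Sum>i<m. f i x)) \<le> e" if "N \<le> m" "m \<le> n" for m n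
    proof -
      have "L2_norm M (\<lambda>x. \<Sum>i=m..<n. f i x) ^ p \<le> (\<Sum>i=m..<n. b i)" by (rule tails) fact
      also have "\<dots> \<le> (\<Sum>i=m..n. b i)" by (rule sum_mono2) (auto simp: b)
      also have "\<dots> \<le> e ^ p" using N[OF \<open>N \<le> m\<close>, of n] by simp
      finally have "L2_norm M (\<lambda>x. \<Sum>i=m..<n. f i x) \<le> e"
        using e p by (simp add: power_mono_iff)
      moreover have "(\<Sum>i<n. f i x) - (\<Sum>i<m. f i x) = (\<Sum>i=m..<n. f i x)" for x
        using sum_diff_nat_ivl[of 0 m n "\<lambda>i. f i x"] \<open>m \<le> n\<close> by (simp add: atLeast0LessThan)
      ultimately show ?thesis by simp
    qed
    show ?thesis
    proof (intro exI[of _ N] allI impI)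
      fix m n assume "N \<le> m" "N \<le> n"
      thus "L2_norm M (\<lambda>x. (\<Sum>i<n. f i x) - (\<Sum>i<m. f i x)) \<le> e"
        using *[of m n] *[of n m]
        by (cases "m \<le> n") (auto simp: L2_norm_minus_commute[of M "\<lambda>x. \<Sum>i<n. f i x"])
    qed
  qed
  have lim: "AE x in M. (\<lambda>n. \<Sum>i<n. f i x) \<longlonglongrightarrow> F x" using F(2) by (simp add: sums_def)
  show "F \<in> L2 M" "(\<lambda>n. L2_norm M (\<lambda>x. (\<Sum>i<n. f i x) - F x)) \<longlonglongrightarrow> 0"
    using L2_limit_of_Cauchy[of "\<lambda>n x. \<Sum>i<n. f i x", OF L2_sum[OF f] F(1) lim Cauchy] by auto
qed

text \<open>By the triangle inequality the partial sums of the |f_n| have norm at most C. Monotone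
  convergence makes the supremum of their squares integrable, hence finite almost everywhere. This
  gives the almost sure convergence of the random power series.\<close>

lemma AE_summable_L2_series:
  assumes f: "\<And>n. f n \<in> L2 M" and sm: "summable (\<lambda>n. L2_norm M (f n))"
  shows "AE x in M. summable (\<lambda>n. cmod (f n x))"
proof -
  note [measurable] = L2_measurable[OF f]
  define C where "C = (\<Sum>n. L2_norm M (f n))"
  define S where "S n x = (\<Sum>i<n. cmod (f i x))" for n x
  have S_nn: "0 \<le> S n x" for n x by (simp add: S_def sum_nonneg)
  have [measurable]: "S n \<in> borel_measurable M" for n
    unfolding S_def[abs_def] by measurable
  have bound: "(\<integral>\<^sup>+x. ennreal ((S n x)\<^sup>2) \<partial>M) \<le> ennreal (C\<^sup>2)" for n
  proof -
    have f': "(\<lambda>x. complex_of_real (cmod (f i x))) \<in> L2 M" for i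
      using f[of i] by (simp add: L2_iff)
    have "L2_norm M (\<lambda>x. \<Sum>i<n. complex_of_real (cmod (f i x)))
        \<le> (\<Sum>i<n. L2_norm M (\<lambda>x. complex_of_real (cmod (f i x))))"
      by (rule L2_norm_sum) (rule f')
    also have "\<dots> = (\<Sum>i<n. L2_norm M (f i))" by (simp add: L2_norm_def)
    also have "\<dots> \<le> C" unfolding C_def by (rule sum_le_suminf) (use sm in auto)
    finally have le: "L2_norm M (\<lambda>x. \<Sum>i<n. complex_of_real (cmod (f i x))) \<le> C" .
    have "(\<integral>\<^sup>+x. ennreal ((S n x)\<^sup>2) \<partial>M)
        = (\<integral>\<^sup>+x. ennreal ((cmod (\<Sum>i<n. complex_of_real (cmod (f i x))))\<^sup>2) \<partial>M)"
      by (simp add: S_def flip: of_real_sum)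
    also have "\<dots> = ennreal ((L2_norm M (\<lambda>x. \<Sum>i<n. complex_of_real (cmod (f i x))))\<^sup>2)"
      by (rule nn_integral_L2) (rule L2_sum, rule f')
    also have "\<dots> \<le> ennreal (C\<^sup>2)" using le by (intro ennreal_leI power_mono) auto
    finally show ?thesis .
  qed
  have "(\<integral>\<^sup>+x. (SUP n. ennreal ((S n x)\<^sup>2)) \<partial>M) = (SUP n. \<integral>\<^sup>+x. ennreal ((S n x)\<^sup>2) \<partial>M)"
  proof (rule nn_integral_monotone_convergence_SUP)
    have "S n x \<le> S (Suc n) x" for n x by (simp add: S_def)
    thus "incseq (\<lambda>n x. ennreal ((S n x)\<^sup>2))"
      by (intro incseq_SucI le_funI ennreal_leI power_mono S_nn)
  qed simp
  also have "\<dots> \<le> ennreal (C\<^sup>2)" by (rule SUP_least) (rule bound)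
  finally have "(\<integral>\<^sup>+x. (SUP n. ennreal ((S n x)\<^sup>2)) \<partial>M) \<noteq> \<infinity>"
    by (auto simp: top_unique)
  hence "AE x in M. (SUP n. ennreal ((S n x)\<^sup>2)) \<noteq> \<infinity>"
    by (intro nn_integral_PInf_AE) auto
  thus ?thesis
  proof eventually_elim
    fix x assume "(SUP n. ennreal ((S n x)\<^sup>2)) \<noteq> \<infinity>"
    then obtain r where r: "r \<ge> 0" "(SUP n. ennreal ((S n x)\<^sup>2)) = ennreal r"
      by (cases "SUP n. ennreal ((S n x)\<^sup>2)") auto
    have "S n x \<le> sqrt r" for n
    proof -
      have "ennreal ((S n x)\<^sup>2) \<le> ennreal r" unfolding r(2)[symmetric] by (rule SUP_upper) simp
      hence "(S n x)\<^sup>2 \<le> r" using r(1) by simp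
      thus ?thesis by (rule real_le_rsqrt)
    qed
    thus "summable (\<lambda>n. cmod (f n x))"
      unfolding S_def by (intro bounded_imp_summable[where B = "sqrt r"])
        (auto simp only: simp_thms norm_ge_zero simp flip: lessThan_Suc_atMost)
  qed
qed

lemma L2_series:
  assumes f: "\<And>n. f n \<in> L2 M" and sm: "summable (\<lambda>n. L2_norm M (f n))"
    and F: "F \<in> borel_measurable M" "AE x in M. (\<lambda>n. f n x) sums F x"
  shows "F \<in> L2 M" and "(\<lambda>n. L2_norm M (\<lambda>x. (\<Sum>i<n. f i x) - F x)) \<longlonglongrightarrow> 0"
proof -
  have "L2_norm M (\<lambda>x. \<Sum>i=m..<n. f i x) ^ 1 \<le> (\<Sum>i=m..<n. L2_norm M (f i))" for m n
    using L2_norm_sum[of "{m..<n}" f M, OF f] by simp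
  from L2_limit_of_partial_sums[OF f F this sm]
  show "F \<in> L2 M" "(\<lambda>n. L2_norm M (\<lambda>x. (\<Sum>i<n. f i x) - F x)) \<longlonglongrightarrow> 0" by auto
qed

section \<open>Orthonormal families and Bessel's inequality\<close>

definition L2_orthonormal :: "'a measure \<Rightarrow> ('i \<Rightarrow> 'a \<Rightarrow> complex) \<Rightarrow> 'i set \<Rightarrow> bool" where
  "L2_orthonormal M u I \<longleftrightarrow>
     (\<forall>i\<in>I. u i \<in> L2 M) \<and> (\<forall>i\<in>I. \<forall>j\<in>I. L2_inner M (u i) (u j) = (if i = j then 1 else 0))"

lemma L2_orthonormal_inner_lincomb:
  assumes "L2_orthonormal M u I" "F \<subseteq> I" "j \<in> I" "finite F"
  shows "L2_inner M (\<lambda>x. \<Sum>i\<in>F. c i * u i x) (u j) = (if j \<in> F then c j else 0)"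
proof -
  have "L2_inner M (\<lambda>x. \<Sum>i\<in>F. c i * u i x) (u j) = (\<Sum>i\<in>F. c i * L2_inner M (u i) (u j))"
    using assms by (intro L2_inner_lincomb_left) (auto simp: L2_orthonormal_def)
  also have "\<dots> = (\<Sum>i\<in>F. if i = j then c i else 0)"
    using assms by (intro sum.cong) (auto simp: L2_orthonormal_def)
  finally show ?thesis using assms(4) by simp
qed

lemma L2_orthonormal_norm_lincomb:
  assumes "L2_orthonormal M u I" "F \<subseteq> I" "finite F"
  shows "(L2_norm M (\<lambda>x. \<Sum>i\<in>F. c i * u i x))\<^sup>2 = (\<Sum>i\<in>F. (cmod (c i))\<^sup>2)"
proof -
  have u: "u i \<in> L2 M" if "i \<in> F" for i using assms that by (auto simp: L2_orthonormal_def)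
  let ?f = "\<lambda>x. \<Sum>i\<in>F. c i * u i x"
  have "complex_of_real ((L2_norm M ?f)\<^sup>2) = L2_inner M ?f ?f" by (rule L2_inner_self[symmetric])
  also have "\<dots> = (\<Sum>i\<in>F. cnj (c i) * L2_inner M ?f (u i))"
    by (rule L2_inner_lincomb_right) (use u in \<open>auto intro: L2_lincomb\<close>)
  also have "\<dots> = (\<Sum>i\<in>F. cnj (c i) * c i)"
    using assms by (intro sum.cong refl) (auto simp: L2_orthonormal_inner_lincomb subset_iff)
  also have "\<dots> = complex_of_real (\<Sum>i\<in>F. (cmod (c i))\<^sup>2)"
    unfolding of_real_sum by (intro sum.cong refl) (simp add: complex_norm_square mult.commute del: of_real_power)
  finally show ?thesis by (simp only: of_real_eq_iff)
qed

lemma L2_orthonormal_norm: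
  assumes "L2_orthonormal M u I" "i \<in> I"
  shows "L2_norm M (u i) = 1"
proof -
  have "complex_of_real ((L2_norm M (u i))\<^sup>2) = 1"
    using assms by (simp add: L2_orthonormal_def flip: L2_inner_self del: of_real_power)
  hence "(L2_norm M (u i))\<^sup>2 = 1" by (simp only: of_real_eq_1_iff)
  thus ?thesis using L2_norm_nonneg[of M "u i"] by (simp add: power2_eq_1_iff)
qed

lemma L2_orthonormal_cnj:
  assumes "L2_orthonormal M u I"
  shows "L2_orthonormal M (\<lambda>i x. cnj (u i x)) I"
  using assms by (auto simp: L2_orthonormal_def L2_cnj L2_inner_cnj_cnj)

text \<open>For the partial projection p one has <f, p> = S = ||p||^2, where S is the sum to be
  bounded. Cauchy-Schwarz gives S <= ||f|| sqrt S, and sqrt S cancels unless it is 0.\<close>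

lemma L2_Bessel:
  assumes on: "L2_orthonormal M u I" "F \<subseteq> I" "finite F" and f: "f \<in> L2 M"
  shows "(\<Sum>i\<in>F. (cmod (L2_inner M f (u i)))\<^sup>2) \<le> (L2_norm M f)\<^sup>2"
proof -
  define c where "c i = L2_inner M f (u i)" for i
  define p where "p x = (\<Sum>i\<in>F. c i * u i x)" for x
  define S where "S = (\<Sum>i\<in>F. (cmod (c i))\<^sup>2)"
  have u: "u i \<in> L2 M" if "i \<in> F" for i using assms that by (auto simp: L2_orthonormal_def)
  have p: "p \<in> L2 M" unfolding p_def[abs_def] by (rule L2_lincomb) (rule u)
  have S_nn: "S \<ge> 0" by (simp add: S_def sum_nonneg)
  have "L2_inner M f p = (\<Sum>i\<in>F. cnj (c i) * c i)"
    unfolding p_def[abs_def] by (subst L2_inner_lincomb_right) (auto simp: u f c_def)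
  also have "\<dots> = complex_of_real S"
    unfolding S_def of_real_sum
    by (intro sum.cong refl) (simp add: complex_norm_square mult.commute del: of_real_power)
  finally have "S = cmod (L2_inner M f p)" using S_nn by simp
  also have "\<dots> \<le> L2_norm M f * L2_norm M p" by (rule L2_Cauchy_Schwarz[OF f p])
  also have "L2_norm M p = sqrt S"
  proof -
    have "(L2_norm M p)\<^sup>2 = S"
      using L2_orthonormal_norm_lincomb[OF on, of c] by (simp add: p_def[abs_def] S_def)
    from arg_cong[OF this, of sqrt] show ?thesis by simp
  qed
  finally have "S \<le> L2_norm M f * sqrt S" .
  hence "sqrt S * sqrt S \<le> L2_norm M f * sqrt S" using S_nn by simp
  hence "sqrt S \<le> L2_norm M f"
    using S_nn by (cases "S = 0") (auto intro: mult_right_le_imp_le[of _ "sqrt S"])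
  hence "(sqrt S)\<^sup>2 \<le> (L2_norm M f)\<^sup>2" using S_nn by (intro power_mono) auto
  thus ?thesis using S_nn by (simp add: S_def c_def)
qed

lemma L2_Bessel_summable:
  assumes "L2_orthonormal M u UNIV" "f \<in> L2 M"
  shows "summable (\<lambda>i::nat. (cmod (L2_inner M f (u i)))\<^sup>2)"
  using L2_Bessel[OF assms(1) _ _ assms(2)]
  by (intro bounded_imp_summable[where B = "(L2_norm M f)\<^sup>2"]) auto

section \<open>Operators on classes of functions\<close>

lemma L2_linear_operatorD:
  assumes "L2_linear_operator M T" "f \<in> L2 M"
  shows "T f \<in> L2 M"
    and "g \<in> L2 M \<Longrightarrow> AE x in M. T (\<lambda>y. f y + g y) x = T f x + T g x"
    and "AE x in M. T (\<lambda>y. c * f y) x = c * T f x"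
  using assms by (auto simp: L2_linear_operator_def)

text \<open>The image of 0 vanishes only almost everywhere, by the scaling clause with c = 0; the
  inner product does not see the difference.\<close>

lemma L2_linear_operator_inner_zero:
  assumes "L2_linear_operator M T" "g \<in> L2 M"
  shows "L2_inner M (T (\<lambda>_. 0)) g = 0"
proof -
  have "AE x in M. T (\<lambda>_. 0) x = 0"
    using L2_linear_operatorD(3)[OF assms(1) L2_zero, of 0] by simp
  hence "L2_inner M (T (\<lambda>_. 0)) g = L2_inner M (\<lambda>_. 0) g"
    by (intro L2_inner_cong_AE L2_linear_operatorD(1)[OF assms(1)] assms(2)) simp_all
  thus ?thesis by (simp add: L2_inner_def)
qed

text \<open>Each use of additivity or homogeneity costs a null set. Under an inner product these
  disappear and linearity becomes an exact equation.\<close>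

lemma L2_linear_operator_inner_lincomb:
  fixes n :: nat
  assumes T: "L2_linear_operator M T" and f: "\<And>i. f i \<in> L2 M" and g: "g \<in> L2 M"
  shows "L2_inner M (T (\<lambda>x. \<Sum>i<n. c i * f i x)) g = (\<Sum>i<n. c i * L2_inner M (T (f i)) g)"
proof (induction n)
  case 0
  show ?case using L2_linear_operator_inner_zero[OF T g] by simp
next
  case (Suc n)
  let ?S = "\<lambda>x. \<Sum>i<n. c i * f i x"
  have S: "?S \<in> L2 M" by (intro L2_lincomb f)
  note TL2 = L2_linear_operatorD(1)[OF T]
  have "AE x in M. T (\<lambda>x. ?S x + c n * f n x) x = T ?S x + c n * T (f n) x"
    using L2_linear_operatorD(2)[OF T S L2_scale[OF f], of "c n" n] L2_linear_operatorD(3)[OF T f, of "c n" n]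
    by eventually_elim simp
  hence "L2_inner M (T (\<lambda>x. ?S x + c n * f n x)) g = L2_inner M (\<lambda>x. T ?S x + c n * T (f n) x) g"
    by (intro L2_inner_cong_AE TL2 L2_add L2_scale S f g)
  also have "\<dots> = L2_inner M (T ?S) g + c n * L2_inner M (T (f n)) g"
    by (subst L2_inner_add_left) (auto intro: TL2 S L2_scale f g simp: L2_inner_scale_left)
  finally show ?case using Suc by simp
qed

section \<open>Area measure on the disk and the Bergman basis\<close>

text \<open>Lebesgue measure is determined by its values on boxes, and a box in the plane is a
  product of intervals. This opens the way to Fubini's theorem in the coordinates Re and Im.\<close>

lemma lborel_complex: "lborel = distr (lborel \<Otimes>\<^sub>M lborel) borel (\<lambda>(x, y). Complex x y)"
proof (rule lborel_eqI)
  have [measurable]: "(\<lambda>p. Complex (fst p) (snd p)) \<in> borel_measurable borel"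
    unfolding Complex_eq by (intro borel_measurable_continuous_onI continuous_intros)
  have meas: "(\<lambda>(x, y). Complex x y) \<in> borel_measurable (lborel \<Otimes>\<^sub>M lborel)"
    by (simp add: lborel_prod case_prod_unfold)
  fix l u :: complex assume le: "\<And>b. b \<in> Basis \<Longrightarrow> l \<bullet> b \<le> u \<bullet> b"
  have le': "Re l \<le> Re u" "Im l \<le> Im u"
    using le[of 1] le[of \<i>] by (auto simp: Basis_complex_def)
  have "(\<lambda>(x, y). Complex x y) -` box l u = {Re l<..<Re u} \<times> {Im l<..<Im u}"
    by (auto simp: in_box_complex_iff)
  hence "emeasure (distr (lborel \<Otimes>\<^sub>M lborel) borel (\<lambda>(x, y). Complex x y)) (box l u)
      = emeasure (lborel \<Otimes>\<^sub>M lborel) ({Re l<..<Re u} \<times> {Im l<..<Im u})"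
    using meas by (subst emeasure_distr) (auto simp: space_pair_measure)
  also have "\<dots> = ennreal (Re u - Re l) * ennreal (Im u - Im l)"
    using le' by (subst lborel.emeasure_pair_measure_Times) auto
  also have "\<dots> = (\<Prod>b\<in>Basis. (u - l) \<bullet> b)"
    using le' by (simp add: Basis_complex_def ennreal_mult)
  finally show "emeasure (distr (lborel \<Otimes>\<^sub>M lborel) borel (\<lambda>(x, y). Complex x y)) (box l u)
      = (\<Prod>b\<in>Basis. (u - l) \<bullet> b)" .
qed simp

text \<open>Both orders of integration are recorded because a shear moves one coordinate and fixes
  the other: the inner integral has to run over the moving one.\<close>

lemma nn_integral_lborel_complex:
  assumes f: "f \<in> borel_measurable borel"
  shows "(\<integral>\<^sup>+z. f z \<partial>lborel) = (\<integral>\<^sup>+y. \<integral>\<^sup>+x. f (Complex x y) \<partial>lborel \<partial>lborel)"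
    and "(\<integral>\<^sup>+z. f z \<partial>lborel) = (\<integral>\<^sup>+x. \<integral>\<^sup>+y. f (Complex x y) \<partial>lborel \<partial>lborel)"
proof -
  have "(\<lambda>p. Complex (fst p) (snd p)) \<in> borel_measurable borel"
    unfolding Complex_eq by (intro borel_measurable_continuous_onI continuous_intros)
  hence meas [measurable]: "(\<lambda>(x, y). Complex x y) \<in> borel_measurable (lborel \<Otimes>\<^sub>M lborel)"
    by (simp add: lborel_prod case_prod_unfold)
  note [measurable] = f
  have eq: "(\<integral>\<^sup>+z. f z \<partial>lborel) = (\<integral>\<^sup>+p. f (case p of (x, y) \<Rightarrow> Complex x y) \<partial>(lborel \<Otimes>\<^sub>M lborel))"
    by (subst lborel_complex, subst nn_integral_distr) auto
  show "(\<integral>\<^sup>+z. f z \<partial>lborel) = (\<integral>\<^sup>+y. \<integral>\<^sup>+x. f (Complex x y) \<partial>lborel \<partial>lborel)"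
    unfolding eq by (subst lborel_pair.nn_integral_snd[symmetric]) auto
  show "(\<integral>\<^sup>+z. f z \<partial>lborel) = (\<integral>\<^sup>+x. \<integral>\<^sup>+y. f (Complex x y) \<partial>lborel \<partial>lborel)"
    unfolding eq by (subst lborel.nn_integral_fst[symmetric]) auto
qed

text \<open>For fixed y = Im z the shear translates the real line by c * y, and the inner integral
  is translation invariant.\<close>

lemma nn_integral_shear_Re:
  fixes c :: real and f :: "complex \<Rightarrow> ennreal"
  assumes f [measurable]: "f \<in> borel_measurable borel"
  shows "(\<integral>\<^sup>+z. f (z + of_real (c * Im z)) \<partial>lborel) = (\<integral>\<^sup>+z. f z \<partial>lborel)"
proof -
  have m: "(\<lambda>z::complex. z + of_real (c * Im z)) \<in> borel_measurable borel"
    by (intro borel_measurable_continuous_onI continuous_intros)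
  have "(\<lambda>x. Complex x y) \<in> borel_measurable borel" for y
    unfolding Complex_eq by (intro borel_measurable_continuous_onI continuous_intros)
  note [measurable] = m this
  have "(\<integral>\<^sup>+z. f (z + of_real (c * Im z)) \<partial>lborel)
      = (\<integral>\<^sup>+y. \<integral>\<^sup>+x. f (Complex (c * y + 1 * x) y) \<partial>lborel \<partial>lborel)"
    by (subst nn_integral_lborel_complex(1)) (auto simp: complex_eq_iff intro!: nn_integral_cong arg_cong[of _ _ f])
  also have "\<dots> = (\<integral>\<^sup>+y. \<integral>\<^sup>+x. f (Complex x y) \<partial>lborel \<partial>lborel)"
  proof (rule nn_integral_cong)
    fix y
    show "(\<integral>\<^sup>+x. f (Complex (c * y + 1 * x) y) \<partial>lborel) = (\<integral>\<^sup>+x. f (Complex x y) \<partial>lborel)"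
      using nn_integral_real_affine[of "\<lambda>x. f (Complex x y)" 1 "c * y"] by simp
  qed
  also have "\<dots> = (\<integral>\<^sup>+z. f z \<partial>lborel)" by (rule nn_integral_lborel_complex(1)[symmetric]) simp
  finally show ?thesis .
qed

lemma nn_integral_shear_Im:
  fixes c :: real and f :: "complex \<Rightarrow> ennreal"
  assumes f [measurable]: "f \<in> borel_measurable borel"
  shows "(\<integral>\<^sup>+z. f (z + \<i> * of_real (c * Re z)) \<partial>lborel) = (\<integral>\<^sup>+z. f z \<partial>lborel)"
proof -
  have m: "(\<lambda>z::complex. z + \<i> * of_real (c * Re z)) \<in> borel_measurable borel"
    by (intro borel_measurable_continuous_onI continuous_intros)
  have "(\<lambda>y. Complex x y) \<in> borel_measurable borel" for x
    unfolding Complex_eq by (intro borel_measurable_continuous_onI continuous_intros)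
  note [measurable] = m this
  have "(\<integral>\<^sup>+z. f (z + \<i> * of_real (c * Re z)) \<partial>lborel)
      = (\<integral>\<^sup>+x. \<integral>\<^sup>+y. f (Complex x (c * x + 1 * y)) \<partial>lborel \<partial>lborel)"
    by (subst nn_integral_lborel_complex(2)) (auto simp: complex_eq_iff intro!: nn_integral_cong arg_cong[of _ _ f])
  also have "\<dots> = (\<integral>\<^sup>+x. \<integral>\<^sup>+y. f (Complex x y) \<partial>lborel \<partial>lborel)"
  proof (rule nn_integral_cong)
    fix x
    show "(\<integral>\<^sup>+y. f (Complex x (c * x + 1 * y)) \<partial>lborel) = (\<integral>\<^sup>+y. f (Complex x y) \<partial>lborel)"
      using nn_integral_real_affine[of "\<lambda>y. f (Complex x y)" 1 "c * x"] by simp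
  qed
  also have "\<dots> = (\<integral>\<^sup>+z. f z \<partial>lborel)" by (rule nn_integral_lborel_complex(2)[symmetric]) simp
  finally show ?thesis .
qed

text \<open>A rotation other than the half-turn is a product of three shears.\<close>

lemma lborel_distr_rotation:
  fixes u :: complex
  assumes u: "cmod u = 1" "u \<noteq> -1"
  shows "distr lborel borel ((*) u) = lborel"
proof (rule measure_eqI)
  \<comment> \<open>For u = exp(i \<theta>) these are s = sin \<theta> and t = tan (\<theta>/2). The
    shears x - t y, then y + s x, then x - t y again compose to the rotation by \<theta>. The
    half-turn is excluded because tan (\<theta>/2) has its pole there.\<close>
  define s t where "s = Im u" and "t = Im u / (1 + Re u)"
  have sq: "(Re u)\<^sup>2 + (Im u)\<^sup>2 = 1" using u(1) by (simp add: cmod_def)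
  have nz: "1 + Re u \<noteq> 0"
  proof
    assume "1 + Re u = 0"
    hence "Re u = -1" by simp
    with sq have "Im u = 0" by simp
    with \<open>Re u = -1\<close> u(2) show False by (simp add: complex_eq_iff)
  qed
  have t1: "t * s = 1 - Re u"
  proof -
    have "s * s = (1 - Re u) * (1 + Re u)" using sq by (simp add: s_def power2_eq_square algebra_simps)
    thus ?thesis using nz by (simp add: t_def s_def field_simps)
  qed
  have t2: "t * (1 + Re u) = s" using nz by (simp add: t_def s_def)
  define R where "R z = z + complex_of_real (- t * Im z)" for z
  define I where "I z = z + \<i> * complex_of_real (s * Re z)" for z
  have RIR: "R (I (R z)) = u * z" for z
  proof (rule complex_eqI)
    have ts2: "t * 2 - t * (t * s) = s" unfolding t1 using t2 by (simp add: algebra_simps)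
    have "Re (R (I (R z))) = (1 - t * s) * Re z - (t * 2 - t * (t * s)) * Im z"
      by (simp add: R_def I_def algebra_simps)
    also have "\<dots> = Re (u * z)" unfolding ts2 by (simp add: t1) (simp add: s_def)
    finally show "Re (R (I (R z))) = Re (u * z)" .
    have "Im (R (I (R z))) = (1 - t * s) * Im z + s * Re z"
      by (simp add: R_def I_def algebra_simps)
    also have "\<dots> = Im (u * z)" by (simp add: t1) (simp add: s_def)
    finally show "Im (R (I (R z))) = Im (u * z)" .
  qed
  have [measurable]: "R \<in> borel_measurable borel" "I \<in> borel_measurable borel"
    unfolding R_def[abs_def] I_def[abs_def]
    by (intro borel_measurable_continuous_onI continuous_intros)+
  fix A assume "A \<in> sets (distr lborel borel ((*) u))"
  hence A [measurable]: "A \<in> sets borel" by simp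
  have "emeasure (distr lborel borel ((*) u)) A = (\<integral>\<^sup>+z. indicator A z \<partial>distr lborel borel ((*) u))"
    by simp
  also have "\<dots> = (\<integral>\<^sup>+z. indicator A (u * z) \<partial>lborel)"
    by (rule nn_integral_distr) auto
  also have "\<dots> = (\<integral>\<^sup>+z. indicator A (R (I (R z))) \<partial>lborel)" by (simp add: RIR)
  also have "\<dots> = (\<integral>\<^sup>+z. indicator A (R (I z)) \<partial>lborel)"
    using nn_integral_shear_Re[of "\<lambda>z. indicator A (R (I z))" "- t"]
    unfolding R_def[symmetric] by measurable
  also have "\<dots> = (\<integral>\<^sup>+z. indicator A (R z) \<partial>lborel)"
    using nn_integral_shear_Im[of "\<lambda>z. indicator A (R z)" s]
    unfolding I_def[symmetric] by measurable
  also have "\<dots> = (\<integral>\<^sup>+z. indicator A z \<partial>lborel)"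
    using nn_integral_shear_Re[of "indicator A" "- t"]
    unfolding R_def[symmetric] by measurable
  also have "\<dots> = emeasure lborel A" by simp
  finally show "emeasure (distr lborel borel ((*) u)) A = emeasure lborel A" .
qed simp

section \<open>Normalized area: rotation invariance and the law of |z|^2\<close>

lemma space_disk_area [simp]: "space disk_area = unit_disk"
  by (simp add: disk_area_def space_restrict_space)

lemma borel_measurable_disk_area:
  assumes "f \<in> borel_measurable borel"
  shows "f \<in> borel_measurable disk_area"
  unfolding disk_area_def using assms by (simp add: measurable_restrict_space1)

lemma emeasure_disk_area:
  assumes "A \<in> sets borel"
  shows "emeasure disk_area (A \<inter> unit_disk) = emeasure lborel (A \<inter> unit_disk) / ennreal pi"
proof -
  have "A \<inter> unit_disk \<in> sets (restrict_space lborel unit_disk)"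
    using assms by (auto simp: sets_restrict_space)
  thus ?thesis
    unfolding disk_area_def
    by (simp add: emeasure_density_const emeasure_restrict_space divide_ennreal_def mult.commute
        flip: inverse_ennreal inverse_eq_divide)
qed

interpretation disk_area: prob_space disk_area
proof
  have "emeasure disk_area (UNIV \<inter> unit_disk) = 1"
    by (subst emeasure_disk_area) (simp_all add: emeasure_ball unit_ball_vol_2 ennreal_divide_self)
  thus "emeasure disk_area (space disk_area) = 1" by simp
qed

lemma integral_disk_area:
  fixes f :: "complex \<Rightarrow> complex"
  assumes "f \<in> borel_measurable borel"
  shows "(LINT z|disk_area. f z) = (LINT z|lborel. indicator unit_disk z *\<^sub>R f z) / pi"
proof -
  have "(LINT z|disk_area. f z) = (LINT z|restrict_space lborel unit_disk. (1 / pi) *\<^sub>R f z)"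
    unfolding disk_area_def
    by (rule integral_density) (use assms in \<open>auto intro: measurable_restrict_space1\<close>)
  also have "\<dots> = (1 / pi) *\<^sub>R (LINT z|restrict_space lborel unit_disk. f z)"
    by (rule integral_scaleR_right)
  also have "(LINT z|restrict_space lborel unit_disk. f z) = (LINT z|lborel. indicator unit_disk z *\<^sub>R f z)"
    by (rule integral_restrict_space) simp
  finally show ?thesis by (simp add: scaleR_conv_of_real)
qed

lemma integral_disk_area_rotation:
  fixes f :: "complex \<Rightarrow> complex"
  assumes f [measurable]: "f \<in> borel_measurable borel" and u: "cmod u = 1" "u \<noteq> -1"
  shows "(LINT z|disk_area. f (u * z)) = (LINT z|disk_area. f z)"
proof -
  have "(LINT z|lborel. indicator unit_disk z *\<^sub>R f z)
      = (LINT z|distr lborel borel ((*) u). indicator unit_disk z *\<^sub>R f z)"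
    by (simp add: lborel_distr_rotation u)
  also have "\<dots> = (LINT z|lborel. indicator unit_disk (u * z) *\<^sub>R f (u * z))"
    by (rule integral_distr) (auto intro!: borel_measurable_scaleR borel_measurable_indicator)
  also have "\<dots> = (LINT z|lborel. indicator unit_disk z *\<^sub>R f (u * z))"
    using u(1) by (intro Bochner_Integration.integral_cong refl) (simp add: indicator_def norm_mult)
  finally show ?thesis by (simp add: integral_disk_area)
qed

text \<open>The disk of radius sqrt x has normalized area x, so the two distribution functions
  agree. Radial integrals thereby become integrals over [0, 1], without polar coordinates.\<close>

lemma distr_disk_area_cmod_square:
  "distr disk_area borel (\<lambda>z. (cmod z)\<^sup>2) = uniform_measure lborel {0..1::real}"
proof (rule cdf_unique)
  have [measurable]: "(\<lambda>z. (cmod z)\<^sup>2) \<in> borel_measurable disk_area"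
    by (rule borel_measurable_disk_area) simp
  interpret D: prob_space "distr disk_area borel (\<lambda>z. (cmod z)\<^sup>2)"
    by (rule disk_area.prob_space_distr) simp
  show "real_distribution (distr disk_area borel (\<lambda>z. (cmod z)\<^sup>2))"
    by (simp add: real_distribution_def real_distribution_axioms_def D.prob_space_axioms)
  interpret U: prob_space "uniform_measure lborel {0..1::real}"
    by (rule prob_space_uniform_measure) auto
  show "real_distribution (uniform_measure lborel {0..1::real})"
    by (simp add: real_distribution_def real_distribution_axioms_def U.prob_space_axioms)
  show "cdf (distr disk_area borel (\<lambda>z. (cmod z)\<^sup>2)) = cdf (uniform_measure lborel {0..1})"
  proof
    fix x :: real
    have "emeasure (distr disk_area borel (\<lambda>z. (cmod z)\<^sup>2)) {..x}
        = emeasure disk_area ({z. (cmod z)\<^sup>2 \<le> x} \<inter> unit_disk)"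
      by (subst emeasure_distr) (auto simp: vimage_def)
    also have "\<dots> = emeasure lborel ({z. (cmod z)\<^sup>2 \<le> x} \<inter> unit_disk) / ennreal pi"
      by (rule emeasure_disk_area) simp
    also have "\<dots> = emeasure lborel ({0..1} \<inter> {..x})"
    proof -
      consider "x < 0" | "0 \<le> x" "x < 1" | "1 \<le> x" by linarith
      thus ?thesis
      proof cases
        case 1
        hence "\<not> (cmod z)\<^sup>2 \<le> x" for z :: complex
          using zero_le_power2[of "cmod z"] by linarith
        hence "{z::complex. (cmod z)\<^sup>2 \<le> x} = {}" "{0..1} \<inter> {..x} = {}" using 1 by auto
        thus ?thesis by simp
      next
        case 2
        have "{z. (cmod z)\<^sup>2 \<le> x} \<inter> unit_disk = cball 0 (sqrt x)"
        proof (intro set_eqI iffI)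
          fix z :: complex assume "z \<in> cball 0 (sqrt x)"
          hence z: "cmod z \<le> sqrt x" by simp
          also have "sqrt x < 1" using 2 by simp
          finally have "cmod z < 1" .
          moreover have "(cmod z)\<^sup>2 \<le> x" using power_mono[OF z, of 2] 2 by simp
          ultimately show "z \<in> {z. (cmod z)\<^sup>2 \<le> x} \<inter> unit_disk" by simp
        qed (auto intro: real_le_rsqrt)
        moreover have "emeasure lborel (cball (0::complex) (sqrt x)) = ennreal (pi * x)"
          using 2 by (simp add: emeasure_cball unit_ball_vol_2)
        moreover have "{0..1} \<inter> {..x} = {0..x}" using 2 by auto
        ultimately show ?thesis using 2 by (simp add: divide_ennreal)
      next
        case 3
        have "(cmod z)\<^sup>2 \<le> x" if "cmod z < 1" for z :: complex
          using power_le_one[of "cmod z" 2] that 3 by simp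
        hence "{z. (cmod z)\<^sup>2 \<le> x} \<inter> unit_disk = unit_disk" by auto
        moreover have "{0..1} \<inter> {..x} = {0..1}" using 3 by auto
        ultimately show ?thesis by (simp add: emeasure_ball unit_ball_vol_2 ennreal_divide_self)
      qed
    qed
    also have "\<dots> = emeasure (uniform_measure lborel {0..1}) {..x}" by (simp add: divide_ennreal_def)
    finally show "cdf (distr disk_area borel (\<lambda>z. (cmod z)\<^sup>2)) x = cdf (uniform_measure lborel {0..1}) x"
      by (simp add: cdf_def measure_def)
  qed
qed

lemma integral_disk_area_cmod_power:
  "(LINT z|disk_area. cmod z ^ (2 * n)) = 1 / real (Suc n)"
proof -
  have "(LINT z|disk_area. cmod z ^ (2 * n)) = (LINT z|disk_area. ((cmod z)\<^sup>2) ^ n)"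
    by (simp add: power_mult)
  also have "\<dots> = (LINT x|distr disk_area borel (\<lambda>z. (cmod z)\<^sup>2). x ^ n)"
    by (rule integral_distr[symmetric]) (auto intro: borel_measurable_disk_area)
  also have "\<dots> = (LINT x|uniform_measure lborel {0..1}. x ^ n)" by (simp add: distr_disk_area_cmod_square)
  also have "\<dots> = (LINT x|lborel. x ^ n * indicator {0..1} x)"
  proof -
    have "uniform_measure lborel {0..1::real} = density lborel (\<lambda>x. ennreal (indicator {0..1} x))"
      by (simp add: uniform_measure_def divide_ennreal_def flip: ennreal_indicator)
    thus ?thesis by (simp add: integral_density mult.commute)
  qed
  also have "\<dots> = 1 / real (Suc n)" by (subst integral_power) auto
  finally show ?thesis .
qed

section \<open>The monomial basis of the Bergman space\<close>

definition bergman_basis :: "nat \<Rightarrow> complex \<Rightarrow> complex" where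
  "bergman_basis k z = of_real (sqrt (real (Suc k))) * z ^ k"

lemma bergman_basis_measurable: "bergman_basis k \<in> borel_measurable disk_area"
  unfolding bergman_basis_def[abs_def] by (intro borel_measurable_disk_area) simp

text \<open>The norms are moments of the uniform law of |z|^2. For j different from k, a rotation by
  u multiplies the integrand by u^j (cnj u)^k; by rotation invariance the integral is 0 as soon as
  this factor differs from 1.\<close>

lemma bergman_basis_orthonormal: "L2_orthonormal disk_area bergman_basis UNIV"
proof -
  have L2: "bergman_basis k \<in> L2 disk_area" for k
  proof -
    have "cmod (bergman_basis k z) \<le> sqrt (real (Suc k))" if "z \<in> unit_disk" for z :: complex
      using that by (auto simp: bergman_basis_def norm_mult norm_power intro!: mult_left_le power_le_one)
    hence "(cmod (bergman_basis k z))\<^sup>2 \<le> (sqrt (real (Suc k)))\<^sup>2" if "z \<in> unit_disk" for z :: complex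
      using that by (intro power_mono) auto
    hence "AE z in disk_area. norm ((cmod (bergman_basis k z))\<^sup>2) \<le> (sqrt (real (Suc k)))\<^sup>2"
      by (intro AE_I2) simp
    hence "integrable disk_area (\<lambda>z. (cmod (bergman_basis k z))\<^sup>2)"
      using bergman_basis_measurable by (intro disk_area.integrable_const_bound) auto
    thus ?thesis using bergman_basis_measurable by (simp add: L2_iff)
  qed
  have "L2_inner disk_area (bergman_basis j) (bergman_basis k) = (if j = k then 1 else 0)" for j k
  proof (cases "j = k")
    case True
    have "(L2_norm disk_area (bergman_basis k))\<^sup>2 = (LINT z|disk_area. real (Suc k) * cmod z ^ (2 * k))"
      unfolding L2_norm_square bergman_basis_def
      by (simp add: norm_mult norm_power power_mult_distrib mult.commute flip: power_mult)
    also have "\<dots> = 1" by (simp add: integral_disk_area_cmod_power)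
    finally show ?thesis using True by (simp add: L2_inner_self)
  next
    case False
    define f where "f z = bergman_basis j z * cnj (bergman_basis k z)" for z
    have f: "f \<in> borel_measurable borel"
      unfolding f_def[abs_def] bergman_basis_def
      by (intro borel_measurable_continuous_onI continuous_intros)
    define d :: nat where "d = (if j < k then k - j else j - k)"
    \<comment> \<open>Chosen so that u ^ d = \<i>, which makes the factor \<i> or -\<i>. Asking for
      u ^ d = -1 through the angle pi / d would give the excluded u = -1 when d = 1.\<close>
    define u where "u = cis (pi / (2 * real d))"
    have d: "d > 0" using False by (simp add: d_def)
    have u1: "cmod u = 1" by (simp add: u_def)
    have ud: "u ^ d = \<i>"
    using d by (simp only: u_def Complex.DeMoivre) (simp add: field_simps)
    have uu: "u * cnj u = 1" using u1 by (simp add: complex_norm_square[symmetric])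
    have um1: "u \<noteq> -1"
    proof
      assume "u = -1"
      hence "Re u = -1" by simp
      moreover have "Re u \<ge> 0"
      proof -
        have "pi / (2 * real d) \<le> pi / 2" using d by (intro divide_left_mono) auto
        moreover have "- (pi / 2) \<le> 0" "0 \<le> pi / (2 * real d)" by simp_all
        ultimately show ?thesis unfolding u_def cis.sel by (intro cos_ge_zero) linarith+
      qed
      ultimately show False by simp
    qed
    have "u ^ j * cnj u ^ k = (if j < k then - \<i> else \<i>)"
    proof (cases "j < k")
      case True
      hence k: "k = j + d" by (simp add: d_def)
      have "u ^ j * cnj u ^ k = (u * cnj u) ^ j * cnj (u ^ d)"
        unfolding k power_add power_mult_distrib by (simp add: mult.assoc)
      thus ?thesis using True by (simp add: uu ud)
    next
      case False
      hence j: "j = k + d" by (simp add: d_def)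
      have "u ^ j * cnj u ^ k = (u * cnj u) ^ k * u ^ d"
        unfolding j power_add power_mult_distrib by (simp add: mult_ac)
      thus ?thesis using False by (simp add: uu ud)
    qed
    moreover have "f (u * z) = (u ^ j * cnj u ^ k) * f z" for z
      by (simp add: f_def bergman_basis_def power_mult_distrib)
    ultimately have "(LINT z|disk_area. f z) = (if j < k then - \<i> else \<i>) * (LINT z|disk_area. f z)"
      using integral_disk_area_rotation[OF f u1 um1] by simp
    moreover have "(if j < k then - \<i> else \<i>) \<noteq> 1" by (simp add: complex_eq_iff)
    ultimately have "(LINT z|disk_area. f z) = 0" by (metis mult_cancel_right1)
    thus ?thesis using False by (simp add: L2_inner_def f_def)
  qed
  with L2 show ?thesis by (simp add: L2_orthonormal_def)
qed

section \<open>Contractions and the Szego kernel\<close>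

lemma bergman_basis_L2: "bergman_basis k \<in> L2 disk_area"
  using bergman_basis_orthonormal by (simp add: L2_orthonormal_def)

lemma bergman_basis_norm [simp]: "L2_norm disk_area (bergman_basis k) = 1"
  by (rule L2_orthonormal_norm[OF bergman_basis_orthonormal UNIV_I])

abbreviation (input) cnj_basis :: "nat \<Rightarrow> complex \<Rightarrow> complex" where
  "cnj_basis k \<equiv> (\<lambda>z. cnj (bergman_basis k z))"

text \<open>The coefficient of cnj s_z along cnj e_k, also <e_k, s_z>, hence analytic in z. The
  kernel s_z itself has the coefficients \<open>szego_coeff (cnj z) k\<close>.\<close>

definition szego_coeff :: "complex \<Rightarrow> nat \<Rightarrow> complex" where
  "szego_coeff z k = z ^ k / of_real (sqrt (real (Suc k)))"

lemma szego_coeff_bound: "cmod (szego_coeff z k) \<le> cmod z ^ k"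
proof -
  have "cmod (szego_coeff z k) = cmod z ^ k / sqrt (real (Suc k))"
    by (simp add: szego_coeff_def norm_divide norm_power)
  also have "\<dots> \<le> cmod z ^ k / 1" by (rule divide_left_mono) auto
  finally show ?thesis by simp
qed

lemma szego_sums:
  assumes z: "z \<in> unit_disk" and \<zeta>: "\<zeta> \<in> unit_disk"
  shows "(\<lambda>k. szego_coeff (cnj z) k * bergman_basis k \<zeta>) sums szego z \<zeta>"
proof -
  have "cmod z * cmod \<zeta> < 1 * 1"
    using z \<zeta> by (intro mult_strict_mono') auto
  hence "cmod (cnj z * \<zeta>) < 1" by (simp add: norm_mult)
  from geometric_sums[OF this]
  have "(\<lambda>k. (cnj z * \<zeta>) ^ k) sums szego z \<zeta>" by (simp add: szego_def)
  moreover have "szego_coeff (cnj z) k * bergman_basis k \<zeta> = (cnj z * \<zeta>) ^ k" for k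
  proof -
    have "complex_of_real (sqrt (real (Suc k))) \<noteq> 0" by (simp del: of_nat_Suc)
    thus ?thesis by (simp add: szego_coeff_def bergman_basis_def power_mult_distrib del: of_nat_Suc)
  qed
  ultimately show ?thesis by simp
qed

text \<open>The basis is normalized, so the k-th term has norm at most |z|^k, and the pointwise
  geometric series also converges in norm.\<close>

lemma szego_L2_series:
  assumes z: "z \<in> unit_disk"
  shows "szego z \<in> L2 disk_area"
    and "(\<lambda>n. L2_norm disk_area (\<lambda>\<zeta>. (\<Sum>k<n. szego_coeff (cnj z) k * bergman_basis k \<zeta>) - szego z \<zeta>)) \<longlonglongrightarrow> 0"
proof -
  have 1: "(\<lambda>\<zeta>. szego_coeff (cnj z) k * bergman_basis k \<zeta>) \<in> L2 disk_area" for k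
    by (intro L2_scale bergman_basis_L2)
  have 2: "summable (\<lambda>k. L2_norm disk_area (\<lambda>\<zeta>. szego_coeff (cnj z) k * bergman_basis k \<zeta>))"
  proof (rule summable_comparison_test')
    show "summable (\<lambda>k. cmod z ^ k)" using z by (intro summable_geometric) simp
    show "norm (L2_norm disk_area (\<lambda>\<zeta>. szego_coeff (cnj z) k * bergman_basis k \<zeta>)) \<le> cmod z ^ k" if "k \<ge> 0" for k
      using szego_coeff_bound[of "cnj z" k] by (simp add: L2_norm_scale)
  qed
  have 3: "szego z \<in> borel_measurable disk_area"
    unfolding szego_def[abs_def] by (intro borel_measurable_disk_area) simp
  have 4: "AE \<zeta> in disk_area. (\<lambda>k. szego_coeff (cnj z) k * bergman_basis k \<zeta>) sums szego z \<zeta>"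
    by (rule AE_I2) (use szego_sums[OF z] in simp)
  show "szego z \<in> L2 disk_area"
    "(\<lambda>n. L2_norm disk_area (\<lambda>\<zeta>. (\<Sum>k<n. szego_coeff (cnj z) k * bergman_basis k \<zeta>) - szego z \<zeta>)) \<longlonglongrightarrow> 0"
    by (rule L2_series[OF 1 2 3 4])+
qed

text \<open>The expanded function is s_w and not f, so f may lie outside the Bergman space, as the
  image under an arbitrary contraction can. Conjugation in the second slot turns
  \<open>cnj w\<close> into \<open>w\<close>.\<close>

lemma szego_inner_sums:
  assumes w: "w \<in> unit_disk" and f: "f \<in> L2 disk_area"
  shows "(\<lambda>k. szego_coeff w k * L2_inner disk_area f (bergman_basis k)) sums L2_inner disk_area f (szego w)"
proof -
  have "(\<lambda>n. L2_inner disk_area f (\<lambda>\<zeta>. \<Sum>k<n. szego_coeff (cnj w) k * bergman_basis k \<zeta>))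
      \<longlonglongrightarrow> L2_inner disk_area f (szego w)"
    by (intro L2_inner_tendsto_right L2_lincomb bergman_basis_L2 szego_L2_series w f)
  moreover have "L2_inner disk_area f (\<lambda>\<zeta>. \<Sum>k<n. szego_coeff (cnj w) k * bergman_basis k \<zeta>)
      = (\<Sum>k<n. szego_coeff w k * L2_inner disk_area f (bergman_basis k))" for n
    by (subst L2_inner_lincomb_right) (auto simp: bergman_basis_L2 f szego_coeff_def)
  ultimately show ?thesis by (simp add: sums_def)
qed

lemma szego_inner_basis:
  assumes "w \<in> unit_disk"
  shows "L2_inner disk_area (bergman_basis k) (szego w) = szego_coeff w k"
proof -
  have "(\<lambda>j. szego_coeff w j * (if k = j then 1 else 0)) sums L2_inner disk_area (bergman_basis k) (szego w)"
    using szego_inner_sums[OF assms bergman_basis_L2[of k]] bergman_basis_orthonormal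
    by (simp add: L2_orthonormal_def)
  moreover have "(\<lambda>j. szego_coeff w j * (if k = j then 1 else 0)) sums szego_coeff w k"
    using sums_single[of k "szego_coeff w"] by (simp add: if_distrib eq_commute[of k] cong: if_cong)
  ultimately show ?thesis by (rule sums_unique2)
qed

lemma cnj_szego_inner_cnj_basis:
  assumes "z \<in> unit_disk"
  shows "L2_inner disk_area (\<lambda>\<zeta>. cnj (szego z \<zeta>)) (cnj_basis k) = szego_coeff z k"
proof -
  have "L2_inner disk_area (\<lambda>\<zeta>. cnj (szego z \<zeta>)) (cnj_basis k) = L2_inner disk_area (bergman_basis k) (szego z)"
    by (simp add: L2_inner_def mult.commute)
  thus ?thesis by (simp only: szego_inner_basis[OF assms])
qed

text \<open>The sum is the Bergman kernel on the diagonal, 1 / (1 - |z|^2)^2, a differentiated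
  geometric series. Square-summable coefficients therefore give series that converge at every point
  of the disk.\<close>

lemma bergman_basis_square_summable:
  assumes "z \<in> unit_disk"
  shows "summable (\<lambda>k. (cmod (bergman_basis k z))\<^sup>2)"
proof -
  have "(cmod z)\<^sup>2 < 1" using assms by (simp add: power_less_one_iff)
  hence "summable (\<lambda>k. real (Suc k) * ((cmod z)\<^sup>2) ^ k)"
    using geometric_deriv_sums[of "(cmod z)\<^sup>2"] by (auto simp: sums_iff)
  moreover have "(cmod (bergman_basis k z))\<^sup>2 = real (Suc k) * ((cmod z)\<^sup>2) ^ k" for k
    by (simp add: bergman_basis_def norm_mult norm_power power_mult_distrib mult.commute flip: power_mult)
  ultimately show ?thesis by simp
qed

lemma summable_product_of_squares:
  fixes a b :: "nat \<Rightarrow> complex"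
  assumes "summable (\<lambda>k. (cmod (a k))\<^sup>2)" "summable (\<lambda>k. (cmod (b k))\<^sup>2)"
  shows "summable (\<lambda>k. a k * b k)"
proof (rule summable_comparison_test')
  show "summable (\<lambda>k. (cmod (a k))\<^sup>2 + (cmod (b k))\<^sup>2)" by (rule summable_add) (fact assms)+
  have "2 * (x * y) \<le> x\<^sup>2 + y\<^sup>2 \<and> 0 \<le> x * y" if "0 \<le> x" "0 \<le> y" for x y :: real
    using zero_le_power2[of "x - y"] that unfolding power2_diff by simp
  from this[of "cmod (a k)" "cmod (b k)" for k]
  show "norm (a k * b k) \<le> (cmod (a k))\<^sup>2 + (cmod (b k))\<^sup>2" for k
    unfolding norm_mult by (smt (verit) norm_ge_zero)
qed

text \<open>The Riesz-Fischer theorem for the Bergman space. \<open>F\<close> is defined by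
  pointwise sums, so it is a concrete representative; orthogonality gives the tail estimate with p =
  2, and the last claim pairs the series with s_w term by term.\<close>

lemma bergman_series:
  fixes t :: "nat \<Rightarrow> complex"
  assumes t: "\<And>n. (\<Sum>k<n. (cmod (t k))\<^sup>2) \<le> C\<^sup>2" and C: "0 \<le> C"
  defines "F \<equiv> (\<lambda>z. \<Sum>k. t k * bergman_basis k z)"
  shows "F \<in> L2 disk_area" "L2_norm disk_area F \<le> C"
    and "w \<in> unit_disk \<Longrightarrow> (\<lambda>k. t k * szego_coeff w k) sums L2_inner disk_area F (szego w)"
proof -
  have tsum: "summable (\<lambda>k. (cmod (t k))\<^sup>2)"
    by (rule bounded_imp_summable[where B = "C\<^sup>2"]) (use t in \<open>auto simp flip: lessThan_Suc_atMost simp del: sum.lessThan_Suc\<close>)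
  have L2: "(\<lambda>z. t k * bergman_basis k z) \<in> L2 disk_area" for k
    by (intro L2_scale bergman_basis_L2)
  have meas: "F \<in> borel_measurable disk_area"
    unfolding F_def using L2_measurable[OF L2] by (rule borel_measurable_suminf)
  have sums: "AE z in disk_area. (\<lambda>k. t k * bergman_basis k z) sums F z"
    unfolding F_def
    by (intro AE_I2 summable_sums summable_product_of_squares tsum bergman_basis_square_summable) simp
  have tails: "(L2_norm disk_area (\<lambda>z. \<Sum>k=m..<n. t k * bergman_basis k z))\<^sup>2
      \<le> (\<Sum>k=m..<n. (cmod (t k))\<^sup>2)" for m n
    by (simp add: L2_orthonormal_norm_lincomb[OF bergman_basis_orthonormal])
  note lim = L2_limit_of_partial_sums[OF L2 meas sums tails tsum]
  show F: "F \<in> L2 disk_area" using lim(1) by simp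
  have conv: "(\<lambda>n. L2_norm disk_area (\<lambda>z. (\<Sum>k<n. t k * bergman_basis k z) - F z)) \<longlonglongrightarrow> 0"
    using lim(2) by simp
  have partial: "(\<lambda>z. \<Sum>k<n. t k * bergman_basis k z) \<in> L2 disk_area" for n
    by (intro L2_sum L2)
  show "L2_norm disk_area F \<le> C"
  proof (rule LIMSEQ_le_const2[OF L2_norm_tendsto[OF partial F conv]], intro exI allI impI)
    fix n
    have "(L2_norm disk_area (\<lambda>z. \<Sum>k<n. t k * bergman_basis k z))\<^sup>2 \<le> C\<^sup>2"
      using t[of n] by (simp add: L2_orthonormal_norm_lincomb[OF bergman_basis_orthonormal])
    thus "L2_norm disk_area (\<lambda>z. \<Sum>k<n. t k * bergman_basis k z) \<le> C"
      using C by (rule power2_le_imp_le)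
  qed
  show "(\<lambda>k. t k * szego_coeff w k) sums L2_inner disk_area F (szego w)" if w: "w \<in> unit_disk"
  proof -
    have "(\<lambda>n. L2_inner disk_area (\<lambda>z. \<Sum>k<n. t k * bergman_basis k z) (szego w))
        \<longlonglongrightarrow> L2_inner disk_area F (szego w)"
      by (rule L2_inner_tendsto_left[OF partial F szego_L2_series(1)[OF w] conv])
    moreover have "L2_inner disk_area (\<lambda>z. \<Sum>k<n. t k * bergman_basis k z) (szego w)
        = (\<Sum>k<n. t k * szego_coeff w k)" for n
      by (subst L2_inner_lincomb_left)
         (simp_all add: bergman_basis_L2 szego_L2_series(1)[OF w] szego_inner_basis[OF w])
    ultimately show ?thesis by (simp add: sums_def)
  qed
qed

text \<open>T f is the series of the t_k e_k with t_k the sum over j of <f, cnj e_j> c_jk, so T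
  vanishes on the orthogonal complement of the cnj e_j. The hypothesis bounds finite sections only:
  m tends to infinity in \<open>t_bound\<close>, n in \<open>bergman_series\<close>. The order of
  the double sum, k outside and j inside, is that of this construction.\<close>

lemma contraction_of_matrix:
  fixes c :: "nat \<Rightarrow> nat \<Rightarrow> complex"
  assumes c: "\<And>a m n. (\<Sum>k<n. (cmod (\<Sum>j<m. a j * c j k))\<^sup>2) \<le> (\<Sum>j<m. (cmod (a j))\<^sup>2)"
  shows "\<exists>T. norm_contraction disk_area T \<and>
    (\<forall>z\<in>unit_disk. \<forall>w\<in>unit_disk.
       (\<lambda>k. szego_coeff w k * (\<Sum>j. szego_coeff z j * c j k)) sums
         L2_inner disk_area (T (\<lambda>\<zeta>. cnj (szego z \<zeta>))) (szego w))"
proof -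
  define a where "a f j = L2_inner disk_area f (cnj_basis j)" for f j
  define t where "t f k = (\<Sum>j. a f j * c j k)" for f k
  define T where "T f z = (\<Sum>k. t f k * bergman_basis k z)" for f z
  have on: "L2_orthonormal disk_area cnj_basis UNIV"
    by (rule L2_orthonormal_cnj[OF bergman_basis_orthonormal])
  have e: "cnj_basis j \<in> L2 disk_area" for j by (intro L2_cnj bergman_basis_L2)
  \<comment> \<open>The inner sums over j converge only if the columns of the matrix are square
    summable. Testing the hypothesis on a_j = cnj (c_jk) and keeping only the k-th output gives S^2
    <= S, hence S <= 1.\<close>
  have c_summable: "summable (\<lambda>j. (cmod (c j k))\<^sup>2)" for k
  proof (rule bounded_imp_summable[where B = 1])
    fix n
    define S where "S = (\<Sum>j\<le>n. (cmod (c j k))\<^sup>2)"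
    have S: "S \<ge> 0" by (simp add: S_def sum_nonneg)
    have eq: "(\<Sum>j<Suc n. cnj (c j k) * c j k) = complex_of_real S"
      unfolding S_def of_real_sum lessThan_Suc_atMost
      by (intro sum.cong refl) (simp add: complex_norm_square mult.commute del: of_real_power)
    have "S\<^sup>2 = (cmod (\<Sum>j<Suc n. cnj (c j k) * c j k))\<^sup>2" unfolding eq by simp
    also have "\<dots> \<le> (\<Sum>i<Suc k. (cmod (\<Sum>j<Suc n. cnj (c j k) * c j i))\<^sup>2)"
      by (rule member_le_sum[of k "{..<Suc k}" "\<lambda>i. (cmod (\<Sum>j<Suc n. cnj (c j k) * c j i))\<^sup>2"]) auto
    also have "\<dots> \<le> (\<Sum>j<Suc n. (cmod (cnj (c j k)))\<^sup>2)" by (rule c)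
    also have "\<dots> = S" by (simp only: S_def lessThan_Suc_atMost complex_mod_cnj)
    finally have "S * S \<le> 1 * S" by (simp add: power2_eq_square)
    thus "(\<Sum>j\<le>n. (cmod (c j k))\<^sup>2) \<le> 1"
      using S unfolding S_def[symmetric] by (cases "S = 0") (auto dest: mult_right_le_imp_le)
  qed simp
  have a_summable: "summable (\<lambda>j. (cmod (a f j))\<^sup>2)" if "f \<in> L2 disk_area" for f
    unfolding a_def by (rule L2_Bessel_summable[OF on that])
  have t_summable: "summable (\<lambda>j. a f j * c j k)" if "f \<in> L2 disk_area" for f k
    by (intro summable_product_of_squares a_summable c_summable that)
  have t_bound: "(\<Sum>k<n. (cmod (t f k))\<^sup>2) \<le> (L2_norm disk_area f)\<^sup>2" if f: "f \<in> L2 disk_area" for f n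
  proof (rule LIMSEQ_le_const2)
    show "(\<lambda>m. \<Sum>k<n. (cmod (\<Sum>j<m. a f j * c j k))\<^sup>2) \<longlonglongrightarrow> (\<Sum>k<n. (cmod (t f k))\<^sup>2)"
      unfolding t_def by (intro tendsto_intros summable_LIMSEQ t_summable f)
    show "\<exists>N. \<forall>m\<ge>N. (\<Sum>k<n. (cmod (\<Sum>j<m. a f j * c j k))\<^sup>2) \<le> (L2_norm disk_area f)\<^sup>2"
    proof (intro exI allI impI)
      fix m
      have "(\<Sum>k<n. (cmod (\<Sum>j<m. a f j * c j k))\<^sup>2) \<le> (\<Sum>j<m. (cmod (a f j))\<^sup>2)" by (rule c)
      also have "\<dots> \<le> (L2_norm disk_area f)\<^sup>2"
        unfolding a_def by (rule L2_Bessel[OF on _ _ f]) auto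
      finally show "(\<Sum>k<n. (cmod (\<Sum>j<m. a f j * c j k))\<^sup>2) \<le> (L2_norm disk_area f)\<^sup>2" .
    qed
  qed
  have T_fun: "T f = (\<lambda>z. \<Sum>k. t f k * bergman_basis k z)" for f by (simp add: T_def fun_eq_iff)
  have T_summable: "summable (\<lambda>k. t f k * bergman_basis k z)" if "f \<in> L2 disk_area" "z \<in> unit_disk" for f z
  proof (intro summable_product_of_squares bergman_basis_square_summable that(2))
    show "summable (\<lambda>k. (cmod (t f k))\<^sup>2)"
      by (rule bounded_imp_summable[where B = "(L2_norm disk_area f)\<^sup>2"])
         (use t_bound[OF that(1)] in \<open>auto simp flip: lessThan_Suc_atMost simp del: sum.lessThan_Suc\<close>)
  qed
  note series = bergman_series[OF t_bound L2_norm_nonneg, folded T_fun]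
  have t_add: "t (\<lambda>y. f y + g y) k = t f k + t g k" if "f \<in> L2 disk_area" "g \<in> L2 disk_area" for f g k
    unfolding t_def using that
    by (subst suminf_add) (auto simp: a_def L2_inner_add_left e distrib_right intro!: t_summable[unfolded a_def])
  have t_scale: "t (\<lambda>y. b * f y) k = b * t f k" if "f \<in> L2 disk_area" for b f k
    unfolding t_def using that
    by (subst suminf_mult[symmetric]) (auto simp: a_def L2_inner_scale_left mult.assoc intro!: t_summable[unfolded a_def])
  have "norm_contraction disk_area T"
    unfolding norm_contraction_def L2_linear_operator_def
  proof (intro conjI ballI allI impI)
    fix f g assume f: "f \<in> L2 disk_area" and g: "g \<in> L2 disk_area"
    show "AE x in disk_area. T f x = T g x" if eq: "AE x in disk_area. f x = g x"
    proof -
      \<comment> \<open>\<open>T f\<close> sees f only through these inner products, so functions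
        equal almost everywhere have literally the same image.\<close>
      have "a f = a g" by (rule ext) (simp only: a_def L2_inner_cong_AE[OF f g e eq])
      thus ?thesis by (simp add: T_def t_def)
    qed
    show "AE x in disk_area. T (\<lambda>y. f y + g y) x = T f x + T g x"
    proof (rule AE_I2)
      fix z assume "z \<in> space disk_area"
      thus "T (\<lambda>y. f y + g y) z = T f z + T g z"
        unfolding T_def using f g
        by (subst suminf_add) (auto simp: t_add distrib_right intro!: T_summable)
    qed
  next
    fix b f assume f: "f \<in> L2 disk_area"
    show "AE x in disk_area. T (\<lambda>y. b * f y) x = b * T f x"
    proof (rule AE_I2)
      fix z assume "z \<in> space disk_area"
      thus "T (\<lambda>y. b * f y) z = b * T f z"
        unfolding T_def using f
        by (subst suminf_mult[symmetric]) (auto simp: t_scale mult.assoc intro!: T_summable)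
    qed
  qed (use series(1,2) in auto)
  moreover have "(\<lambda>k. szego_coeff w k * (\<Sum>j. szego_coeff z j * c j k)) sums
         L2_inner disk_area (T (\<lambda>\<zeta>. cnj (szego z \<zeta>))) (szego w)" if z: "z \<in> unit_disk" and w: "w \<in> unit_disk" for z w
    using series(3)[OF L2_cnj[OF szego_L2_series(1)[OF z]] w]
    by (simp only: t_def a_def cnj_szego_inner_cnj_basis[OF z] mult.commute)
  ultimately show ?thesis by blast
qed

text \<open>Linearity handles finite partial sums S_n; the contraction bound ||T S_n - T s|| <=
  ||S_n - s|| supplies the continuity that carries the series through T.\<close>

lemma contraction_cnj_szego_sums:
  assumes T: "norm_contraction disk_area T" and z: "z \<in> unit_disk" and g: "g \<in> L2 disk_area"
  shows "(\<lambda>j. szego_coeff z j * L2_inner disk_area (T (cnj_basis j)) g) sums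
           L2_inner disk_area (T (\<lambda>\<zeta>. cnj (szego z \<zeta>))) g"
proof -
  define S where "S n = (\<lambda>\<zeta>. \<Sum>j<n. szego_coeff z j * cnj (bergman_basis j \<zeta>))" for n
  define s where "s = (\<lambda>\<zeta>. cnj (szego z \<zeta>))"
  have lin: "L2_linear_operator disk_area T"
    and contr: "\<And>f. f \<in> L2 disk_area \<Longrightarrow> L2_norm disk_area (T f) \<le> L2_norm disk_area f"
    using T by (auto simp: norm_contraction_def)
  note T_L2 = L2_linear_operatorD(1)[OF lin]
  note T_add = L2_linear_operatorD(2)[OF lin]
  note T_scale = L2_linear_operatorD(3)[OF lin]
  have e: "cnj_basis j \<in> L2 disk_area" for j by (intro L2_cnj bergman_basis_L2)
  have s: "s \<in> L2 disk_area" unfolding s_def by (intro L2_cnj szego_L2_series z)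
  have S: "S n \<in> L2 disk_area" for n unfolding S_def by (intro L2_lincomb e)
  have TS: "L2_inner disk_area (T (S n)) g = (\<Sum>j<n. szego_coeff z j * L2_inner disk_area (T (cnj_basis j)) g)" for n
    unfolding S_def by (rule L2_linear_operator_inner_lincomb[OF lin e g])
  have "L2_norm disk_area (\<lambda>\<zeta>. S n \<zeta> - s \<zeta>)
      = L2_norm disk_area (\<lambda>\<zeta>. (\<Sum>k<n. szego_coeff (cnj z) k * bergman_basis k \<zeta>) - szego z \<zeta>)" for n
    by (subst L2_norm_cnj[symmetric]) (simp add: S_def s_def szego_coeff_def)
  hence Slim: "(\<lambda>n. L2_norm disk_area (\<lambda>\<zeta>. S n \<zeta> - s \<zeta>)) \<longlonglongrightarrow> 0"
    using szego_L2_series(2)[OF z] by simp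
  have "(\<lambda>n. L2_norm disk_area (\<lambda>\<zeta>. T (S n) \<zeta> - T s \<zeta>)) \<longlonglongrightarrow> 0"
  proof (rule Lim_null_comparison[OF _ Slim], rule always_eventually, rule allI)
    fix n
    \<comment> \<open>The operator clauses speak of sums and scalar multiples, so the difference is
      read as S_n + (-1) s.\<close>
    let ?s = "\<lambda>x. (- 1) * s x"
    have ns: "?s \<in> L2 disk_area" by (intro L2_scale s)
    have "AE x in disk_area. T (\<lambda>y. S n y - s y) x = T (S n) x - T s x"
      using T_add[OF S ns, of n] T_scale[OF s, of "- 1"] by eventually_elim simp
    hence "L2_norm disk_area (\<lambda>\<zeta>. T (S n) \<zeta> - T s \<zeta>) = L2_norm disk_area (T (\<lambda>y. S n y - s y))"
      by (intro L2_norm_cong_AE) (auto intro: T_L2 L2_diff S s)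
    also have "\<dots> \<le> L2_norm disk_area (\<lambda>y. S n y - s y)" by (intro contr L2_diff S s)
    finally show "norm (L2_norm disk_area (\<lambda>\<zeta>. T (S n) \<zeta> - T s \<zeta>)) \<le> L2_norm disk_area (\<lambda>\<zeta>. S n \<zeta> - s \<zeta>)"
      by simp
  qed
  hence "(\<lambda>n. L2_inner disk_area (T (S n)) g) \<longlonglongrightarrow> L2_inner disk_area (T s) g"
    by (intro L2_inner_tendsto_left T_L2 S s g)
  thus ?thesis by (simp add: TS sums_def s_def)
qed

section \<open>Independence from characteristic functions\<close>

lemma (in prob_space) integrable_bounded:
  fixes f :: "'a \<Rightarrow> 'b::{banach, second_countable_topology}"
  assumes "f \<in> borel_measurable M" "\<And>x. norm (f x) \<le> C"
  shows "integrable M f"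
  using assms by (intro integrable_const_bound[where B = C]) auto

text \<open>
  For a nonnegative weight \<open>h\<close>, the law of \<open>X\<close> under the reweighted probability is determined by
  its characteristic function.
\<close>

lemma (in prob_space) weighted_law_of_char:
  fixes h X :: "'a \<Rightarrow> real"
  assumes h [measurable]: "h \<in> borel_measurable M" and nn: "\<And>x. 0 \<le> h x" and bd: "\<And>x. h x \<le> C"
    and X [measurable]: "X \<in> borel_measurable M"
    and char: "\<And>s. (CLINT x|M. h x * iexp (s * X x)) = (LINT x|M. h x) * (CLINT x|M. iexp (s * X x))"
    and A [measurable]: "A \<in> sets borel"
  shows "(LINT x|M. h x * indicator A (X x)) = (LINT x|M. h x) * (LINT x|M. indicator A (X x))"
proof -
  define E where "E = (LINT x|M. h x)"
  have hint: "integrable M h"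
    using nn bd by (intro integrable_bounded[where C = C]) auto
  have E_nn: "E \<ge> 0" unfolding E_def using nn by (intro Bochner_Integration.integral_nonneg) auto
  show ?thesis
  proof (cases "E = 0")
    case True
    hence "AE x in M. h x = 0"
      using integral_nonneg_eq_0_iff_AE[OF hint] nn by (simp add: E_def)
    hence "(LINT x|M. h x * indicator A (X x)) = (LINT x|M. 0)"
      by (intro integral_cong_AE) (auto elim!: eventually_mono)
    with True show ?thesis by (simp add: E_def)
  next
    case False
    with E_nn have E: "E > 0" by simp
    \<comment> \<open>Dividing \<open>char\<close> by E says that X has the same characteristic
      function under the reweighted probability N as under M.\<close>
    define N where "N = density M (\<lambda>x. ennreal (h x / E))"
    have N: "(LINT x|N. f x) = (LINT x|M. (h x / E) *\<^sub>R f x)" if "f \<in> borel_measurable M"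
      for f :: "'a \<Rightarrow> 'b::{banach, second_countable_topology}"
      unfolding N_def by (rule integral_density) (use that E nn in auto)
    have "emeasure N (space N) = (\<integral>\<^sup>+x. ennreal (h x / E) \<partial>M)"
      by (simp add: N_def emeasure_density)
    also have "\<dots> = ennreal (LINT x|M. h x / E)"
      using hint nn E by (intro nn_integral_eq_integral) auto
    also have "\<dots> = 1" using E by (simp add: E_def)
    finally interpret N: prob_space N by (rule prob_spaceI)
    have [measurable]: "X \<in> borel_measurable N" by (simp add: N_def)
    interpret DN: prob_space "distr N borel X" by (rule N.prob_space_distr) simp
    interpret DM: prob_space "distr M borel X" by (rule prob_space_distr) simp
    have "distr N borel X = distr M borel X"
    proof (rule Levy_uniqueness)
      show "real_distribution (distr N borel X)" "real_distribution (distr M borel X)"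
        by (simp_all add: real_distribution_def real_distribution_axioms_def DN.prob_space_axioms DM.prob_space_axioms)
      show "char (distr N borel X) = char (distr M borel X)"
      proof
        fix s
        have "char (distr N borel X) s = (CLINT x|N. iexp (s * X x))"
          unfolding char_def by (rule integral_distr) auto
        also have "\<dots> = (CLINT x|M. (h x / E) *\<^sub>R iexp (s * X x))"
          by (rule N) simp
        also have "\<dots> = (CLINT x|M. h x * iexp (s * X x) / E)"
          by (simp add: scaleR_conv_of_real)
        also have "\<dots> = (CLINT x|M. iexp (s * X x))"
          using E char[of s] by (simp add: E_def[symmetric])
        also have "\<dots> = char (distr M borel X) s"
          unfolding char_def by (rule integral_distr[symmetric]) auto
        finally show "char (distr N borel X) s = char (distr M borel X) s" .
      qed
    qed
    hence "(LINT x|N. indicator A (X x)) = (LINT x|M. indicator A (X x) :: real)"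
      using integral_distr[of X N borel "indicator A :: real \<Rightarrow> real"] integral_distr[of X M borel "indicator A :: real \<Rightarrow> real"]
      by simp
    moreover have "(LINT x|N. indicator A (X x)) = (LINT x|M. h x * indicator A (X x)) / E"
      by (subst N) auto
    ultimately show ?thesis using E by (simp add: E_def field_simps)
  qed
qed

text \<open>\<open>W e\<^bsup>i\<theta>\<^esup>\<close> is a linear combination of the nonnegative weights \<open>W\<close> and \<open>W (1 + Re (u e\<^bsup>i\<theta>\<^esup>))\<close>, \<open>|u| = 1\<close>.\<close>

lemma (in prob_space) weighted_law_of_char_complex:
  fixes W X \<theta> :: "'a \<Rightarrow> real"
  assumes W [measurable]: "W \<in> borel_measurable M" and W01: "\<And>x. 0 \<le> W x" "\<And>x. W x \<le> 1"
    and X [measurable]: "X \<in> borel_measurable M" and \<theta> [measurable]: "\<theta> \<in> borel_measurable M"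
    and char0: "\<And>s. (CLINT x|M. W x * iexp (s * X x)) = (LINT x|M. W x) * (CLINT x|M. iexp (s * X x))"
    and char1: "\<And>s. (CLINT x|M. W x * iexp (\<theta> x) * iexp (s * X x))
                   = (CLINT x|M. W x * iexp (\<theta> x)) * (CLINT x|M. iexp (s * X x))"
    and A [measurable]: "A \<in> sets borel"
  shows "(CLINT x|M. W x * iexp (\<theta> x) * indicator A (X x))
       = (CLINT x|M. W x * iexp (\<theta> x)) * complex_of_real (LINT x|M. indicator A (X x))"
proof -
  define \<phi> where "\<phi> s = (CLINT x|M. iexp (s * X x))" for s
  define Z where "Z x = W x * iexp (\<theta> x)" for x
  have [measurable]: "Z \<in> borel_measurable M" unfolding Z_def by measurable
  have Wle: "\<bar>W x\<bar> \<le> 1" for x using W01[of x] by simp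
  have Zle: "cmod (Z x) \<le> 1" for x using Wle[of x] by (simp add: Z_def norm_mult)
  have Zint: "integrable M (\<lambda>x. Z x * iexp (s * X x))" for s
    using Zle by (intro integrable_bounded[where C = 1]) (auto simp: norm_mult)
  have cZint: "integrable M (\<lambda>x. cnj (Z x) * iexp (s * X x))" for s
    using integrable_cnj[OF Zint[of "- s"]] by (simp add: exp_cnj)
  have Wint: "integrable M (\<lambda>x. complex_of_real (W x) * iexp (s * X x))" for s
    using Wle by (intro integrable_bounded[where C = 1]) (auto simp: norm_mult)
  have Wint': "integrable M W" and Zint': "integrable M Z"
    using Wle Zle by (auto intro!: integrable_bounded[where C = 1])
  \<comment> \<open>Conjugating \<open>char1\<close> at -s shows that the weight W exp(-i \<theta>)
    factors as well; it enters through the real part of u exp(i \<theta>).\<close>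
  have cnj_char: "(CLINT x|M. cnj (Z x) * iexp (s * X x)) = (CLINT x|M. cnj (Z x)) * \<phi> s" for s
  proof -
    have "(CLINT x|M. cnj (Z x) * iexp (s * X x)) = cnj (CLINT x|M. Z x * iexp ((- s) * X x))"
      by (subst Bochner_Integration.integral_cnj[symmetric]) (simp add: exp_cnj)
    also have "\<dots> = cnj (CLINT x|M. Z x) * cnj (\<phi> (- s))"
      unfolding Z_def char1 \<phi>_def by simp
    also have "cnj (\<phi> (- s)) = \<phi> s"
      unfolding \<phi>_def by (subst Bochner_Integration.integral_cnj[symmetric]) (simp add: exp_cnj)
    finally show ?thesis by simp
  qed
  have real_part: "(LINT x|M. W x * (1 + Re (u * iexp (\<theta> x))) * indicator A (X x))
      = (LINT x|M. W x * (1 + Re (u * iexp (\<theta> x)))) * (LINT x|M. indicator A (X x))" if u: "cmod u = 1" for u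
  proof (rule weighted_law_of_char[where C = 2])
    have bd: "\<bar>Re (u * iexp (\<theta> x))\<bar> \<le> 1" for x
      using abs_Re_le_cmod[of "u * iexp (\<theta> x)"] u by (simp add: norm_mult)
    show "0 \<le> W x * (1 + Re (u * iexp (\<theta> x)))" for x using W01[of x] bd[of x] by simp
    show "W x * (1 + Re (u * iexp (\<theta> x))) \<le> 2" for x
      using mult_mono[of "W x" 1 "1 + Re (u * iexp (\<theta> x))" 2] W01[of x] bd[of x] by simp
    have eq: "complex_of_real (W x * (1 + Re (u * iexp (\<theta> x))))
        = W x + (u / 2) * Z x + (cnj u / 2) * cnj (Z x)" for x
    proof -
      have "complex_of_real (Re (u * iexp (\<theta> x))) = (u * iexp (\<theta> x) + cnj (u * iexp (\<theta> x))) / 2"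
        by (simp add: complex_eq_iff)
      thus ?thesis
        unfolding of_real_mult of_real_add Z_def by (simp only:) (simp add: field_simps)
    qed
    fix s
    have "(CLINT x|M. complex_of_real (W x * (1 + Re (u * iexp (\<theta> x)))) * iexp (s * X x))
        = (CLINT x|M. W x * iexp (s * X x) + (u / 2) * (Z x * iexp (s * X x)) + (cnj u / 2) * (cnj (Z x) * iexp (s * X x)))"
      by (simp only: eq distrib_right mult.assoc)
    also have "\<dots> = (CLINT x|M. W x * iexp (s * X x)) + (u / 2) * (CLINT x|M. Z x * iexp (s * X x))
        + (cnj u / 2) * (CLINT x|M. cnj (Z x) * iexp (s * X x))"
      using Wint[of s] Zint[of s] cZint[of s] by simp
    also have "\<dots> = (LINT x|M. W x) * \<phi> s + (u / 2) * ((CLINT x|M. Z x) * \<phi> s) + (cnj u / 2) * ((CLINT x|M. cnj (Z x)) * \<phi> s)"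
      by (simp only: cnj_char char0 char1[folded Z_def] \<phi>_def)
    also have "\<dots> = ((CLINT x|M. W x) + (u / 2) * (CLINT x|M. Z x) + (cnj u / 2) * (CLINT x|M. cnj (Z x))) * \<phi> s"
      by (simp add: algebra_simps)
    also have "(CLINT x|M. W x) + (u / 2) * (CLINT x|M. Z x) + (cnj u / 2) * (CLINT x|M. cnj (Z x))
        = (CLINT x|M. W x + (u / 2) * Z x + (cnj u / 2) * cnj (Z x))"
      using Wint' Zint' by simp
    also have "\<dots> = complex_of_real (LINT x|M. W x * (1 + Re (u * iexp (\<theta> x))))"
      unfolding eq[symmetric] by (rule integral_complex_of_real)
    finally show "(CLINT x|M. complex_of_real (W x * (1 + Re (u * iexp (\<theta> x)))) * iexp (s * X x))
        = complex_of_real (LINT x|M. W x * (1 + Re (u * iexp (\<theta> x)))) * (CLINT x|M. iexp (s * X x))"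
      by (simp add: \<phi>_def)
  qed auto
  have W_part: "(LINT x|M. W x * indicator A (X x)) = (LINT x|M. W x) * (LINT x|M. indicator A (X x))"
    by (rule weighted_law_of_char[where C = 1]) (use W01 char0 in auto)
  have WRe_int: "integrable M (\<lambda>x. Re (u * Z x))" for u
    using Zint' by (intro integrable_Re) auto
  have ind_int: "integrable M (\<lambda>x. f x * indicator A (X x))" if "integrable M f" for f :: "'a \<Rightarrow> real"
    using borel_measurable_integrable[OF that]
    by (intro Bochner_Integration.integrable_bound[OF that]) (auto simp: indicator_def)
  \<comment> \<open>Subtracting the identity for the weight W leaves the part Re (u Z). The values u
    = 1 and u = -\<i> then give Re Z and Im Z.\<close>
  have Re_part: "(LINT x|M. Re (u * Z x) * indicator A (X x))
      = (LINT x|M. Re (u * Z x)) * (LINT x|M. indicator A (X x))" if u: "cmod u = 1" for u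
  proof -
    have eq: "W x * (1 + Re (u * iexp (\<theta> x))) = W x + Re (u * Z x)" for x
      by (simp add: Z_def algebra_simps)
    have "(LINT x|M. W x * indicator A (X x)) + (LINT x|M. Re (u * Z x) * indicator A (X x))
        = (LINT x|M. (W x + Re (u * Z x)) * indicator A (X x))"
      unfolding distrib_right
      by (intro Bochner_Integration.integral_add[symmetric] ind_int Wint' WRe_int)
    also have "\<dots> = (LINT x|M. W x + Re (u * Z x)) * (LINT x|M. indicator A (X x))"
      using real_part[OF u] by (simp only: eq)
    also have "(LINT x|M. W x + Re (u * Z x)) = (LINT x|M. W x) + (LINT x|M. Re (u * Z x))"
      using Wint' WRe_int[of u] by (rule Bochner_Integration.integral_add)
    finally show ?thesis using W_part by (simp add: algebra_simps)
  qed
  have int1: "integrable M (\<lambda>x. Z x * indicator A (X x))"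
    using Zle by (intro integrable_bounded[where C = 1]) (auto simp: norm_mult indicator_def)
  have "(CLINT x|M. Z x * indicator A (X x)) = (CLINT x|M. Z x) * complex_of_real (LINT x|M. indicator A (X x))"
  proof (rule complex_eqI)
    have "Re (CLINT x|M. Z x * indicator A (X x)) = (LINT x|M. Re (1 * Z x) * indicator A (X x))"
      by (subst integral_Re[OF int1, symmetric]) (auto intro!: Bochner_Integration.integral_cong simp: indicator_def)
    also have "\<dots> = Re ((CLINT x|M. Z x) * complex_of_real (LINT x|M. indicator A (X x)))"
      using Re_part[of 1] Zint' by simp
    finally show "Re (CLINT x|M. Z x * indicator A (X x)) = Re ((CLINT x|M. Z x) * complex_of_real (LINT x|M. indicator A (X x)))" .
    have "Im (CLINT x|M. Z x * indicator A (X x)) = (LINT x|M. Re (- \<i> * Z x) * indicator A (X x))"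
      by (subst integral_Im[OF int1, symmetric]) (auto intro!: Bochner_Integration.integral_cong simp: indicator_def)
    also have "\<dots> = Im ((CLINT x|M. Z x) * complex_of_real (LINT x|M. indicator A (X x)))"
      using Re_part[of "- \<i>"] Zint' by simp
    finally show "Im (CLINT x|M. Z x * indicator A (X x)) = Im ((CLINT x|M. Z x) * complex_of_real (LINT x|M. indicator A (X x)))" .
  qed
  thus ?thesis by (simp add: Z_def)
qed

text \<open>Kac's theorem. Exponentials are exchanged for indicators one index at a time: K collects
  the indices already exchanged, L those still carrying exponentials. Each exchange applies the
  weighted uniqueness theorem to X_k, with the indicators as W and the remaining exponential as
  exp(i \<theta>).\<close>

lemma (in prob_space) indep_vars_of_char:
  fixes X :: "'i \<Rightarrow> 'a \<Rightarrow> real"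
  assumes X: "\<And>i. i \<in> I \<Longrightarrow> X i \<in> borel_measurable M"
    and char: "\<And>J t. finite J \<Longrightarrow> J \<subseteq> I \<Longrightarrow>
      (CLINT x|M. iexp (\<Sum>i\<in>J. t i * X i x)) = (\<Prod>i\<in>J. CLINT x|M. iexp (t i * X i x))"
  shows "indep_vars (\<lambda>_. borel) X I"
proof -
  have main: "(CLINT x|M. complex_of_real (\<Prod>i\<in>K. indicator (A i) (X i x)) * iexp (\<Sum>i\<in>L. t i * X i x))
      = complex_of_real (\<Prod>i\<in>K. LINT x|M. indicator (A i) (X i x)) * (\<Prod>i\<in>L. CLINT x|M. iexp (t i * X i x))"
    if "finite K" "K \<subseteq> I" "finite L" "L \<subseteq> I - K" "\<And>i. i \<in> K \<Longrightarrow> A i \<in> sets borel" for K L t and A :: "'i \<Rightarrow> real set"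
    using that
  proof (induction K arbitrary: L t rule: finite_induct)
    case empty
    thus ?case using char[of L t] by simp
  next
    case (insert k K)
    define W where "W x = (\<Prod>i\<in>K. indicator (A i) (X i x) :: real)" for x
    define \<theta> where "\<theta> x = (\<Sum>i\<in>L. t i * X i x)" for x
    define c where "c = (\<Prod>i\<in>K. LINT x|M. indicator (A i) (X i x) :: real)"
    have [measurable]: "X i \<in> borel_measurable M" if "i \<in> insert k (K \<union> L)" for i
      using X that insert.prems by auto
    have [measurable]: "A i \<in> sets borel" if "i \<in> insert k K" for i using insert.prems that by auto
    have [measurable]: "W \<in> borel_measurable M" "\<theta> \<in> borel_measurable M"
      unfolding W_def[abs_def] \<theta>_def[abs_def] by measurable
    have IH: "(CLINT x|M. complex_of_real (W x) * iexp (\<Sum>i\<in>L'. t' i * X i x))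
        = complex_of_real c * (\<Prod>i\<in>L'. CLINT x|M. iexp (t' i * X i x))"
      if "finite L'" "L' \<subseteq> I - K" for L' t'
      unfolding W_def c_def using insert that by auto
    have k: "k \<notin> L" "k \<in> I - K" "L \<subseteq> I - K" using insert.prems insert.hyps by auto
    have Wc: "(LINT x|M. W x) = c"
    proof -
      have "complex_of_real (LINT x|M. W x) = complex_of_real c" using IH[of "{}"] by simp
      thus ?thesis by (simp only: of_real_eq_iff)
    qed
    have "(CLINT x|M. W x * iexp (\<theta> x) * indicator (A k) (X k x))
       = (CLINT x|M. W x * iexp (\<theta> x)) * complex_of_real (LINT x|M. indicator (A k) (X k x))"
    proof (rule weighted_law_of_char_complex)
      show "0 \<le> W x" "W x \<le> 1" for x
        by (auto simp: W_def intro!: prod_nonneg prod_le_1)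
      show "(CLINT x|M. W x * iexp (s * X k x)) = (LINT x|M. W x) * (CLINT x|M. iexp (s * X k x))" for s
        using IH[of "{k}" "\<lambda>_. s"] k by (simp add: Wc)
      fix s
      \<comment> \<open>Joining the frequency s at k to the frequencies on L puts both exponentials
        into one sum, so the induction hypothesis applies to \<open>insert k L\<close>.\<close>
      define t' where "t' i = (if i = k then s else t i)" for i
      have t': "t' i = t i" if "i \<in> L" for i using that k by (auto simp: t'_def)
      have "(CLINT x|M. W x * iexp (\<theta> x) * iexp (s * X k x))
          = (CLINT x|M. W x * iexp (\<Sum>i\<in>insert k L. t' i * X i x))"
        using k insert.prems by (simp add: \<theta>_def t' t'_def[of k] distrib_left exp_add mult_ac)
      also have "\<dots> = c * (\<Prod>i\<in>insert k L. CLINT x|M. iexp (t' i * X i x))"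
        by (rule IH) (use insert.prems k in auto)
      also have "\<dots> = c * (\<Prod>i\<in>L. CLINT x|M. iexp (t i * X i x)) * (CLINT x|M. iexp (s * X k x))"
        using k insert.prems by (simp add: t' t'_def[of k] mult_ac)
      also have "c * (\<Prod>i\<in>L. CLINT x|M. iexp (t i * X i x)) = (CLINT x|M. W x * iexp (\<theta> x))"
        unfolding \<theta>_def by (rule IH[symmetric]) (use insert.prems k in auto)
      finally show "(CLINT x|M. W x * iexp (\<theta> x) * iexp (s * X k x))
                   = (CLINT x|M. W x * iexp (\<theta> x)) * (CLINT x|M. iexp (s * X k x))" .
    qed auto
    moreover have "(CLINT x|M. W x * iexp (\<theta> x)) = c * (\<Prod>i\<in>L. CLINT x|M. iexp (t i * X i x))"
      unfolding \<theta>_def by (rule IH) (use insert.prems k in auto)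
    moreover have "complex_of_real (\<Prod>i\<in>insert k K. indicator (A i) (X i x)) * iexp (\<Sum>i\<in>L. t i * X i x)
        = W x * iexp (\<theta> x) * indicator (A k) (X k x)" for x
      using insert.hyps by (auto simp: W_def \<theta>_def indicator_def)
    moreover have "(\<Prod>i\<in>insert k K. LINT x|M. indicator (A i) (X i x) :: real) = c * (LINT x|M. indicator (A k) (X k x))"
      using insert.hyps by (simp add: c_def mult.commute)
    ultimately show ?case by (simp add: mult_ac)
  qed
  show ?thesis
    unfolding indep_vars_def2
  proof (intro conjI ballI indep_setsI)
    fix J and B :: "'i \<Rightarrow> 'a set"
    assume J: "J \<noteq> {}" "J \<subseteq> I" "finite J" "\<forall>j\<in>J. B j \<in> {X j -` A \<inter> space M |A. A \<in> sets borel}"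
    then obtain A where A: "\<And>j. j \<in> J \<Longrightarrow> A j \<in> sets borel \<and> B j = X j -` A j \<inter> space M"
      by simp metis
    have sets: "B j \<in> sets M" if "j \<in> J" for j
      using A[OF that] X[of j] J(2) that by (auto intro: measurable_sets)
    have ind: "(LINT x|M. indicator (A j) (X j x)) = prob (B j)" if "j \<in> J" for j
    proof -
      have "(LINT x|M. indicator (A j) (X j x)) = (LINT x|M. indicator (B j) x :: real)"
        using A[OF that] by (intro Bochner_Integration.integral_cong) (auto simp: indicator_def)
      also have "\<dots> = prob (B j)" using sets[OF that] by simp
      finally show ?thesis .
    qed
    have "complex_of_real (LINT x|M. (\<Prod>j\<in>J. indicator (A j) (X j x)))
        = complex_of_real (\<Prod>j\<in>J. LINT x|M. indicator (A j) (X j x))"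
      using main[of J "{}" A] J A by (simp del: of_real_prod)
    hence "(LINT x|M. (\<Prod>j\<in>J. indicator (A j) (X j x))) = (\<Prod>j\<in>J. LINT x|M. indicator (A j) (X j x) :: real)"
      by (simp only: of_real_eq_iff)
    also have "\<dots> = (\<Prod>j\<in>J. prob (B j))" by (intro prod.cong refl ind)
    also have "(LINT x|M. (\<Prod>j\<in>J. indicator (A j) (X j x))) = (LINT x|M. indicator (\<Inter>j\<in>J. B j) x :: real)"
    proof (intro Bochner_Integration.integral_cong refl)
      fix x assume x: "x \<in> space M"
      have "(\<Prod>j\<in>J. indicator (A j) (X j x) :: real) = (\<Prod>j\<in>J. indicator (B j) x)"
        using x A by (intro prod.cong refl) (auto simp: indicator_def)
      also have "\<dots> = indicator (\<Inter>j\<in>J. B j) x"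
        using J(3) by (auto simp: indicator_def of_bool_def prod_zero_iff)
      finally show "(\<Prod>j\<in>J. indicator (A j) (X j x)) = (indicator (\<Inter>j\<in>J. B j) x :: real)" .
    qed
    also have "\<dots> = prob (\<Inter>j\<in>J. B j)"
      using sets.finite_INT[OF J(3) J(1) sets] by simp
    finally show "prob (\<Inter>j\<in>J. B j) = (\<Prod>j\<in>J. prob (B j))" .
  qed (use X in \<open>auto intro: measurable_sets\<close>)
qed

section \<open>Cholesky factorisation and white noise\<close>

text \<open>The conjugate sits on the second index so that a Gram matrix K m n = <v_m, v_n> has as
  its form the squared norm of the sum of the x_m v_m. Hermitian symmetry makes the form real;
  taking \<open>Re\<close> keeps the inequality among the reals.\<close>

definition positive_kernel :: "(nat \<Rightarrow> nat \<Rightarrow> complex) \<Rightarrow> bool" where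
  "positive_kernel K \<longleftrightarrow> (\<forall>m n. K n m = cnj (K m n)) \<and>
     (\<forall>N x. 0 \<le> Re (\<Sum>m<N. \<Sum>n<N. x m * cnj (x n) * K m n))"

lemma positive_kernel_hermitian:
  assumes "positive_kernel K"
  shows "K n m = cnj (K m n)"
  using assms unfolding positive_kernel_def by blast

lemma positive_kernel_form_nonneg:
  assumes "positive_kernel K"
  shows "0 \<le> Re (\<Sum>m<N. \<Sum>n<N. x m * cnj (x n) * K m n)"
  using assms unfolding positive_kernel_def by blast

text \<open>The form evaluated at x + \<tau> e_p, with e_p a unit vector. Varying a single
  coordinate is enough for everything below: \<tau> = 1 at x = 0 gives the diagonal, a suitable
  multiple of a conjugated entry the vanishing rows, and the minimizing \<tau> the Schur
  complement.\<close>

lemma kernel_form_shift: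
  fixes x :: "nat \<Rightarrow> complex"
  assumes "p < N"
  shows "(\<Sum>m<N. \<Sum>n<N. (x m + (if m = p then \<tau> else 0)) * cnj (x n + (if n = p then \<tau> else 0)) * K m n)
    = (\<Sum>m<N. \<Sum>n<N. x m * cnj (x n) * K m n) + \<tau> * (\<Sum>n<N. cnj (x n) * K p n)
      + cnj \<tau> * (\<Sum>m<N. x m * K m p) + \<tau> * cnj \<tau> * K p p"
proof -
  have "(\<Sum>n<N. (x m + (if m = p then \<tau> else 0)) * cnj (x n + (if n = p then \<tau> else 0)) * K m n)
      = (\<Sum>n<N. x m * cnj (x n) * K m n) + cnj \<tau> * (x m * K m p)
        + (if m = p then \<tau> * (\<Sum>n<N. cnj (x n) * K p n) + \<tau> * cnj \<tau> * K p p else 0)" for m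
  proof -
    have "(\<Sum>n<N. (x m + (if m = p then \<tau> else 0)) * cnj (x n + (if n = p then \<tau> else 0)) * K m n)
        = (\<Sum>n<N. x m * cnj (x n) * K m n + (if m = p then \<tau> * (cnj (x n) * K p n) else 0)
            + (if n = p then (x m + (if m = p then \<tau> else 0)) * cnj \<tau> * K m p else 0))"
      by (intro sum.cong refl) (auto simp: algebra_simps)
    also have "\<dots> = (\<Sum>n<N. x m * cnj (x n) * K m n) + (if m = p then \<tau> * (\<Sum>n<N. cnj (x n) * K p n) else 0)
            + (x m + (if m = p then \<tau> else 0)) * cnj \<tau> * K m p"
      using assms by (simp add: sum.distrib sum_distrib_left)
    finally show ?thesis by (auto simp: algebra_simps)
  qed
  hence "(\<Sum>m<N. \<Sum>n<N. (x m + (if m = p then \<tau> else 0)) * cnj (x n + (if n = p then \<tau> else 0)) * K m n)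
    = (\<Sum>m<N. (\<Sum>n<N. x m * cnj (x n) * K m n) + cnj \<tau> * (x m * K m p)
        + (if m = p then \<tau> * (\<Sum>n<N. cnj (x n) * K p n) + \<tau> * cnj \<tau> * K p p else 0))"
    by simp
  also have "\<dots> = (\<Sum>m<N. \<Sum>n<N. x m * cnj (x n) * K m n) + cnj \<tau> * (\<Sum>m<N. x m * K m p)
        + (\<tau> * (\<Sum>n<N. cnj (x n) * K p n) + \<tau> * cnj \<tau> * K p p)"
    using assms by (simp add: sum.distrib sum_distrib_left)
  finally show ?thesis by (simp add: algebra_simps)
qed

lemma positive_kernel_diagonal:
  assumes "positive_kernel K"
  shows "K p p = of_real (Re (K p p))" "0 \<le> Re (K p p)"
proof -
  have "K p p = cnj (K p p)" by (rule positive_kernel_hermitian[OF assms])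
  thus "K p p = of_real (Re (K p p))" by (simp add: complex_eq_iff)
  have "0 \<le> Re (\<Sum>m<Suc p. \<Sum>n<Suc p. (0 + (if m = p then 1 else 0)) * cnj (0 + (if n = p then 1 else 0)) * K m n)"
    by (rule positive_kernel_form_nonneg[OF assms])
  thus "0 \<le> Re (K p p)" by (subst (asm) kernel_form_shift) auto
qed

text \<open>If K p p = 0, the form at e_n + \<tau> e_p has no quadratic term in \<tau>, so a nonzero
  entry K p n would let it become negative.\<close>

lemma positive_kernel_zero_row:
  assumes K: "positive_kernel K" and 0: "K p p = 0"
  shows "K p n = 0"
proof (rule ccontr)
  assume nz: "K p n \<noteq> 0"
  define r where "r = (cmod (K p n))\<^sup>2"
  have r: "r > 0" using nz by (simp add: r_def)
  \<comment> \<open>Solves K n n - 2 t r = -1, the value of the form at the chosen vector.\<close>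
  define t where "t = (Re (K n n) + 1) / (2 * r)"
  define \<tau> where "\<tau> = - complex_of_real t * cnj (K p n)"
  define N where "N = Suc (max p n)"
  have N: "p < N" "n < N" by (auto simp: N_def)
  define x :: "nat \<Rightarrow> complex" where "x m = (if m = n then 1 else 0)" for m
  have herm: "K n p = cnj (K p n)" by (rule positive_kernel_hermitian[OF K])
  have q: "(\<Sum>m<N. \<Sum>n<N. x m * cnj (x n) * K m n) = K n n"
  proof -
    have "(\<Sum>m<N. \<Sum>k<N. x m * cnj (x k) * K m k) = (\<Sum>m<N. \<Sum>k<N. if k = n then (if m = n then K n n else 0) else 0)"
      by (intro sum.cong refl) (auto simp: x_def)
    also have "\<dots> = K n n" using N by simp
    finally show ?thesis .
  qed
  have 1: "(\<Sum>k<N. cnj (x k) * K p k) = K p n"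
  proof -
    have "(\<Sum>k<N. cnj (x k) * K p k) = (\<Sum>k<N. if k = n then K p n else 0)"
      by (intro sum.cong refl) (auto simp: x_def)
    thus ?thesis using N by simp
  qed
  have 2: "(\<Sum>m<N. x m * K m p) = K n p"
  proof -
    have "(\<Sum>m<N. x m * K m p) = (\<Sum>m<N. if m = n then K n p else 0)"
      by (intro sum.cong refl) (auto simp: x_def)
    thus ?thesis using N by simp
  qed
  have "0 \<le> Re (\<Sum>m<N. \<Sum>n<N. (x m + (if m = p then \<tau> else 0)) * cnj (x n + (if n = p then \<tau> else 0)) * K m n)"
    by (rule positive_kernel_form_nonneg[OF K])
  also have "\<dots> = Re (K n n + \<tau> * K p n + cnj \<tau> * K n p)"
    by (subst kernel_form_shift[OF N(1)]) (simp add: q 1 2 0)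
  also have "\<tau> * K p n = of_real (- t * r)"
    by (simp add: \<tau>_def r_def complex_norm_square mult_ac del: of_real_power)
  also have "cnj \<tau> * K n p = of_real (- t * r)"
    by (simp add: \<tau>_def r_def herm complex_norm_square mult_ac del: of_real_power)
  also have "Re (K n n + of_real (- t * r) + of_real (- t * r)) = - 1"
    using r by (simp add: t_def field_simps)
  finally show False by simp
qed

text \<open>The form of the Schur complement is the minimum over \<tau> of the form of K at x +
  \<tau> e_p. If the pivot vanishes, division by zero makes the correction 0 and the kernel is
  unchanged.\<close>

lemma positive_kernel_schur:
  assumes K: "positive_kernel K"
  shows "positive_kernel (\<lambda>m n. K m n - K m p * K p n / K p p)"
proof (cases "K p p = 0")
  case False
  define d where "d = Re (K p p)"
  have Kpp: "K p p = of_real d" and d: "d > 0"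
    using positive_kernel_diagonal[OF K, of p] False by (auto simp: d_def less_le)
  have herm: "K n m = cnj (K m n)" for m n by (rule positive_kernel_hermitian[OF K])
  have "0 \<le> Re (\<Sum>m<N. \<Sum>n<N. x m * cnj (x n) * (K m n - K m p * K p n / K p p))" for N x
  proof -
    \<comment> \<open>The index p may exceed N, so x is cut off at N and continued by zero to a
      range that contains p.\<close>
    define y where "y m = (if m < N then x m else 0)" for m
    obtain N' where N': "N \<le> N'" "p < N'" using that[of "N + Suc p"] by auto
    define s where "s = (\<Sum>m<N. x m * K m p)"
    \<comment> \<open>The minimizer of \<tau> cnj s + cnj \<tau> s + d |\<tau>|^2; the minimum is
      -|s|^2 / d.\<close>
    define \<tau> where "\<tau> = - s / of_real d"
    have extend: "(\<Sum>m<N'. f (y m) m) = (\<Sum>m<N. f (x m) m)" if "\<And>m. f 0 m = 0" for f :: "complex \<Rightarrow> nat \<Rightarrow> complex"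
    proof -
      have "(\<Sum>m<N'. f (y m) m) = (\<Sum>m<N. f (y m) m)"
        using that by (intro sum.mono_neutral_right) (use N' in \<open>auto simp: y_def\<close>)
      thus ?thesis by (simp add: y_def)
    qed
    have cnj_s: "(\<Sum>n<N. cnj (x n) * K p n) = cnj s"
      by (simp add: s_def flip: herm)
    have q: "(\<Sum>m<N'. \<Sum>n<N'. y m * cnj (y n) * K m n) = (\<Sum>m<N. \<Sum>n<N. x m * cnj (x n) * K m n)"
      using extend[of "\<lambda>u m. \<Sum>n<N'. u * cnj (y n) * K m n"]
        extend[of "\<lambda>u n. x m * cnj u * K m n" for m] by simp
    have "0 \<le> Re (\<Sum>m<N'. \<Sum>n<N'. (y m + (if m = p then \<tau> else 0)) * cnj (y n + (if n = p then \<tau> else 0)) * K m n)"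
      by (rule positive_kernel_form_nonneg[OF K])
    also have "(\<Sum>m<N'. \<Sum>n<N'. (y m + (if m = p then \<tau> else 0)) * cnj (y n + (if n = p then \<tau> else 0)) * K m n)
        = (\<Sum>m<N. \<Sum>n<N. x m * cnj (x n) * K m n) + \<tau> * cnj s + cnj \<tau> * s + \<tau> * cnj \<tau> * of_real d"
      using extend[of "\<lambda>u n. cnj u * K p n"] extend[of "\<lambda>u m. u * K m p"]
      by (subst kernel_form_shift) (auto simp: q cnj_s s_def[symmetric] Kpp N')
    also have "\<dots> = (\<Sum>m<N. \<Sum>n<N. x m * cnj (x n) * K m n) - s * cnj s / of_real d"
      using d by (simp add: \<tau>_def field_simps)
    also have "s * cnj s = (\<Sum>m<N. \<Sum>n<N. x m * cnj (x n) * (K m p * K p n))"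
      unfolding cnj_s[symmetric] unfolding s_def sum_product by (intro sum.cong refl) (simp add: mult_ac)
    finally show ?thesis
      by (simp add: Kpp right_diff_distrib sum_subtractf sum_divide_distrib)
  qed
  moreover have "K n m - K n p * K p m / K p p = cnj (K m n - K m p * K p n / K p p)" for m n
    using herm[of n m] herm[of p m] herm[of n p] by (simp add: Kpp mult.commute)
  ultimately show ?thesis unfolding positive_kernel_def by blast
qed (use K in simp)

text \<open>Schur complements are iterated; a vanishing pivot has a vanishing row and contributes \<open>0\<close> since \<open>x / 0 = 0\<close>.\<close>

lemma positive_kernel_cholesky:
  assumes K: "positive_kernel K"
  shows "\<exists>L. (\<forall>m l. m < l \<longrightarrow> L m l = 0) \<and> (\<forall>m n. K m n = (\<Sum>l\<le>m. L m l * cnj (L n l)))"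
proof -
  define S where "S = rec_nat K (\<lambda>l C m n. C m n - C m l * C l n / C l l)"
  have S0: "S 0 = K" and SSuc: "S (Suc l) = (\<lambda>m n. S l m n - S l m l * S l l n / S l l l)" for l
    by (simp_all add: S_def)
  have pos: "positive_kernel (S l)" for l
    by (induction l) (simp_all add: S0 SSuc K positive_kernel_schur)
  have herm: "S l n m = cnj (S l m n)" for l m n by (rule positive_kernel_hermitian[OF pos])
  \<comment> \<open>Elimination clears row l at step l. Each later correction to that row contains
    one of its own entries as a factor, so the row stays 0.\<close>
  have row: "S l m n = 0" if "m < l" for l m n
    using that
  proof (induction l arbitrary: n)
    case (Suc l)
    show ?case
    proof (cases "m = l")
      case True
      show ?thesis
        using positive_kernel_zero_row[OF pos, of l l n] True by (cases "S l l l = 0") (auto simp: SSuc)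
    next
      case False
      with Suc show ?thesis by (simp add: SSuc)
    qed
  qed simp
  \<comment> \<open>The pivot is split evenly between the two factors; for a vanishing pivot the
    whole column of \<open>L\<close> is 0.\<close>
  define L where "L m l = S l m l / of_real (sqrt (Re (S l l l)))" for m l
  have quot: "(a / complex_of_real r) * cnj (b / complex_of_real r) = a * cnj b / complex_of_real (r * r)" for a b r
    by simp
  have step: "S (Suc l) m n = S l m n - L m l * cnj (L n l)" for l m n
  proof -
    note diag = positive_kernel_diagonal[OF pos, of l l]
    have "L m l * cnj (L n l) = S l m l * S l l n / of_real (sqrt (Re (S l l l)) * sqrt (Re (S l l l)))"
      using quot[of "S l m l" "sqrt (Re (S l l l))" "S l n l"] herm[of l l n] by (simp only: L_def)
    also have "sqrt (Re (S l l l)) * sqrt (Re (S l l l)) = Re (S l l l)" using diag(2) by simp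
    also have "complex_of_real (Re (S l l l)) = S l l l" using diag(1) by simp
    finally show ?thesis by (simp add: SSuc)
  qed
  have "S k m n = K m n - (\<Sum>l<k. L m l * cnj (L n l))" for k m n
    by (induction k) (simp_all add: S0 step)
  \<comment> \<open>After Suc m eliminations row m is 0, so the telescoped identity leaves K m n as
    a finite sum over l <= m.\<close>
  from this[of "Suc m" m n for m n] row
  have "K m n = (\<Sum>l\<le>m. L m l * cnj (L n l))" for m n
    by (simp add: lessThan_Suc_atMost)
  moreover have "L m l = 0" if "m < l" for m l using row[OF that] by (simp add: L_def)
  ultimately show ?thesis by blast
qed

section \<open>Countably many independent standard normal variables\<close>

definition white_noise :: "(nat \<Rightarrow> real) measure" where
  "white_noise = PiM UNIV (\<lambda>_. std_normal_distribution)"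

interpretation white_noise: prob_space white_noise
  unfolding white_noise_def by (intro prob_space_PiM prob_space_normal_density) simp

lemma white_noise_component_measurable [measurable]: "(\<lambda>\<omega>. \<omega> i) \<in> borel_measurable white_noise"
proof -
  have "(\<lambda>\<omega>. \<omega> i) \<in> measurable white_noise std_normal_distribution"
    unfolding white_noise_def by (rule measurable_component_singleton) simp
  thus ?thesis by simp
qed

lemma white_noise_component_distr: "distr white_noise borel (\<lambda>\<omega>. \<omega> i) = std_normal_distribution"
proof -
  interpret product_prob_space "\<lambda>_::nat. std_normal_distribution" UNIV
    by (rule product_prob_spaceI) (simp add: prob_space_normal_density)
  have "distr white_noise std_normal_distribution (\<lambda>\<omega>. \<omega> i) = std_normal_distribution"
    unfolding white_noise_def by (rule PiM_component) simp
  moreover have "distr white_noise borel (\<lambda>\<omega>. \<omega> i) = distr white_noise std_normal_distribution (\<lambda>\<omega>. \<omega> i)"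
    by (rule distr_cong) simp_all
  ultimately show ?thesis by simp
qed

text \<open>The coordinates together form the identity map, so their joint law is the product
  measure itself, that is, the product of the marginal laws.\<close>

lemma white_noise_indep: "white_noise.indep_vars (\<lambda>_. borel) (\<lambda>i \<omega>. \<omega> i) UNIV"
proof (subst white_noise.indep_vars_iff_distr_eq_PiM')
  have "sets white_noise = sets (PiM UNIV (\<lambda>_::nat. borel :: real measure))"
    unfolding white_noise_def by (intro sets_PiM_cong) auto
  hence "distr white_noise (PiM UNIV (\<lambda>_. borel)) (\<lambda>\<omega>. restrict \<omega> UNIV) = distr white_noise white_noise (\<lambda>\<omega>. \<omega>)"
    by (intro distr_cong) auto
  also have "\<dots> = white_noise" by simp
  also have "\<dots> = PiM UNIV (\<lambda>i. distr white_noise borel (\<lambda>\<omega>. \<omega> i))"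
    by (simp only: white_noise_component_distr) (simp add: white_noise_def)
  finally show "distr white_noise (PiM UNIV (\<lambda>_. borel)) (\<lambda>x. \<lambda>i\<in>UNIV. x i) = PiM UNIV (\<lambda>i. distr white_noise borel (\<lambda>\<omega>. \<omega> i))" .
qed auto

lemma white_noise_integral:
  fixes f :: "real \<Rightarrow> 'b::{banach, second_countable_topology}"
  assumes "f \<in> borel_measurable borel"
  shows "(LINT \<omega>|white_noise. f (\<omega> i)) = (LINT x|std_normal_distribution. f x)"
    and "integrable white_noise (\<lambda>\<omega>. f (\<omega> i)) \<longleftrightarrow> integrable std_normal_distribution f"
  using assms unfolding white_noise_component_distr[of i, symmetric]
  by (simp_all add: integral_distr integrable_distr_eq)

lemma white_noise_char:
  "(CLINT \<omega>|white_noise. iexp (\<Sum>i<n. a i * \<omega> i)) = of_real (exp (- (\<Sum>i<n. (a i)\<^sup>2) / 2))"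
proof -
  have ind: "white_noise.indep_vars (\<lambda>_. borel) (\<lambda>i \<omega>. a i * \<omega> i) {..<n}"
    by (rule white_noise.indep_vars_compose2[OF white_noise.indep_vars_subset[OF white_noise_indep]]) auto
  have "(CLINT \<omega>|white_noise. iexp (\<Sum>i<n. a i * \<omega> i)) = char (distr white_noise borel (\<lambda>\<omega>. \<Sum>i<n. a i * \<omega> i)) 1"
    by (simp add: char_def integral_distr)
  also have "\<dots> = (\<Prod>i<n. char (distr white_noise borel (\<lambda>\<omega>. a i * \<omega> i)) 1)"
    by (rule white_noise.char_distr_sum[OF ind])
  also have "\<dots> = (\<Prod>i<n. char std_normal_distribution (a i))"
  proof (intro prod.cong refl)
    fix i
    show "char (distr white_noise borel (\<lambda>\<omega>. a i * \<omega> i)) 1 = char std_normal_distribution (a i)"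
      unfolding char_def using white_noise_integral(1)[of "\<lambda>x. iexp (a i * x)" i]
      by (simp add: integral_distr)
  qed
  also have "\<dots> = (\<Prod>i<n. of_real (exp (- ((a i)\<^sup>2) / 2)))"
    by (simp add: char_std_normal_distribution)
  also have "\<dots> = of_real (exp (\<Sum>i<n. - ((a i)\<^sup>2) / 2))"
    by (simp add: exp_sum del: of_real_exp)
  finally show ?thesis by (simp add: sum_negf sum_divide_distrib)
qed

section \<open>Finite complex combinations of the coordinates\<close>

definition gaussian_coordinate :: "nat \<Rightarrow> (nat \<Rightarrow> real) \<Rightarrow> complex" where
  "gaussian_coordinate i \<omega> = of_real (\<omega> i)"

lemma cnj_gaussian_coordinate [simp]: "cnj (gaussian_coordinate i \<omega>) = gaussian_coordinate i \<omega>"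
  by (simp add: gaussian_coordinate_def)

lemma gaussian_coordinate_orthonormal: "L2_orthonormal white_noise gaussian_coordinate UNIV"
  unfolding L2_orthonormal_def
proof (intro conjI ballI)
  have int1: "integrable white_noise (\<lambda>\<omega>. \<omega> i)" for i
    using white_noise_integral(2)[of "\<lambda>x. x" i] integrable_std_normal_distribution_moment[of 1] by simp
  have int2: "integrable white_noise (\<lambda>\<omega>. (\<omega> i)\<^sup>2)" for i
    using white_noise_integral(2)[of "\<lambda>x. x\<^sup>2" i] integrable_std_normal_distribution_moment[of 2] by simp
  show "gaussian_coordinate i \<in> L2 white_noise" for i
    using int2[of i] by (simp add: L2_iff gaussian_coordinate_def[abs_def])
  fix i j :: nat
  have "(LINT \<omega>|white_noise. \<omega> i * \<omega> j) = (if i = j then 1 else 0)"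
  proof (cases "i = j")
    case True
    have "(LINT \<omega>|white_noise. (\<omega> i)\<^sup>2) = (LINT x|std_normal_distribution. x\<^sup>2)"
      by (rule white_noise_integral) simp
    also have "\<dots> = 1" using std_normal_distribution_even_moments(1)[of 1] by simp
    finally show ?thesis using True by (simp add: power2_eq_square)
  next
    case False
    have "(LINT \<omega>|white_noise. (\<Prod>k\<in>{i, j}. \<omega> k)) = (\<Prod>k\<in>{i, j}. LINT \<omega>|white_noise. \<omega> k)"
      by (rule white_noise.indep_vars_lebesgue_integral[OF _ white_noise.indep_vars_subset[OF white_noise_indep]])
         (use int1 in auto)
    also have "\<dots> = 0"
      using white_noise_integral(1)[of "\<lambda>x. x" i] integral_std_normal_distribution_moment_odd[of 1] False by simp
    finally show ?thesis using False by simp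
  qed
  moreover have "L2_inner white_noise (gaussian_coordinate i) (gaussian_coordinate j) = of_real (LINT \<omega>|white_noise. \<omega> i * \<omega> j)"
    by (simp add: L2_inner_def gaussian_coordinate_def flip: of_real_mult)
  ultimately show "L2_inner white_noise (gaussian_coordinate i) (gaussian_coordinate j) = (if i = j then 1 else 0)"
    by simp
qed

definition gaussian_span :: "((nat \<Rightarrow> real) \<Rightarrow> complex) set" where
  "gaussian_span = {f. \<exists>n c. f = (\<lambda>\<omega>. \<Sum>i<n. c i * gaussian_coordinate i \<omega>)}"

lemma gaussian_span_L2: "f \<in> gaussian_span \<Longrightarrow> f \<in> L2 white_noise"
  using gaussian_coordinate_orthonormal
  by (auto simp: gaussian_span_def L2_orthonormal_def intro!: L2_lincomb)

lemma gaussian_span_scale: "f \<in> gaussian_span \<Longrightarrow> (\<lambda>\<omega>. c * f \<omega>) \<in> gaussian_span"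
  unfolding gaussian_span_def
proof clarify
  fix n d
  show "\<exists>m e. (\<lambda>\<omega>. c * (\<Sum>i<n. d i * gaussian_coordinate i \<omega>)) = (\<lambda>\<omega>. \<Sum>i<m. e i * gaussian_coordinate i \<omega>)"
    by (intro exI[of _ n] exI[of _ "\<lambda>i. c * d i"]) (simp add: sum_distrib_left mult.assoc)
qed

lemma gaussian_span_cnj: "f \<in> gaussian_span \<Longrightarrow> (\<lambda>\<omega>. cnj (f \<omega>)) \<in> gaussian_span"
  unfolding gaussian_span_def
proof clarify
  fix n d
  show "\<exists>m e. (\<lambda>\<omega>. cnj (\<Sum>i<n. d i * gaussian_coordinate i \<omega>)) = (\<lambda>\<omega>. \<Sum>i<m. e i * gaussian_coordinate i \<omega>)"
    by (intro exI[of _ n] exI[of _ "\<lambda>i. cnj (d i)"]) simp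
qed

lemma gaussian_span_zero: "(\<lambda>_. 0) \<in> gaussian_span"
  unfolding gaussian_span_def by (auto intro!: exI[of _ 0])

lemma gaussian_span_coordinate: "gaussian_coordinate i \<in> gaussian_span"
  unfolding gaussian_span_def
  by (auto intro!: exI[of _ "Suc i"] exI[of _ "\<lambda>j. if j = i then 1 else 0"] simp: if_distribR cong: if_cong)

lemma gaussian_span_add:
  assumes "f \<in> gaussian_span" "g \<in> gaussian_span"
  shows "(\<lambda>\<omega>. f \<omega> + g \<omega>) \<in> gaussian_span"
proof -
  obtain n c m d where f: "f = (\<lambda>\<omega>. \<Sum>i<n. c i * gaussian_coordinate i \<omega>)"
    and g: "g = (\<lambda>\<omega>. \<Sum>i<m. d i * gaussian_coordinate i \<omega>)"
    using assms unfolding gaussian_span_def by auto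
  have extend: "(\<Sum>i<k. e i * gaussian_coordinate i \<omega>)
      = (\<Sum>i<n + m. (if i < k then e i else 0) * gaussian_coordinate i \<omega>)" if "k \<le> n + m" for k e \<omega>
    using that by (intro sum.mono_neutral_cong_left) auto
  have "(\<lambda>\<omega>. f \<omega> + g \<omega>)
      = (\<lambda>\<omega>. \<Sum>i<n + m. ((if i < n then c i else 0) + (if i < m then d i else 0)) * gaussian_coordinate i \<omega>)"
    unfolding f g by (subst (1 2) extend) (simp_all only: distrib_right sum.distrib le_add1 le_add2)
  thus ?thesis
    unfolding gaussian_span_def mem_Collect_eq by (intro exI)
qed

lemma gaussian_span_sum:
  assumes "\<And>i. i \<in> I \<Longrightarrow> f i \<in> gaussian_span"
  shows "(\<lambda>\<omega>. \<Sum>i\<in>I. c i * f i \<omega>) \<in> gaussian_span"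
  using assms
proof (induction I rule: infinite_finite_induct)
  case (insert i I)
  have "(\<lambda>\<omega>. c i * f i \<omega> + (\<Sum>j\<in>I. c j * f j \<omega>)) \<in> gaussian_span"
    using insert by (intro gaussian_span_add[of "\<lambda>\<omega>. c i * f i \<omega>"] gaussian_span_scale) auto
  thus ?case using insert.hyps by simp
qed (simp_all add: gaussian_span_zero)

text \<open>The coordinates are real, so Re f is the real combination with coefficients Re c_i. The
  variance is written as an integral to free later arguments from a choice of coefficients. Since
  the span is closed under complex scalars, real parts cover every form a Re f + b Im f.\<close>

lemma gaussian_span_char:
  assumes f: "f \<in> gaussian_span"
  shows "(CLINT \<omega>|white_noise. iexp (Re (f \<omega>))) = of_real (exp (- (LINT \<omega>|white_noise. (Re (f \<omega>))\<^sup>2) / 2))"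
proof -
  obtain n c where f: "f = (\<lambda>\<omega>. \<Sum>i<n. c i * gaussian_coordinate i \<omega>)"
    using f unfolding gaussian_span_def by auto
  have Re: "Re (f \<omega>) = (\<Sum>i<n. Re (c i) * \<omega> i)" for \<omega>
    by (simp add: f gaussian_coordinate_def)
  have "(LINT \<omega>|white_noise. (Re (f \<omega>))\<^sup>2)
      = (LINT \<omega>|white_noise. (cmod (\<Sum>i<n. complex_of_real (Re (c i)) * gaussian_coordinate i \<omega>))\<^sup>2)"
    unfolding Re by (simp add: gaussian_coordinate_def flip: of_real_mult of_real_sum)
  also have "\<dots> = (\<Sum>i<n. (Re (c i))\<^sup>2)"
    using L2_orthonormal_norm_lincomb[OF gaussian_coordinate_orthonormal, of "{..<n}" "\<lambda>i. of_real (Re (c i))"]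
    by (simp add: L2_norm_square)
  finally show ?thesis unfolding Re by (simp only: white_noise_char)
qed

section \<open>The Gaussian Hilbert space of white noise\<close>

lemma cmod_iexp_diff_le: "cmod (iexp x - iexp y) \<le> \<bar>x - y\<bar>"
proof -
  have "iexp x - iexp y = iexp y * (iexp (x - y) - 1)"
    by (simp add: algebra_simps flip: exp_add)
  hence "cmod (iexp x - iexp y) = cmod (iexp (x - y) - 1)" by (simp add: norm_mult)
  also have "\<dots> \<le> \<bar>x - y\<bar>" using iexp_approx1[of "x - y" 0] by simp
  finally show ?thesis .
qed

text \<open>Zero variance gives the degenerate alternative. Otherwise division by \<sigma> reduces
  to the standard normal law, which its characteristic function determines.\<close>

lemma (in prob_space) centered_gaussian_of_char:
  fixes Y :: "'a \<Rightarrow> real"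
  assumes Y [measurable]: "Y \<in> borel_measurable M" and sq: "integrable M (\<lambda>x. (Y x)\<^sup>2)"
    and char: "\<And>t. (CLINT x|M. iexp (t * Y x)) = of_real (exp (- (t\<^sup>2 * (LINT x|M. (Y x)\<^sup>2)) / 2))"
  shows "centered_gaussian M Y"
proof (cases "(LINT x|M. (Y x)\<^sup>2) = 0")
  case True
  hence "AE x in M. (Y x)\<^sup>2 = 0"
    using integral_nonneg_eq_0_iff_AE[OF sq] by simp
  thus ?thesis by (simp add: centered_gaussian_def)
next
  case False
  define \<sigma> where "\<sigma> = sqrt (LINT x|M. (Y x)\<^sup>2)"
  have nn: "0 \<le> (LINT x|M. (Y x)\<^sup>2)" by (intro Bochner_Integration.integral_nonneg) auto
  hence "0 < (LINT x|M. (Y x)\<^sup>2)" using False by linarith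
  hence \<sigma>: "\<sigma> > 0" by (simp add: \<sigma>_def)
  have \<sigma>2: "(LINT x|M. (Y x)\<^sup>2) = \<sigma>\<^sup>2" using nn by (simp add: \<sigma>_def)
  have "distr M borel (\<lambda>x. (Y x - 0) / \<sigma>) = std_normal_distribution"
  proof (rule Levy_uniqueness)
    show "real_distribution (distr M borel (\<lambda>x. (Y x - 0) / \<sigma>))"
      by (rule real_distribution_distr) simp
    show "real_distribution std_normal_distribution" by (rule real_dist_normal_dist)
    show "char (distr M borel (\<lambda>x. (Y x - 0) / \<sigma>)) = char std_normal_distribution"
    proof
      fix t
      have "char (distr M borel (\<lambda>x. (Y x - 0) / \<sigma>)) t = (CLINT x|M. iexp (t / \<sigma> * Y x))"
        by (simp add: char_def integral_distr)
      also have "\<dots> = char std_normal_distribution t"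
        unfolding char \<sigma>2 char_std_normal_distribution using \<sigma> by (simp add: power_divide)
      finally show "char (distr M borel (\<lambda>x. (Y x - 0) / \<sigma>)) t = char std_normal_distribution t" .
    qed
  qed
  moreover have "distr M lborel (\<lambda>x. (Y x - 0) / \<sigma>) = distr M borel (\<lambda>x. (Y x - 0) / \<sigma>)"
    by (rule distr_cong) simp_all
  ultimately have "distributed M lborel (\<lambda>x. (Y x - 0) / \<sigma>) std_normal_density"
    by (simp add: distributed_def)
  hence "distributed M lborel Y (normal_density 0 \<sigma>)"
    using normal_standard_normal_convert[OF \<sigma>, of Y 0] by simp
  thus ?thesis using \<sigma> by (auto simp: centered_gaussian_def)
qed

text \<open>The norm closure of \<open>gaussian_span\<close>, phrased by approximation within e, so
  that the closure properties become splittings of e.\<close>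

definition white_noise_space :: "((nat \<Rightarrow> real) \<Rightarrow> complex) set" where
  "white_noise_space = {f \<in> L2 white_noise.
     \<forall>e>0. \<exists>X\<in>gaussian_span. L2_norm white_noise (\<lambda>\<omega>. X \<omega> - f \<omega>) < e}"

lemma white_noise_space_approx:
  assumes "f \<in> white_noise_space" "e > 0"
  obtains X where "X \<in> gaussian_span" "L2_norm white_noise (\<lambda>\<omega>. X \<omega> - f \<omega>) < e"
  using assms unfolding white_noise_space_def by blast

lemma gaussian_span_subset: "gaussian_span \<subseteq> white_noise_space"
  by (auto simp: white_noise_space_def gaussian_span_L2 L2_norm_def intro!: bexI)

text \<open>Gaussianity survives norm limits: exp(ix) is 1-Lipschitz, so the characteristic
  functions of the approximants converge, and their variances converge with the norms.\<close>

lemma white_noise_space_gaussian: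
  assumes f: "f \<in> white_noise_space"
  shows "centered_complex_gaussian white_noise f"
  unfolding centered_complex_gaussian_def
proof (intro allI)
  fix a b :: real
  have fL2: "f \<in> L2 white_noise" using f by (simp add: white_noise_space_def)
  \<comment> \<open>R w is the real part of (a - ib) w. It thus maps span elements to real parts of
    span elements, and |R w| <= |a - ib| |w| passes the approximation on to the real forms.\<close>
  define R :: "complex \<Rightarrow> real" where "R w = a * Re w + b * Im w" for w
  have R_eq: "R w = Re (Complex a (- b) * w)" for w by (simp add: R_def)
  have R_diff: "R v - R w = R (v - w)" for v w by (simp add: R_def algebra_simps)
  have R_bound: "\<bar>R w\<bar> \<le> cmod (Complex a (- b)) * cmod w" for w
    using abs_Re_le_cmod[of "Complex a (- b) * w"] by (simp only: R_eq norm_mult)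
  have R_L2: "(\<lambda>\<omega>. complex_of_real (R (g \<omega>))) \<in> L2 white_noise" if "g \<in> L2 white_noise" for g
  proof (rule L2_bound[OF L2_scale[OF that, of "Complex a (- b)"]])
    note [measurable] = L2_measurable[OF that]
    show "(\<lambda>\<omega>. complex_of_real (R (g \<omega>))) \<in> borel_measurable white_noise"
      unfolding R_def by measurable
  qed (use R_bound in \<open>auto simp: norm_mult\<close>)
  have "\<forall>n. \<exists>X\<in>gaussian_span. L2_norm white_noise (\<lambda>\<omega>. X \<omega> - f \<omega>) < inverse (real (Suc n))"
    using f by (simp add: white_noise_space_def)
  then obtain X where X: "\<And>n. X n \<in> gaussian_span"
    and X_lt: "\<And>n. L2_norm white_noise (\<lambda>\<omega>. X n \<omega> - f \<omega>) < inverse (real (Suc n))"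
    by metis
  have XL2: "X n \<in> L2 white_noise" for n by (rule gaussian_span_L2[OF X])
  define Y where "Y n \<omega> = complex_of_real (R (X n \<omega>))" for n \<omega>
  define Z where "Z \<omega> = complex_of_real (R (f \<omega>))" for \<omega>
  have Y: "Y n \<in> L2 white_noise" for n unfolding Y_def[abs_def] by (rule R_L2[OF XL2])
  have Z: "Z \<in> L2 white_noise" unfolding Z_def[abs_def] by (rule R_L2[OF fL2])
  have YZ: "(\<lambda>n. L2_norm white_noise (\<lambda>\<omega>. Y n \<omega> - Z \<omega>)) \<longlonglongrightarrow> 0"
  proof (rule Lim_null_comparison)
    show "(\<lambda>n. cmod (Complex a (- b)) * inverse (real (Suc n))) \<longlonglongrightarrow> 0"
      using tendsto_mult_right_zero[OF LIMSEQ_inverse_real_of_nat] by blast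
    show "\<forall>\<^sub>F n in sequentially. norm (L2_norm white_noise (\<lambda>\<omega>. Y n \<omega> - Z \<omega>))
        \<le> cmod (Complex a (- b)) * inverse (real (Suc n))"
    proof (rule always_eventually, rule allI)
      fix n
      have "L2_norm white_noise (\<lambda>\<omega>. Y n \<omega> - Z \<omega>)
          \<le> L2_norm white_noise (\<lambda>\<omega>. Complex a (- b) * (X n \<omega> - f \<omega>))"
        by (rule L2_norm_mono_AE)
           (use L2_measurable[OF L2_diff[OF Y Z]] R_bound in
              \<open>auto intro!: L2_scale L2_diff XL2 fL2 simp: Y_def Z_def R_diff norm_mult simp flip: of_real_diff\<close>)
      also have "\<dots> \<le> cmod (Complex a (- b)) * inverse (real (Suc n))"
        unfolding L2_norm_scale using X_lt[of n] by (intro mult_left_mono) auto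
      finally show "norm (L2_norm white_noise (\<lambda>\<omega>. Y n \<omega> - Z \<omega>)) \<le> cmod (Complex a (- b)) * inverse (real (Suc n))"
        by simp
    qed
  qed
  have sq: "(L2_norm white_noise (\<lambda>\<omega>. complex_of_real (g \<omega>)))\<^sup>2 = (LINT \<omega>|white_noise. (g \<omega>)\<^sup>2)" for g
    by (simp add: L2_norm_square)
  have Rf [measurable]: "(\<lambda>\<omega>. R (f \<omega>)) \<in> borel_measurable white_noise"
    unfolding R_def using L2_measurable[OF fL2] by measurable
  have RX [measurable]: "(\<lambda>\<omega>. R (X n \<omega>)) \<in> borel_measurable white_noise" for n
    unfolding R_def using L2_measurable[OF XL2[of n]] by measurable
  have "centered_gaussian white_noise (\<lambda>\<omega>. R (f \<omega>))"
  proof (rule white_noise.centered_gaussian_of_char)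
    show "integrable white_noise (\<lambda>\<omega>. (R (f \<omega>))\<^sup>2)"
      using L2_square_integrable[OF Z] by (simp add: Z_def)
    fix t :: real
    have char_X: "(CLINT \<omega>|white_noise. iexp (t * R (X n \<omega>)))
        = of_real (exp (- (t\<^sup>2 * (L2_norm white_noise (Y n))\<^sup>2) / 2))" for n
    proof -
      have Re: "Re ((of_real t * Complex a (- b)) * X n \<omega>) = t * R (X n \<omega>)" for \<omega>
        by (simp add: R_def algebra_simps)
      show ?thesis
        using gaussian_span_char[OF gaussian_span_scale[OF X[of n], of "of_real t * Complex a (- b)"]]
        unfolding Re by (simp add: Y_def[abs_def] sq power_mult_distrib)
    qed
    have "(\<lambda>n. CLINT \<omega>|white_noise. iexp (t * R (X n \<omega>))) \<longlonglongrightarrow> (CLINT \<omega>|white_noise. iexp (t * R (f \<omega>)))"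
    proof (rule LIM_zero_cancel, rule Lim_null_comparison)
      show "(\<lambda>n. \<bar>t\<bar> * (L2_norm white_noise (\<lambda>\<omega>. Y n \<omega> - Z \<omega>) * L2_norm white_noise (\<lambda>_. 1))) \<longlonglongrightarrow> 0"
        by (intro tendsto_mult_right_zero tendsto_mult_left_zero YZ)
      show "\<forall>\<^sub>F n in sequentially. norm ((CLINT \<omega>|white_noise. iexp (t * R (X n \<omega>))) - (CLINT \<omega>|white_noise. iexp (t * R (f \<omega>))))
          \<le> \<bar>t\<bar> * (L2_norm white_noise (\<lambda>\<omega>. Y n \<omega> - Z \<omega>) * L2_norm white_noise (\<lambda>_. 1))"
      proof (rule always_eventually, rule allI)
        fix n
        have one: "(\<lambda>_. 1) \<in> L2 white_noise" by (simp add: L2_iff)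
        have int: "integrable white_noise (\<lambda>\<omega>. iexp (t * R (X n \<omega>)))" "integrable white_noise (\<lambda>\<omega>. iexp (t * R (f \<omega>)))"
          by (intro white_noise.integrable_iexp; simp)+
        have "norm ((CLINT \<omega>|white_noise. iexp (t * R (X n \<omega>))) - (CLINT \<omega>|white_noise. iexp (t * R (f \<omega>))))
            = norm (CLINT \<omega>|white_noise. iexp (t * R (X n \<omega>)) - iexp (t * R (f \<omega>)))"
          using int by simp
        also have "\<dots> \<le> (LINT \<omega>|white_noise. cmod (iexp (t * R (X n \<omega>)) - iexp (t * R (f \<omega>))))"
          by (rule integral_norm_bound)
        also have "\<dots> \<le> (LINT \<omega>|white_noise. \<bar>t\<bar> * cmod ((Y n \<omega> - Z \<omega>) * 1))"
        proof (rule integral_mono)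
          show "integrable white_noise (\<lambda>\<omega>. cmod (iexp (t * R (X n \<omega>)) - iexp (t * R (f \<omega>))))"
            by (intro integrable_norm Bochner_Integration.integrable_diff int)
          show "integrable white_noise (\<lambda>\<omega>. \<bar>t\<bar> * cmod ((Y n \<omega> - Z \<omega>) * 1))"
            by (intro integrable_mult_right integrable_norm L2_product_integrable L2_diff Y Z one)
          fix \<omega>
          have "cmod (iexp (t * R (X n \<omega>)) - iexp (t * R (f \<omega>))) \<le> \<bar>t * R (X n \<omega>) - t * R (f \<omega>)\<bar>"
            by (rule cmod_iexp_diff_le)
          also have "\<dots> = \<bar>t\<bar> * cmod ((Y n \<omega> - Z \<omega>) * 1)"
            by (simp add: Y_def Z_def flip: of_real_diff right_diff_distrib abs_mult)
          finally show "cmod (iexp (t * R (X n \<omega>)) - iexp (t * R (f \<omega>))) \<le> \<bar>t\<bar> * cmod ((Y n \<omega> - Z \<omega>) * 1)" .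
        qed
        also have "\<dots> \<le> \<bar>t\<bar> * (L2_norm white_noise (\<lambda>\<omega>. Y n \<omega> - Z \<omega>) * L2_norm white_noise (\<lambda>_. 1))"
          using L2_Cauchy_Schwarz_cmod[OF L2_diff[OF Y[of n] Z] one] by (simp add: mult_left_mono)
        finally show "norm ((CLINT \<omega>|white_noise. iexp (t * R (X n \<omega>))) - (CLINT \<omega>|white_noise. iexp (t * R (f \<omega>))))
          \<le> \<bar>t\<bar> * (L2_norm white_noise (\<lambda>\<omega>. Y n \<omega> - Z \<omega>) * L2_norm white_noise (\<lambda>_. 1))" .
      qed
    qed
    moreover have "(\<lambda>n. CLINT \<omega>|white_noise. iexp (t * R (X n \<omega>)))
        \<longlonglongrightarrow> of_real (exp (- (t\<^sup>2 * (L2_norm white_noise Z)\<^sup>2) / 2))"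
      unfolding char_X by (intro tendsto_intros L2_norm_tendsto Y Z YZ) simp
    ultimately show "(CLINT \<omega>|white_noise. iexp (t * R (f \<omega>)))
        = of_real (exp (- (t\<^sup>2 * (LINT \<omega>|white_noise. (R (f \<omega>))\<^sup>2)) / 2))"
      unfolding sq[symmetric] Z_def[abs_def, symmetric] by (rule LIMSEQ_unique)
  qed simp
  thus "centered_gaussian white_noise (\<lambda>\<omega>. a * Re (f \<omega>) + b * Im (f \<omega>))" by (simp add: R_def)
qed

lemma white_noise_space_gaussian_hilbert: "gaussian_hilbert_space white_noise white_noise_space"
  unfolding gaussian_hilbert_space_def
proof (intro conjI)
  show "prob_space white_noise" by (rule white_noise.prob_space_axioms)
  show "white_noise_space \<subseteq> L2 white_noise" by (auto simp: white_noise_space_def)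
  show "(\<lambda>_. 0) \<in> white_noise_space" using gaussian_span_subset gaussian_span_zero by blast
  show "\<forall>f\<in>white_noise_space. \<forall>g\<in>white_noise_space. (\<lambda>\<omega>. f \<omega> + g \<omega>) \<in> white_noise_space"
  proof (intro ballI)
    fix f g assume fg: "f \<in> white_noise_space" "g \<in> white_noise_space"
    have L2: "f \<in> L2 white_noise" "g \<in> L2 white_noise" using fg by (auto simp: white_noise_space_def)
    have "\<exists>X\<in>gaussian_span. L2_norm white_noise (\<lambda>\<omega>. X \<omega> - (f \<omega> + g \<omega>)) < e" if "e > 0" for e
    proof -
      have "e / 2 > 0" using \<open>e > 0\<close> by simp
      obtain X where X: "X \<in> gaussian_span" "L2_norm white_noise (\<lambda>\<omega>. X \<omega> - f \<omega>) < e / 2"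
        using fg(1) \<open>e / 2 > 0\<close> by (rule white_noise_space_approx)
      obtain Y where Y: "Y \<in> gaussian_span" "L2_norm white_noise (\<lambda>\<omega>. Y \<omega> - g \<omega>) < e / 2"
        using fg(2) \<open>e / 2 > 0\<close> by (rule white_noise_space_approx)
      have "L2_norm white_noise (\<lambda>\<omega>. (X \<omega> - f \<omega>) + (Y \<omega> - g \<omega>)) < e"
        using L2_norm_triangle[OF L2_diff[OF gaussian_span_L2[OF X(1)] L2(1)] L2_diff[OF gaussian_span_L2[OF Y(1)] L2(2)]] X(2) Y(2)
        by simp
      hence "L2_norm white_noise (\<lambda>\<omega>. (X \<omega> + Y \<omega>) - (f \<omega> + g \<omega>)) < e" by (simp only: add_diff_add)
      thus ?thesis using gaussian_span_add[OF X(1) Y(1)] by (rule bexI)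
    qed
    thus "(\<lambda>\<omega>. f \<omega> + g \<omega>) \<in> white_noise_space" using L2 by (simp add: white_noise_space_def L2_add)
  qed
  show "\<forall>c. \<forall>f\<in>white_noise_space. (\<lambda>\<omega>. c * f \<omega>) \<in> white_noise_space"
  proof (intro allI ballI)
    fix c f assume f: "f \<in> white_noise_space"
    have L2: "f \<in> L2 white_noise" using f by (auto simp: white_noise_space_def)
    have "\<exists>X\<in>gaussian_span. L2_norm white_noise (\<lambda>\<omega>. X \<omega> - c * f \<omega>) < e" if "e > 0" for e
    proof -
      have "e / (cmod c + 1) > 0" using \<open>e > 0\<close> by (simp add: add_nonneg_pos)
      then obtain X where X: "X \<in> gaussian_span" "L2_norm white_noise (\<lambda>\<omega>. X \<omega> - f \<omega>) < e / (cmod c + 1)"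
        by (rule white_noise_space_approx[OF f])
      have "L2_norm white_noise (\<lambda>\<omega>. c * (X \<omega> - f \<omega>)) \<le> cmod c * (e / (cmod c + 1))"
        unfolding L2_norm_scale using X(2) by (intro mult_left_mono) auto
      also have "\<dots> < e"
      proof -
        have "cmod c + 1 > 0" by (simp add: add_nonneg_pos)
        thus ?thesis using \<open>e > 0\<close> by (simp add: field_simps)
      qed
      finally have "L2_norm white_noise (\<lambda>\<omega>. c * X \<omega> - c * f \<omega>) < e" by (simp add: right_diff_distrib)
      thus ?thesis using gaussian_span_scale[OF X(1)] by (rule bexI)
    qed
    thus "(\<lambda>\<omega>. c * f \<omega>) \<in> white_noise_space" using L2 by (simp add: white_noise_space_def L2_scale)
  qed
  show "\<forall>X. \<forall>f\<in>L2 white_noise. (\<forall>n::nat. X n \<in> white_noise_space) \<longrightarrow>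
        (\<lambda>n. L2_norm white_noise (\<lambda>\<omega>. X n \<omega> - f \<omega>)) \<longlonglongrightarrow> 0 \<longrightarrow> f \<in> white_noise_space"
  proof (intro allI ballI impI)
    fix X f assume f: "f \<in> L2 white_noise" and X: "\<forall>n::nat. X n \<in> white_noise_space"
      and lim: "(\<lambda>n. L2_norm white_noise (\<lambda>\<omega>. X n \<omega> - f \<omega>)) \<longlonglongrightarrow> 0"
    have XL2: "X n \<in> L2 white_noise" for n using X by (auto simp: white_noise_space_def)
    have "\<exists>Y\<in>gaussian_span. L2_norm white_noise (\<lambda>\<omega>. Y \<omega> - f \<omega>) < e" if "e > 0" for e
    proof -
      obtain n where n: "L2_norm white_noise (\<lambda>\<omega>. X n \<omega> - f \<omega>) < e / 2"
        using LIMSEQ_D[OF lim, of "e / 2"] \<open>e > 0\<close> by auto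
      obtain Y where Y: "Y \<in> gaussian_span" "L2_norm white_noise (\<lambda>\<omega>. Y \<omega> - X n \<omega>) < e / 2"
        by (rule white_noise_space_approx[of "X n" "e / 2"]) (use X \<open>e > 0\<close> in auto)
      have "L2_norm white_noise (\<lambda>\<omega>. Y \<omega> - f \<omega>) < e"
        using L2_norm_triangle_diff[OF gaussian_span_L2[OF Y(1)] XL2[of n] f] n Y(2) by simp
      thus ?thesis using Y(1) by (rule bexI)
    qed
    thus "f \<in> white_noise_space" using f by (simp add: white_noise_space_def)
  qed
  have cnj: "(\<lambda>\<omega>. cnj (f \<omega>)) \<in> white_noise_space" if f: "f \<in> white_noise_space" for f
  proof -
    have "\<exists>X\<in>gaussian_span. L2_norm white_noise (\<lambda>\<omega>. X \<omega> - cnj (f \<omega>)) < e" if "e > 0" for e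
    proof -
      obtain X where X: "X \<in> gaussian_span" "L2_norm white_noise (\<lambda>\<omega>. X \<omega> - f \<omega>) < e"
        using f \<open>e > 0\<close> by (rule white_noise_space_approx)
      have "L2_norm white_noise (\<lambda>\<omega>. cnj (X \<omega>) - cnj (f \<omega>)) < e"
        using X(2) by (simp flip: complex_cnj_diff)
      thus ?thesis using gaussian_span_cnj[OF X(1)] by (rule bexI)
    qed
    thus ?thesis using f by (simp add: white_noise_space_def L2_cnj)
  qed
  show "\<forall>f. f \<in> white_noise_space \<longleftrightarrow> (\<lambda>\<omega>. cnj (f \<omega>)) \<in> white_noise_space"
  proof
    fix f
    show "f \<in> white_noise_space \<longleftrightarrow> (\<lambda>\<omega>. cnj (f \<omega>)) \<in> white_noise_space"
      using cnj[of f] cnj[of "\<lambda>\<omega>. cnj (f \<omega>)"] by auto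
  qed
  show "\<forall>f\<in>white_noise_space. centered_complex_gaussian white_noise f"
    using white_noise_space_gaussian by blast
qed

text \<open>Integrate 2 (Re Z)^2 = Re (Z^2) + |Z|^2. Circularity makes the integral of Z^2 vanish,
  so only half of the squared norm remains, whatever the arguments of the coefficients.\<close>

lemma gaussian_span_circular_norm:
  assumes span: "\<And>i. i \<in> I \<Longrightarrow> \<alpha> i \<in> gaussian_span"
    and on: "L2_orthonormal white_noise \<alpha> I"
    and circ: "\<And>i j. i \<in> I \<Longrightarrow> j \<in> I \<Longrightarrow> L2_inner white_noise (\<alpha> i) (\<lambda>\<omega>. cnj (\<alpha> j \<omega>)) = 0"
    and F: "finite F" "F \<subseteq> I"
  shows "(LINT \<omega>|white_noise. (Re (\<Sum>i\<in>F. c i * \<alpha> i \<omega>))\<^sup>2) = (\<Sum>i\<in>F. (cmod (c i))\<^sup>2) / 2"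
proof -
  define Z where "Z \<omega> = (\<Sum>i\<in>F. c i * \<alpha> i \<omega>)" for \<omega>
  have L2: "\<alpha> i \<in> L2 white_noise" if "i \<in> F" for i using span gaussian_span_L2 that F by auto
  have Z: "Z \<in> L2 white_noise" unfolding Z_def[abs_def] by (intro L2_lincomb L2)
  have norm: "(L2_norm white_noise Z)\<^sup>2 = (\<Sum>i\<in>F. (cmod (c i))\<^sup>2)"
    unfolding Z_def[abs_def] by (rule L2_orthonormal_norm_lincomb[OF on F(2,1)])
  have sq: "(LINT \<omega>|white_noise. (Z \<omega>)\<^sup>2) = 0"
  proof -
    have "(LINT \<omega>|white_noise. (Z \<omega>)\<^sup>2) = L2_inner white_noise Z (\<lambda>\<omega>. \<Sum>j\<in>F. cnj (c j) * cnj (\<alpha> j \<omega>))"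
      by (simp add: L2_inner_def Z_def power2_eq_square)
    also have "\<dots> = (\<Sum>j\<in>F. c j * L2_inner white_noise Z (\<lambda>\<omega>. cnj (\<alpha> j \<omega>)))"
      using L2_inner_lincomb_right[of F "\<lambda>j \<omega>. cnj (\<alpha> j \<omega>)" white_noise Z "\<lambda>j. cnj (c j)"] by (simp add: L2 L2_cnj Z)
    also have "\<dots> = 0"
    proof (intro sum.neutral ballI)
      fix j assume j: "j \<in> F"
      have "L2_inner white_noise Z (\<lambda>\<omega>. cnj (\<alpha> j \<omega>)) = (\<Sum>i\<in>F. c i * L2_inner white_noise (\<alpha> i) (\<lambda>\<omega>. cnj (\<alpha> j \<omega>)))"
        unfolding Z_def[abs_def] by (intro L2_inner_lincomb_left L2 L2_cnj j)
      also have "\<dots> = 0" using circ F j by (intro sum.neutral ballI) auto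
      finally show "c j * L2_inner white_noise Z (\<lambda>\<omega>. cnj (\<alpha> j \<omega>)) = 0" by simp
    qed
    finally show ?thesis .
  qed
  have "integrable white_noise (\<lambda>\<omega>. (Z \<omega>)\<^sup>2)"
    using L2_product_integrable[OF Z Z] by (simp add: power2_eq_square)
  hence "(LINT \<omega>|white_noise. Re ((Z \<omega>)\<^sup>2) + (cmod (Z \<omega>))\<^sup>2) = Re (LINT \<omega>|white_noise. (Z \<omega>)\<^sup>2) + (L2_norm white_noise Z)\<^sup>2"
    using L2_square_integrable[OF Z] by (simp add: L2_norm_square)
  moreover have "Re ((Z \<omega>)\<^sup>2) + (cmod (Z \<omega>))\<^sup>2 = 2 * (Re (Z \<omega>))\<^sup>2" for \<omega>
    by (simp add: cmod_power2 Re_power2)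
  ultimately have "2 * (LINT \<omega>|white_noise. (Re (Z \<omega>))\<^sup>2) = (\<Sum>i\<in>F. (cmod (c i))\<^sup>2)"
    by (simp add: sq norm)
  thus ?thesis by (simp add: Z_def)
qed

text \<open>All real and imaginary parts are treated as one real family X. By the variance formula
  its joint characteristic function is exp of minus a quarter of the sum of squares, which factors;
  pairing the parts again gives the independence of the \<alpha>_i.\<close>

lemma gaussian_span_indep:
  assumes span: "\<And>i. i \<in> I \<Longrightarrow> \<alpha> i \<in> gaussian_span"
    and on: "L2_orthonormal white_noise \<alpha> I"
    and circ: "\<And>i j. i \<in> I \<Longrightarrow> j \<in> I \<Longrightarrow> L2_inner white_noise (\<alpha> i) (\<lambda>\<omega>. cnj (\<alpha> j \<omega>)) = 0"
  shows "white_noise.indep_vars (\<lambda>_. borel) \<alpha> I"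
proof -
  define X where "X p \<omega> = (if snd p then Re (\<alpha> (fst p) \<omega>) else Im (\<alpha> (fst p) \<omega>))" for p \<omega>
  have X_meas: "X p \<in> borel_measurable white_noise" if "p \<in> I \<times> UNIV" for p
  proof -
    have [measurable]: "\<alpha> (fst p) \<in> borel_measurable white_noise"
      using that span by (intro L2_measurable gaussian_span_L2) auto
    show ?thesis unfolding X_def[abs_def] by measurable
  qed
  have char: "(CLINT \<omega>|white_noise. iexp (\<Sum>p\<in>J. t p * X p \<omega>)) = of_real (exp (- (\<Sum>p\<in>J. (t p)\<^sup>2) / 4))"
    if J: "finite J" "J \<subseteq> I \<times> UNIV" for J t
  proof -
    \<comment> \<open>J may contain only one of the two parts of some \<alpha>_i; the missing one
      receives frequency 0.\<close>
    define t' where "t' p = (if p \<in> J then t p else 0)" for p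
    define F where "F = fst ` J"
    \<comment> \<open>The minus sign is chosen so that Re (c_i \<alpha>_i) = t' (i, True) Re
      \<alpha>_i + t' (i, False) Im \<alpha>_i.\<close>
    define c where "c i = Complex (t' (i, True)) (- t' (i, False))" for i
    have F: "finite F" "F \<subseteq> I" using J by (auto simp: F_def)
    have sub: "J \<subseteq> F \<times> UNIV" by (force simp: F_def)
    have split: "(\<Sum>p\<in>F \<times> UNIV. g p) = (\<Sum>i\<in>F. g (i, True) + g (i, False))" for g :: "'a \<times> bool \<Rightarrow> real"
      by (simp add: sum.cartesian_product' UNIV_bool add.commute)
    have "(\<Sum>p\<in>J. t p * X p \<omega>) = (\<Sum>p\<in>F \<times> UNIV. t' p * X p \<omega>)" for \<omega>
      using F(1) sub by (intro sum.mono_neutral_cong_left) (auto simp: t'_def)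
    also have "(\<Sum>p\<in>F \<times> UNIV. t' p * X p \<omega>) = Re (\<Sum>i\<in>F. c i * \<alpha> i \<omega>)" for \<omega>
      by (simp add: split X_def c_def)
    finally have lin: "(\<Sum>p\<in>J. t p * X p \<omega>) = Re (\<Sum>i\<in>F. c i * \<alpha> i \<omega>)" for \<omega> .
    have "(\<Sum>i\<in>F. (cmod (c i))\<^sup>2) = (\<Sum>p\<in>F \<times> UNIV. (t' p)\<^sup>2)"
      by (simp add: split c_def cmod_power2)
    also have "\<dots> = (\<Sum>p\<in>J. (t p)\<^sup>2)"
      using F(1) sub by (intro sum.mono_neutral_cong_right) (auto simp: t'_def)
    finally have var: "(\<Sum>i\<in>F. (cmod (c i))\<^sup>2) = (\<Sum>p\<in>J. (t p)\<^sup>2)" .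
    have "(\<lambda>\<omega>. \<Sum>i\<in>F. c i * \<alpha> i \<omega>) \<in> gaussian_span"
      using F span by (intro gaussian_span_sum) auto
    from gaussian_span_char[OF this]
    have "(CLINT \<omega>|white_noise. iexp (\<Sum>p\<in>J. t p * X p \<omega>))
        = of_real (exp (- (LINT \<omega>|white_noise. (Re (\<Sum>i\<in>F. c i * \<alpha> i \<omega>))\<^sup>2) / 2))"
      by (simp only: lin)
    also have "(LINT \<omega>|white_noise. (Re (\<Sum>i\<in>F. c i * \<alpha> i \<omega>))\<^sup>2) = (\<Sum>p\<in>J. (t p)\<^sup>2) / 2"
      using gaussian_span_circular_norm[OF span on circ F, of c] var by simp
    finally show ?thesis by simp
  qed
  have "white_noise.indep_vars (\<lambda>_. borel) X (I \<times> UNIV)"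
  proof (rule white_noise.indep_vars_of_char[OF X_meas])
    fix J t assume J: "finite J" "J \<subseteq> I \<times> (UNIV :: bool set)"
    have "(CLINT \<omega>|white_noise. iexp (t p * X p \<omega>)) = of_real (exp (- ((t p)\<^sup>2) / 4))" if "p \<in> J" for p
      using char[of "{p}" t] that J by auto
    moreover have "exp (- (\<Sum>p\<in>J. (t p)\<^sup>2) / 4) = (\<Prod>p\<in>J. exp (- ((t p)\<^sup>2) / 4))"
      using J(1) by (simp add: sum_negf sum_divide_distrib flip: exp_sum)
    ultimately show "(CLINT \<omega>|white_noise. iexp (\<Sum>p\<in>J. t p * X p \<omega>)) = (\<Prod>p\<in>J. CLINT \<omega>|white_noise. iexp (t p * X p \<omega>))"
      by (simp only: char[OF J] of_real_prod cong: prod.cong)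
  qed
  \<comment> \<open>The blocks {i} x UNIV are disjoint, and each \<alpha>_i is a measurable function
    of its own block.\<close>
  hence "white_noise.indep_vars (\<lambda>i. PiM ({i} \<times> UNIV) (\<lambda>_. borel)) (\<lambda>i \<omega>. restrict (\<lambda>p. X p \<omega>) ({i} \<times> UNIV)) I"
    by (rule white_noise.indep_vars_restrict) (auto simp: disjoint_family_on_def)
  hence "white_noise.indep_vars (\<lambda>_. borel)
      (\<lambda>i \<omega>. (\<lambda>f. complex_of_real (f (i, True)) + \<i> * complex_of_real (f (i, False))) (restrict (\<lambda>p. X p \<omega>) ({i} \<times> UNIV))) I"
  proof (rule white_noise.indep_vars_compose2)
    fix i
    have [measurable]: "(\<lambda>f. f (i, b)) \<in> borel_measurable (PiM ({i} \<times> UNIV) (\<lambda>_. borel :: real measure))" for b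
      by (rule measurable_component_singleton) simp
    show "(\<lambda>f. complex_of_real (f (i, True)) + \<i> * complex_of_real (f (i, False)))
        \<in> borel_measurable (PiM ({i} \<times> UNIV) (\<lambda>_. borel))" by measurable
  qed
  thus ?thesis by (simp add: X_def flip: complex_eq)
qed

text \<open>The v_m are the rows of the Cholesky factor applied to independent circular variables
  \<gamma>_l. The factorization gives the Gram matrix; and since no cnj \<gamma>_l enters, the
  integrals of all products v_m v_n vanish.\<close>

lemma gaussian_family_of_kernel:
  assumes K: "positive_kernel K"
  shows "\<exists>v. (\<forall>m. v m \<in> gaussian_span) \<and> (\<forall>m n. L2_inner white_noise (v m) (v n) = K m n) \<and>
    (\<forall>m n. L2_inner white_noise (v m) (\<lambda>\<omega>. cnj (v n \<omega>)) = 0)"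
proof -
  let ?\<xi> = gaussian_coordinate
  note on = gaussian_coordinate_orthonormal[unfolded L2_orthonormal_def]
  obtain L where L0: "\<And>m l. m < l \<Longrightarrow> L m l = 0" and L: "\<And>m n. K m n = (\<Sum>l\<le>m. L m l * cnj (L n l))"
    using positive_kernel_cholesky[OF K] by blast
  define s where "s = complex_of_real (1 / sqrt 2)"
  have ss: "s * s = 1 / 2"
    by (simp add: s_def flip: of_real_mult)
  have cnj_s: "cnj s = s" by (simp add: s_def)
  \<comment> \<open>The factor 1 / sqrt 2 normalizes E |\<gamma>_l|^2 to 1. The real and imaginary
    parts are orthogonal with equal variance, hence E (\<gamma>_l^2) = 0. Even and odd coordinates
    keep different \<gamma>_l apart.\<close>
  define \<gamma> where "\<gamma> l = (\<lambda>\<omega>. s * ?\<xi> (2 * l) \<omega> + (s * \<i>) * ?\<xi> (Suc (2 * l)) \<omega>)" for l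
  have span: "\<gamma> l \<in> gaussian_span" for l
    unfolding \<gamma>_def by (intro gaussian_span_add gaussian_span_scale gaussian_span_coordinate)
  note \<gamma>L2 = gaussian_span_L2[OF span]
  have cnj_\<gamma>: "(\<lambda>\<omega>. cnj (\<gamma> l \<omega>)) = (\<lambda>\<omega>. s * ?\<xi> (2 * l) \<omega> + (- s * \<i>) * ?\<xi> (Suc (2 * l)) \<omega>)" for l
    by (simp add: \<gamma>_def cnj_s)
  have inner: "L2_inner white_noise (\<lambda>\<omega>. a * ?\<xi> (2 * k) \<omega> + b * ?\<xi> (Suc (2 * k)) \<omega>)
      (\<lambda>\<omega>. c * ?\<xi> (2 * l) \<omega> + d * ?\<xi> (Suc (2 * l)) \<omega>) = (if k = l then a * cnj c + b * cnj d else 0)"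
    for a b c d k l
  proof -
    have neq: "2 * k \<noteq> Suc (2 * l)" "Suc (2 * k) \<noteq> 2 * l" by presburger+
    show ?thesis
      using on neq
      by (simp add: L2_inner_add_left L2_inner_add_right L2_add L2_scale L2_inner_scale_left L2_inner_scale_right)
  qed
  have \<gamma>1: "L2_inner white_noise (\<gamma> k) (\<gamma> l) = (if k = l then 1 else 0)" for k l
    unfolding \<gamma>_def inner by (simp add: cnj_s ss mult_ac)
  have \<gamma>2: "L2_inner white_noise (\<gamma> k) (\<lambda>\<omega>. cnj (\<gamma> l \<omega>)) = 0" for k l
    unfolding cnj_\<gamma> unfolding \<gamma>_def inner by (simp add: cnj_s ss mult_ac)
  define v where "v m = (\<lambda>\<omega>. \<Sum>l\<le>m. L m l * \<gamma> l \<omega>)" for m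
  have vspan: "v m \<in> gaussian_span" for m
    unfolding v_def by (intro gaussian_span_sum span)
  have "L2_inner white_noise (v m) (v n) = K m n" for m n
  proof -
    have "L2_inner white_noise (v m) (v n) = (\<Sum>l\<le>m. L m l * L2_inner white_noise (\<gamma> l) (v n))"
      unfolding v_def[of m] by (intro L2_inner_lincomb_left \<gamma>L2 gaussian_span_L2 vspan)
    also have "\<dots> = (\<Sum>l\<le>m. L m l * cnj (L n l))"
    proof (intro sum.cong refl)
      fix l
      have "L2_inner white_noise (\<gamma> l) (v n) = (\<Sum>k\<le>n. cnj (L n k) * L2_inner white_noise (\<gamma> l) (\<gamma> k))"
        unfolding v_def by (intro L2_inner_lincomb_right \<gamma>L2)
      also have "\<dots> = (\<Sum>k\<le>n. if k = l then cnj (L n l) else 0)"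
        by (intro sum.cong refl) (auto simp: \<gamma>1)
      also have "\<dots> = cnj (L n l)" using L0[of n l] by (auto simp: not_le)
      finally show "L m l * L2_inner white_noise (\<gamma> l) (v n) = L m l * cnj (L n l)" by simp
    qed
    finally show ?thesis by (simp only: L)
  qed
  moreover have "L2_inner white_noise (v m) (\<lambda>\<omega>. cnj (v n \<omega>)) = 0" for m n
  proof -
    have "L2_inner white_noise (v m) (\<lambda>\<omega>. cnj (v n \<omega>)) = (\<Sum>l\<le>m. L m l * L2_inner white_noise (\<gamma> l) (\<lambda>\<omega>. cnj (v n \<omega>)))"
      unfolding v_def[of m] by (intro L2_inner_lincomb_left \<gamma>L2 L2_cnj gaussian_span_L2 vspan)
    also have "\<dots> = 0"
    proof (intro sum.neutral ballI)
      fix l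
      have "L2_inner white_noise (\<gamma> l) (\<lambda>\<omega>. cnj (v n \<omega>))
          = L2_inner white_noise (\<gamma> l) (\<lambda>\<omega>. \<Sum>k\<le>n. cnj (L n k) * cnj (\<gamma> k \<omega>))"
        by (simp add: v_def)
      also have "\<dots> = (\<Sum>k\<le>n. cnj (cnj (L n k)) * L2_inner white_noise (\<gamma> l) (\<lambda>\<omega>. cnj (\<gamma> k \<omega>)))"
        by (intro L2_inner_lincomb_right \<gamma>L2 L2_cnj)
      finally show "L m l * L2_inner white_noise (\<gamma> l) (\<lambda>\<omega>. cnj (v n \<omega>)) = 0" by (simp add: \<gamma>2)
    qed
    finally show ?thesis .
  qed
  ultimately show ?thesis using vspan by blast
qed

section \<open>Random analytic functions\<close>

lemma (in prob_space) centered_gaussian_mean: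
  assumes "centered_gaussian M X"
  shows "(LINT x|M. X x) = 0"
  using assms unfolding centered_gaussian_def
proof (elim conjE disjE exE)
  assume "X \<in> borel_measurable M" "AE x in M. X x = 0"
  hence "(LINT x|M. X x) = (LINT x|M. 0)" by (intro integral_cong_AE) auto
  thus ?thesis by simp
qed (rule normal_distributed_expectation)

lemma (in prob_space) L2_integrable:
  assumes "f \<in> L2 M"
  shows "integrable M f"
  using L2_product_integrable[OF assms, of "\<lambda>_. 1"] by (simp add: L2_iff)

lemma (in prob_space) centered_complex_gaussian_mean:
  assumes \<gamma>: "centered_complex_gaussian M \<gamma>" "\<gamma> \<in> L2 M"
  shows "(LINT x|M. \<gamma> x) = 0"
proof (rule complex_eqI)
  have c: "centered_gaussian M (\<lambda>x. a * Re (\<gamma> x) + b * Im (\<gamma> x))" for a b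
    using \<gamma>(1) by (simp add: centered_complex_gaussian_def)
  have int: "integrable M \<gamma>" using \<gamma>(2) by (rule L2_integrable)
  show "Re (LINT x|M. \<gamma> x) = Re 0"
    using centered_gaussian_mean[OF c[of 1 0]] int by simp
  show "Im (LINT x|M. \<gamma> x) = Im 0"
    using centered_gaussian_mean[OF c[of 0 1]] int by simp
qed

lemma (in prob_space) standard_complex_gaussian_orthonormal:
  assumes L2: "\<And>i. i \<in> I \<Longrightarrow> \<alpha> i \<in> L2 M"
    and std: "\<And>i. i \<in> I \<Longrightarrow> standard_complex_gaussian M (\<alpha> i)"
    and ind: "indep_vars (\<lambda>_. borel) \<alpha> I"
  shows "L2_orthonormal M \<alpha> I"
  unfolding L2_orthonormal_def
proof (intro conjI ballI L2)
  fix i j assume ij: "i \<in> I" "j \<in> I"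
  show "L2_inner M (\<alpha> i) (\<alpha> j) = (if i = j then 1 else 0)"
  proof (cases "i = j")
    case True
    have "(L2_norm M (\<alpha> i))\<^sup>2 = 1"
      using std[OF ij(1)] by (simp add: standard_complex_gaussian_def L2_norm_square)
    thus ?thesis using True by (simp add: L2_inner_self del: of_real_power)
  next
    case False
    \<comment> \<open>Conjugates one of the two variables only, so that the product rule for
      independent variables yields an inner product.\<close>
    define Y where "Y k w = (if k = j then cnj w else w)" for k and w :: complex
    have cnj_meas: "cnj \<in> borel_measurable borel"
      by (intro borel_measurable_continuous_onI continuous_intros)
    have "indep_vars (\<lambda>_. borel) (\<lambda>k x. Y k (\<alpha> k x)) {i, j}"
      by (rule indep_vars_compose2[OF indep_vars_subset[OF ind]])
         (use ij cnj_meas in \<open>auto simp: Y_def\<close>)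
    moreover have "integrable M (\<lambda>x. Y k (\<alpha> k x))" if "k \<in> {i, j}" for k
      using L2_integrable[OF L2[of k]] L2_integrable[OF L2_cnj[OF L2[of k]]] that ij False by (auto simp: Y_def)
    ultimately have "(LINT x|M. (\<Prod>k\<in>{i, j}. Y k (\<alpha> k x))) = (\<Prod>k\<in>{i, j}. LINT x|M. Y k (\<alpha> k x))"
      by (intro indep_vars_lebesgue_integral) auto
    moreover have "(LINT x|M. \<alpha> i x) = 0"
      using std[OF ij(1)] L2[OF ij(1)] by (intro centered_complex_gaussian_mean) (auto simp: standard_complex_gaussian_def)
    ultimately show ?thesis using False by (simp add: L2_inner_def Y_def)
  qed
qed

text \<open>E (F H) is the inner product of F with cnj H, which is continuous in norm. One series is
  expanded at a time, F against each b_k and then H against F, so no interchange of a double sum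
  occurs and the order of summation matches that of the operator side.\<close>

lemma series_product_expectation:
  assumes a: "\<And>j. a j \<in> L2 M" "\<And>j. L2_norm M (a j) \<le> 1"
    and b: "\<And>k. b k \<in> L2 M" "\<And>k. L2_norm M (b k) \<le> 1"
    and p: "summable (\<lambda>j. cmod (p j))" and q: "summable (\<lambda>k. cmod (q k))"
    and F: "F \<in> borel_measurable M" "AE x in M. (\<lambda>j. p j * a j x) sums F x"
    and H: "H \<in> borel_measurable M" "AE x in M. (\<lambda>k. q k * b k x) sums H x"
  shows "(\<lambda>k. q k * (\<Sum>j. p j * (LINT x|M. a j x * b k x))) sums (LINT x|M. F x * H x)"
proof -
  have series: "G \<in> L2 M \<and> (\<lambda>n. L2_norm M (\<lambda>x. (\<Sum>j<n. r j * c j x) - G x)) \<longlonglongrightarrow> 0"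
    if c: "\<And>j. c j \<in> L2 M" "\<And>j. L2_norm M (c j) \<le> 1" and r: "summable (\<lambda>j. cmod (r j))"
      and G: "G \<in> borel_measurable M" "AE x in M. (\<lambda>j. r j * c j x) sums G x" for c r G
  proof -
    have "summable (\<lambda>j. L2_norm M (\<lambda>x. r j * c j x))"
    proof (rule summable_comparison_test'[OF r])
      show "norm (L2_norm M (\<lambda>x. r j * c j x)) \<le> cmod (r j)" if "j \<ge> 0" for j
        using c(2)[of j] by (simp add: L2_norm_scale mult_left_le)
    qed
    from L2_series[OF L2_scale[OF c(1)] this G] show ?thesis by simp
  qed
  note F' = series[OF a p F] and H' = series[OF b q H]
  have inner: "(LINT x|M. f x * g x) = L2_inner M f (\<lambda>x. cnj (g x))" for f g
    by (simp add: L2_inner_def)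
  have "(\<lambda>j. p j * (LINT x|M. a j x * b k x)) sums (LINT x|M. F x * b k x)" for k
  proof -
    have "(\<lambda>n. L2_inner M (\<lambda>x. \<Sum>j<n. p j * a j x) (\<lambda>x. cnj (b k x))) \<longlonglongrightarrow> L2_inner M F (\<lambda>x. cnj (b k x))"
      using F' by (intro L2_inner_tendsto_left L2_lincomb L2_cnj a b) auto
    thus ?thesis by (simp add: sums_def inner L2_inner_lincomb_left a b L2_cnj)
  qed
  hence eq: "(\<Sum>j. p j * (LINT x|M. a j x * b k x)) = (LINT x|M. b k x * F x)" for k
    by (simp add: sums_iff mult.commute)
  have "(\<lambda>n. L2_inner M (\<lambda>x. \<Sum>k<n. q k * b k x) (\<lambda>x. cnj (F x))) \<longlonglongrightarrow> L2_inner M H (\<lambda>x. cnj (F x))"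
    using F' H' by (intro L2_inner_tendsto_left L2_lincomb L2_cnj b) auto
  hence "(\<lambda>k. q k * (LINT x|M. b k x * F x)) sums (LINT x|M. H x * F x)"
    using F' by (simp add: sums_def inner L2_inner_lincomb_left b L2_cnj)
  thus ?thesis by (simp only: eq mult.commute[of "H _" "F _"])
qed

text \<open>The coefficients of a \<open>\<D>\<^sub>0\<close>-GAF are those of the Szego kernel, shifted by one factor of \<open>z\<close>.\<close>

lemma GAF_coeff_eq:
  "c / of_real (sqrt (real (Suc j))) * z ^ Suc j = (z * szego_coeff z j) * c"
  by (simp add: szego_coeff_def)

lemma szego_coeff_summable:
  assumes "z \<in> unit_disk"
  shows "summable (\<lambda>j. cmod (z * szego_coeff z j))"
proof (rule summable_comparison_test')
  show "summable (\<lambda>j. cmod z * cmod z ^ j)"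
    using assms by (intro summable_mult summable_geometric) simp
  show "norm (cmod (z * szego_coeff z j)) \<le> cmod z * cmod z ^ j" if "j \<ge> 0" for j
    using szego_coeff_bound[of z j] by (simp add: norm_mult mult_left_mono)
qed

text \<open>Common to (a) and (b): both reduce the identity to a double series in the Szego
  coefficients with sum S. The factors z and w are pulled out of the two coefficient
  sequences.\<close>

lemma GAF_expectation:
  assumes a: "\<And>j. \<alpha> j \<in> L2 M" "\<And>j. L2_norm M (\<alpha> j) \<le> 1"
    and b: "\<And>k. \<beta> k \<in> L2 M" "\<And>k. L2_norm M (\<beta> k) \<le> 1"
    and F: "\<Phi> z \<in> borel_measurable M" "AE \<omega> in M. (\<lambda>j. \<alpha> j \<omega> / of_real (sqrt (real (Suc j))) * z ^ Suc j) sums \<Phi> z \<omega>"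
    and H: "\<Psi> w \<in> borel_measurable M" "AE \<omega> in M. (\<lambda>k. \<beta> k \<omega> / of_real (sqrt (real (Suc k))) * w ^ Suc k) sums \<Psi> w \<omega>"
    and z: "z \<in> unit_disk" and w: "w \<in> unit_disk"
    and S: "(\<lambda>k. szego_coeff w k * (\<Sum>j. szego_coeff z j * (LINT \<omega>|M. \<alpha> j \<omega> * \<beta> k \<omega>))) sums S"
  shows "(LINT \<omega>|M. \<Phi> z \<omega> * \<Psi> w \<omega>) = z * w * S"
proof -
  have summable: "summable (\<lambda>j. szego_coeff z j * (LINT \<omega>|M. \<alpha> j \<omega> * \<beta> k \<omega>))" for k
  proof (rule summable_comparison_test')
    show "summable (\<lambda>j. cmod z ^ j)" using z by (intro summable_geometric) simp
    fix j
    have "cmod (L2_inner M (\<alpha> j) (\<lambda>\<omega>. cnj (\<beta> k \<omega>))) \<le> L2_norm M (\<alpha> j) * L2_norm M (\<beta> k)"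
      using L2_Cauchy_Schwarz[OF a(1) L2_cnj[OF b(1)]] by simp
    also have "\<dots> \<le> 1" using a(2) b(2) by (intro mult_le_one) auto
    finally show "norm (szego_coeff z j * (LINT \<omega>|M. \<alpha> j \<omega> * \<beta> k \<omega>)) \<le> cmod z ^ j"
      using mult_mono[OF szego_coeff_bound] by (fastforce simp: L2_inner_def norm_mult)
  qed
  have "(\<lambda>k. (w * szego_coeff w k) * (\<Sum>j. (z * szego_coeff z j) * (LINT \<omega>|M. \<alpha> j \<omega> * \<beta> k \<omega>)))
      sums (LINT \<omega>|M. \<Phi> z \<omega> * \<Psi> w \<omega>)"
    using F H unfolding GAF_coeff_eq
    by (intro series_product_expectation a b szego_coeff_summable z w)
  moreover have "(w * szego_coeff w k) * (\<Sum>j. (z * szego_coeff z j) * (LINT \<omega>|M. \<alpha> j \<omega> * \<beta> k \<omega>))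
      = (z * w) * (szego_coeff w k * (\<Sum>j. szego_coeff z j * (LINT \<omega>|M. \<alpha> j \<omega> * \<beta> k \<omega>)))" for k
    using suminf_mult[OF summable[of k], of z] by (simp add: mult_ac)
  ultimately show ?thesis
    using sums_mult[OF S, of "z * w"] by (simp add: sums_unique2)
qed

text \<open>Part (a) concerns second moments only, so of the Gaussian and independence assumptions
  just orthonormality is retained. The index is shifted to start at 0, in line with the basis
  e_j.\<close>

lemma D0_GAF_coefficients:
  assumes G: "gaussian_hilbert_space M G" and \<Phi>: "D0_GAF M G \<Phi>"
  obtains \<alpha> where "L2_orthonormal M \<alpha> (UNIV :: nat set)"
    "AE \<omega> in M. \<forall>z\<in>unit_disk. (\<lambda>j. \<alpha> j \<omega> / of_real (sqrt (real (Suc j))) * z ^ Suc j) sums \<Phi> z \<omega>"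
proof -
  from \<Phi> obtain \<alpha> where \<alpha>: "\<forall>j\<ge>1. \<alpha> j \<in> G \<and> standard_complex_gaussian M (\<alpha> j)"
    "prob_space.indep_vars M (\<lambda>_. borel) \<alpha> {1..}"
    "AE \<omega> in M. \<forall>z\<in>unit_disk. (\<lambda>j. \<alpha> (Suc j) \<omega> / of_real (sqrt (real (Suc j))) * z ^ Suc j) sums \<Phi> z \<omega>"
    by (auto simp: D0_GAF_def)
  interpret prob_space M using G by (simp add: gaussian_hilbert_space_def)
  have "G \<subseteq> L2 M" using G by (simp add: gaussian_hilbert_space_def)
  hence "L2_orthonormal M \<alpha> {1..}"
    using \<alpha> by (intro standard_complex_gaussian_orthonormal) auto
  hence "L2_orthonormal M (\<lambda>j. \<alpha> (Suc j)) UNIV" by (auto simp: L2_orthonormal_def)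
  thus ?thesis using \<alpha>(3) by (rule that)
qed

lemma contraction_of_GAFs:
  assumes "jointly_gaussian_D0_GAFs M G \<Phi> \<Psi>"
  shows "\<exists>T. norm_contraction disk_area T \<and> correlation_identity M \<Phi> \<Psi> T"
proof -
  have G: "gaussian_hilbert_space M G" and GAF: "D0_GAF M G \<Phi>" "D0_GAF M G \<Psi>"
    using assms by (auto simp: jointly_gaussian_D0_GAFs_def)
  obtain \<alpha> where \<alpha>: "L2_orthonormal M \<alpha> (UNIV :: nat set)"
    and \<Phi>: "AE \<omega> in M. \<forall>z\<in>unit_disk. (\<lambda>j. \<alpha> j \<omega> / of_real (sqrt (real (Suc j))) * z ^ Suc j) sums \<Phi> z \<omega>"
    using D0_GAF_coefficients[OF G GAF(1)] by blast
  obtain \<beta> where \<beta>: "L2_orthonormal M \<beta> (UNIV :: nat set)"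
    and \<Psi>: "AE \<omega> in M. \<forall>z\<in>unit_disk. (\<lambda>j. \<beta> j \<omega> / of_real (sqrt (real (Suc j))) * z ^ Suc j) sums \<Psi> z \<omega>"
    using D0_GAF_coefficients[OF G GAF(2)] by blast
  have meas: "\<Phi> z \<in> borel_measurable M" "\<Psi> z \<in> borel_measurable M" if "z \<in> unit_disk" for z
    using GAF that by (auto simp: D0_GAF_def random_analytic_function_def)
  have L2: "\<alpha> j \<in> L2 M" "\<beta> j \<in> L2 M" for j using \<alpha> \<beta> by (auto simp: L2_orthonormal_def)
  have norm: "L2_norm M (\<alpha> j) \<le> 1" "L2_norm M (\<beta> j) \<le> 1" for j
    using L2_orthonormal_norm[OF \<alpha>, of j] L2_orthonormal_norm[OF \<beta>, of j] by simp_all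
  define c where "c j k = (LINT \<omega>|M. \<alpha> j \<omega> * \<beta> k \<omega>)" for j k
  have c_inner: "c j k = L2_inner M (\<alpha> j) (\<lambda>\<omega>. cnj (\<beta> k \<omega>))" for j k
    by (simp add: c_def L2_inner_def)
  have "(\<Sum>k<n. (cmod (\<Sum>j<m. a j * c j k))\<^sup>2) \<le> (\<Sum>j<m. (cmod (a j))\<^sup>2)" for a m n
  proof -
    \<comment> \<open>Its inner products with the cnj \<beta>_k are the entries to be bounded, and
      its squared norm is the right-hand side.\<close>
    define A where "A \<omega> = (\<Sum>j<m. a j * \<alpha> j \<omega>)" for \<omega>
    have A: "A \<in> L2 M" unfolding A_def[abs_def] by (intro L2_lincomb L2)
    have "(\<Sum>j<m. a j * c j k) = L2_inner M A (\<lambda>\<omega>. cnj (\<beta> k \<omega>))" for k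
      unfolding A_def[abs_def] c_inner by (intro L2_inner_lincomb_left[symmetric] L2 L2_cnj)
    hence "(\<Sum>k<n. (cmod (\<Sum>j<m. a j * c j k))\<^sup>2) \<le> (L2_norm M A)\<^sup>2"
      using L2_Bessel[OF L2_orthonormal_cnj[OF \<beta>], of "{..<n}", OF _ _ A] by simp
    also have "\<dots> = (\<Sum>j<m. (cmod (a j))\<^sup>2)"
      unfolding A_def[abs_def] by (rule L2_orthonormal_norm_lincomb[OF \<alpha>]) auto
    finally show ?thesis .
  qed
  from contraction_of_matrix[of c, OF this] obtain T where T: "norm_contraction disk_area T"
    and TS: "\<And>z w. z \<in> unit_disk \<Longrightarrow> w \<in> unit_disk \<Longrightarrow>
      (\<lambda>k. szego_coeff w k * (\<Sum>j. szego_coeff z j * c j k)) sums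
        L2_inner disk_area (T (\<lambda>\<zeta>. cnj (szego z \<zeta>))) (szego w)" by blast
  have "correlation_identity M \<Phi> \<Psi> T"
    unfolding correlation_identity_def
  proof (intro ballI)
    fix z w assume z: "z \<in> unit_disk" and w: "w \<in> unit_disk"
    have \<Phi>z: "AE \<omega> in M. (\<lambda>j. \<alpha> j \<omega> / of_real (sqrt (real (Suc j))) * z ^ Suc j) sums \<Phi> z \<omega>"
      using \<Phi> by eventually_elim (use z in blast)
    have \<Psi>w: "AE \<omega> in M. (\<lambda>j. \<beta> j \<omega> / of_real (sqrt (real (Suc j))) * w ^ Suc j) sums \<Psi> w \<omega>"
      using \<Psi> by eventually_elim (use w in blast)
    show "(LINT \<omega>|M. \<Phi> z \<omega> * \<Psi> w \<omega>) = z * w * L2_inner disk_area (T (\<lambda>\<zeta>. cnj (szego z \<zeta>))) (szego w)"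
      by (rule GAF_expectation[where \<alpha> = \<alpha> and \<beta> = \<beta> and \<Phi> = \<Phi> and \<Psi> = \<Psi>,
            OF L2(1) norm(1) L2(2) norm(2) meas(1)[OF z] \<Phi>z meas(2)[OF w] \<Psi>w z w TS[OF z w, unfolded c_def]])
  qed
  with T show ?thesis by blast
qed

text \<open>Almost sure convergence is obtained at countably many radii tending to 1, so that one
  null set serves the whole disk; off that set the sum is an ordinary convergent power series, hence
  analytic.\<close>

lemma D0_GAF_exists:
  assumes G: "gaussian_hilbert_space M G"
    and \<alpha>: "\<And>j. j \<ge> 1 \<Longrightarrow> \<alpha> j \<in> G" "\<And>j. j \<ge> 1 \<Longrightarrow> standard_complex_gaussian M (\<alpha> j)"
    and ind: "prob_space.indep_vars M (\<lambda>_. borel) \<alpha> {1..}"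
  obtains \<Phi> where "D0_GAF M G \<Phi>"
    "AE \<omega> in M. \<forall>z\<in>unit_disk. (\<lambda>j. \<alpha> (Suc j) \<omega> / of_real (sqrt (real (Suc j))) * z ^ Suc j) sums \<Phi> z \<omega>"
proof -
  interpret prob_space M using G by (simp add: gaussian_hilbert_space_def)
  \<comment> \<open>A zero constant term turns the series, which starts at the first power, into a
    power series over all n.\<close>
  define c where "c \<omega> n = (if n = 0 then 0 else \<alpha> n \<omega> / of_real (sqrt (real n)))" for \<omega> n
  \<comment> \<open>On the exceptional null set this is whatever \<open>suminf\<close> returns;
    \<Phi> z is still measurable there.\<close>
  define \<Phi> where "\<Phi> z \<omega> = (\<Sum>n. c \<omega> n * z ^ n)" for z \<omega>
  have L2: "\<alpha> (Suc j) \<in> L2 M" for j using G \<alpha>(1)[of "Suc j"] by (auto simp: gaussian_hilbert_space_def)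
  have cL2: "(\<lambda>\<omega>. c \<omega> n * z ^ n) \<in> L2 M" for z n
  proof (cases n)
    case (Suc j)
    have "(\<lambda>\<omega>. (z ^ n / of_real (sqrt (real n))) * \<alpha> n \<omega>) \<in> L2 M" unfolding Suc by (intro L2_scale L2)
    thus ?thesis using Suc by (simp add: c_def mult.commute)
  qed (simp add: c_def)
  have norm: "L2_norm M (\<alpha> (Suc j)) = 1" for j
    using \<alpha>(2)[of "Suc j"] by (simp add: standard_complex_gaussian_def L2_norm_def)
  have bound: "L2_norm M (\<lambda>\<omega>. c \<omega> n * z ^ n) \<le> cmod z ^ n" for z n
  proof (cases n)
    case (Suc j)
    have "L2_norm M (\<lambda>\<omega>. c \<omega> n * z ^ n) = L2_norm M (\<lambda>\<omega>. (z * szego_coeff z j) * \<alpha> (Suc j) \<omega>)"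
      using Suc by (simp only: c_def GAF_coeff_eq nat.distinct if_False)
    also have "\<dots> = cmod z * cmod (szego_coeff z j)" by (simp add: L2_norm_scale norm norm_mult)
    also have "\<dots> \<le> cmod z * cmod z ^ j" by (intro mult_left_mono szego_coeff_bound) simp
    finally show ?thesis using Suc by simp
  qed (simp add: c_def L2_norm_def)
  \<comment> \<open>The radii are 1 - 1 / (m + 1). Absolute convergence at such a point dominates
    the series at every z of smaller or equal modulus.\<close>
  have "AE \<omega> in M. summable (\<lambda>n. cmod (c \<omega> n * of_real (1 - inverse (real (Suc m))) ^ n))" for m
  proof (rule AE_summable_L2_series[OF cL2], rule summable_comparison_test')
    show "summable (\<lambda>n. (1 - inverse (real (Suc m))) ^ n)"
      by (intro summable_geometric) (simp add: field_simps)
    have "cmod (of_real (1 - inverse (real (Suc m)))) = 1 - inverse (real (Suc m))"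
      unfolding norm_of_real by (simp add: field_simps)
    thus "norm (L2_norm M (\<lambda>\<omega>. c \<omega> n * of_real (1 - inverse (real (Suc m))) ^ n)) \<le> (1 - inverse (real (Suc m))) ^ n" for n
      using bound[of n "of_real (1 - inverse (real (Suc m)))"] by simp
  qed
  hence "AE \<omega> in M. \<forall>m. summable (\<lambda>n. cmod (c \<omega> n * of_real (1 - inverse (real (Suc m))) ^ n))"
    unfolding AE_all_countable by blast
  hence summable: "AE \<omega> in M. \<forall>z\<in>unit_disk. summable (\<lambda>n. c \<omega> n * z ^ n)"
  proof eventually_elim
    case (elim \<omega>)
    show ?case
    proof
      fix z :: complex assume "z \<in> unit_disk"
      hence "1 - cmod z > 0" by simp
      then obtain m where m: "inverse (real (Suc m)) < 1 - cmod z" using reals_Archimedean by blast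
      define r where "r = 1 - inverse (real (Suc m))"
      have r: "cmod z \<le> r" "0 \<le> r" using m by (simp_all add: r_def field_simps)
      show "summable (\<lambda>n. c \<omega> n * z ^ n)"
      proof (rule summable_comparison_test')
        show "summable (\<lambda>n. cmod (c \<omega> n * of_real r ^ n))" using elim[rule_format, of m] by (simp only: r_def)
        show "norm (c \<omega> n * z ^ n) \<le> cmod (c \<omega> n * of_real r ^ n)" for n
          using r by (auto simp: norm_mult norm_power intro!: mult_left_mono power_mono)
      qed
    qed
  qed
  have series: "(\<lambda>j. \<alpha> (Suc j) \<omega> / of_real (sqrt (real (Suc j))) * z ^ Suc j) sums \<Phi> z \<omega>"
    if "summable (\<lambda>n. c \<omega> n * z ^ n)" for \<omega> z
  proof -
    have "(\<lambda>n. c \<omega> n * z ^ n) sums \<Phi> z \<omega>" unfolding \<Phi>_def using that by (rule summable_sums)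
    hence "(\<lambda>j. c \<omega> (Suc j) * z ^ Suc j) sums (\<Phi> z \<omega> - c \<omega> 0 * z ^ 0)"
      using sums_Suc_iff[of "\<lambda>n. c \<omega> n * z ^ n"] by simp
    thus ?thesis by (simp add: c_def)
  qed
  have AE: "AE \<omega> in M. \<forall>z\<in>unit_disk. (\<lambda>j. \<alpha> (Suc j) \<omega> / of_real (sqrt (real (Suc j))) * z ^ Suc j) sums \<Phi> z \<omega>"
    using summable by eventually_elim (use series in blast)
  have "AE \<omega> in M. (\<lambda>z. \<Phi> z \<omega>) analytic_on unit_disk"
    using summable
  proof eventually_elim
    case (elim \<omega>)
    have "((\<lambda>z. \<Phi> z \<omega>) has_field_derivative (\<Sum>n. diffs (c \<omega>) n * z ^ n)) (at z)" if "z \<in> unit_disk" for z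
      unfolding \<Phi>_def by (rule termdiffs_strong'[where K = 1]) (use elim that in auto)
    thus ?case unfolding analytic_on_open[OF open_ball] holomorphic_on_open[OF open_ball] by blast
  qed
  moreover have "\<Phi> z \<in> borel_measurable M" for z
    unfolding \<Phi>_def[abs_def] using L2_measurable[OF cL2] by (rule borel_measurable_suminf)
  ultimately have "D0_GAF M G \<Phi>"
    unfolding D0_GAF_def random_analytic_function_def using \<alpha> ind AE by blast
  thus ?thesis using AE by (rule that)
qed

text \<open>
  The Gram matrix of \<open>\<alpha>\<^sub>1, \<beta>\<^sub>1*, \<alpha>\<^sub>2, \<beta>\<^sub>2*, \<dots>\<close> (stars denoting conjugates) that the
  identity prescribes; it is positive because \<open>T\<close> is a contraction.
\<close>

lemma contraction_gram_kernel:
  assumes T: "norm_contraction disk_area T"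
  obtains K where "positive_kernel K"
    "\<And>j k. K (2 * j) (2 * k) = (if j = k then 1 else 0)"
    "\<And>j k. K (Suc (2 * j)) (Suc (2 * k)) = (if j = k then 1 else 0)"
    "\<And>j k. K (2 * j) (Suc (2 * k)) = L2_inner disk_area (T (cnj_basis j)) (bergman_basis k)"
proof -
  have lin: "L2_linear_operator disk_area T"
    and contr: "\<And>f. f \<in> L2 disk_area \<Longrightarrow> L2_norm disk_area (T f) \<le> L2_norm disk_area f"
    using T by (auto simp: norm_contraction_def)
  note TL2 = L2_linear_operatorD(1)[OF lin]
  \<comment> \<open>Index m stands for the pair (u m, v m), one component of which is 0. A single
    formula for K then covers all four parity blocks: two identities, the matrix of T and its
    adjoint.\<close>
  define u where "u m = (if even m then cnj_basis (m div 2) else (\<lambda>_. 0))" for m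
  define v where "v m = (if even m then (\<lambda>_. 0) else bergman_basis (m div 2))" for m
  define K where "K m n = L2_inner disk_area (u m) (u n) + L2_inner disk_area (v m) (v n)
      + L2_inner disk_area (T (u m)) (v n) + cnj (L2_inner disk_area (T (u n)) (v m))" for m n
  have u: "u m \<in> L2 disk_area" and v: "v m \<in> L2 disk_area" for m
    by (auto simp: u_def v_def intro: L2_cnj bergman_basis_L2)
  have "K n m = cnj (K m n)" for m n
    using L2_inner_cnj_commute[of disk_area "u n" "u m"] L2_inner_cnj_commute[of disk_area "v n" "v m"]
    by (simp add: K_def)
  moreover have "0 \<le> Re (\<Sum>m<N. \<Sum>n<N. x m * cnj (x n) * K m n)" for N x
  proof -
    define U where "U = (\<lambda>z. \<Sum>m<N. x m * u m z)"
    define V where "V = (\<lambda>z. \<Sum>m<N. x m * v m z)"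
    have U: "U \<in> L2 disk_area" and V: "V \<in> L2 disk_area"
      unfolding U_def V_def by (intro L2_lincomb u v)+
    have right: "L2_inner disk_area f (\<lambda>z. \<Sum>n<N. x n * g n z) = (\<Sum>n<N. cnj (x n) * L2_inner disk_area f (g n))"
      if "f \<in> L2 disk_area" "\<And>n. g n \<in> L2 disk_area" for f g
      using that by (intro L2_inner_lincomb_right) auto
    have UU: "L2_inner disk_area U U = (\<Sum>m<N. \<Sum>n<N. x m * cnj (x n) * L2_inner disk_area (u m) (u n))"
      unfolding U_def by (subst L2_inner_lincomb_left) (auto simp: u right L2_lincomb sum_distrib_left mult.assoc)
    have VV: "L2_inner disk_area V V = (\<Sum>m<N. \<Sum>n<N. x m * cnj (x n) * L2_inner disk_area (v m) (v n))"
      unfolding V_def by (subst L2_inner_lincomb_left) (auto simp: v right L2_lincomb sum_distrib_left mult.assoc)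
    have TUV: "L2_inner disk_area (T U) V = (\<Sum>m<N. \<Sum>n<N. x m * cnj (x n) * L2_inner disk_area (T (u m)) (v n))"
    proof -
      have "L2_inner disk_area (T U) V = (\<Sum>m<N. x m * L2_inner disk_area (T (u m)) V)"
        unfolding U_def by (rule L2_linear_operator_inner_lincomb[OF lin u V])
      thus ?thesis by (simp add: V_def right TL2 u v sum_distrib_left mult.assoc)
    qed
    have cnj_TUV: "cnj (L2_inner disk_area (T U) V) = (\<Sum>m<N. \<Sum>n<N. x m * cnj (x n) * cnj (L2_inner disk_area (T (u n)) (v m)))"
      unfolding TUV by (subst sum.swap) (simp add: mult.commute mult.left_commute)
    have "(\<Sum>m<N. \<Sum>n<N. x m * cnj (x n) * K m n)
        = L2_inner disk_area U U + L2_inner disk_area V V + L2_inner disk_area (T U) V + cnj (L2_inner disk_area (T U) V)"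
      unfolding UU VV cnj_TUV unfolding TUV by (simp add: K_def distrib_left sum.distrib)
    hence "Re (\<Sum>m<N. \<Sum>n<N. x m * cnj (x n) * K m n)
        = (L2_norm disk_area U)\<^sup>2 + (L2_norm disk_area V)\<^sup>2 + 2 * Re (L2_inner disk_area (T U) V)"
      by (simp add: L2_inner_self del: of_real_power)
    moreover have "\<bar>Re (L2_inner disk_area (T U) V)\<bar> \<le> L2_norm disk_area U * L2_norm disk_area V"
    proof -
      have "\<bar>Re (L2_inner disk_area (T U) V)\<bar> \<le> cmod (L2_inner disk_area (T U) V)" by (rule abs_Re_le_cmod)
      also have "\<dots> \<le> L2_norm disk_area (T U) * L2_norm disk_area V" by (intro L2_Cauchy_Schwarz TL2 U V)
      also have "\<dots> \<le> L2_norm disk_area U * L2_norm disk_area V" by (intro mult_right_mono contr U) simp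
      finally show ?thesis .
    qed
    \<comment> \<open>The form equals ||U||^2 + ||V||^2 + 2 Re <T U, V>, which is at least (||U|| -
      ||V||)^2.\<close>
    moreover have "0 \<le> (L2_norm disk_area U - L2_norm disk_area V)\<^sup>2" by simp
    ultimately show ?thesis unfolding power2_diff by linarith
  qed
  ultimately have "positive_kernel K" unfolding positive_kernel_def by blast
  moreover have zero: "L2_inner disk_area f (\<lambda>_. 0) = 0" "L2_inner disk_area (\<lambda>_. 0) f = 0" for f
    by (simp_all add: L2_inner_def)
  note T0 = L2_linear_operator_inner_zero[OF lin]
  have e: "L2_inner disk_area (bergman_basis j) (bergman_basis k) = (if j = k then 1 else 0)"
    "L2_inner disk_area (cnj_basis j) (cnj_basis k) = (if j = k then 1 else 0)" for j k
    using bergman_basis_orthonormal L2_orthonormal_cnj[OF bergman_basis_orthonormal]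
    by (auto simp: L2_orthonormal_def)
  have "K (2 * j) (2 * k) = (if j = k then 1 else 0)" "K (Suc (2 * j)) (Suc (2 * k)) = (if j = k then 1 else 0)"
    "K (2 * j) (Suc (2 * k)) = L2_inner disk_area (T (cnj_basis j)) (bergman_basis k)" for j k
    by (simp_all add: K_def u_def v_def zero T0 e bergman_basis_L2)
  ultimately show ?thesis by (intro that)
qed

lemma GAFs_of_contraction:
  assumes T: "norm_contraction disk_area T"
  shows "\<exists>\<Phi> \<Psi>. jointly_gaussian_D0_GAFs white_noise white_noise_space \<Phi> \<Psi> \<and> correlation_identity white_noise \<Phi> \<Psi> T"
proof -
  obtain K where K: "positive_kernel K"
    and K_even: "\<And>j k. K (2 * j) (2 * k) = (if j = k then 1 else 0)"
    and K_odd: "\<And>j k. K (Suc (2 * j)) (Suc (2 * k)) = (if j = k then 1 else 0)"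
    and K_mixed: "\<And>j k. K (2 * j) (Suc (2 * k)) = L2_inner disk_area (T (cnj_basis j)) (bergman_basis k)"
    using contraction_gram_kernel[OF T] by blast
  obtain v where span: "\<And>m. v m \<in> gaussian_span"
    and gram: "\<And>m n. L2_inner white_noise (v m) (v n) = K m n"
    and circ: "\<And>m n. L2_inner white_noise (v m) (\<lambda>\<omega>. cnj (v n \<omega>)) = 0"
    using gaussian_family_of_kernel[OF K] by blast
  \<comment> \<open>The shift \<open>j - 1\<close> pairs \<alpha>_1 with e_0. At j = 0 truncated
    subtraction repeats the value at j = 1, so orthonormality and independence are claimed on {1..}
    only. The conjugate in \<beta> turns the Gram entry into the integral of \<alpha>_j
    \<beta>_k.\<close>
  define \<alpha> where "\<alpha> j = v (2 * (j - 1))" for j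
  define \<beta> where "\<beta> j = (\<lambda>\<omega>. cnj (v (Suc (2 * (j - 1))) \<omega>))" for j
  have \<alpha>_span: "\<alpha> j \<in> gaussian_span" and \<beta>_span: "\<beta> j \<in> gaussian_span" for j
    by (auto simp: \<alpha>_def \<beta>_def span gaussian_span_cnj)
  note L2 = gaussian_span_L2[OF span]
  have \<alpha>_on: "L2_orthonormal white_noise \<alpha> {1..}"
    by (auto simp: L2_orthonormal_def \<alpha>_def L2 gram K_even)
  have "L2_orthonormal white_noise (\<lambda>j. v (Suc (2 * (j - 1)))) {1..}"
    by (auto simp: L2_orthonormal_def L2 gram K_odd)
  hence \<beta>_on: "L2_orthonormal white_noise \<beta> {1..}"
    unfolding \<beta>_def[abs_def] by (rule L2_orthonormal_cnj)
  have \<alpha>_circ: "L2_inner white_noise (\<alpha> i) (\<lambda>\<omega>. cnj (\<alpha> j \<omega>)) = 0" for i j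
    by (simp add: \<alpha>_def circ)
  have \<beta>_circ: "L2_inner white_noise (\<beta> i) (\<lambda>\<omega>. cnj (\<beta> j \<omega>)) = 0" for i j
    using circ[of "Suc (2 * (i - 1))" "Suc (2 * (j - 1))"]
      L2_inner_cnj_cnj[of white_noise "v (Suc (2 * (i - 1)))" "\<lambda>\<omega>. cnj (v (Suc (2 * (j - 1))) \<omega>)"]
    by (simp add: \<beta>_def)
  have std: "standard_complex_gaussian white_noise (f j)"
    if "f j \<in> gaussian_span" "L2_orthonormal white_noise f {1..}" "L2_inner white_noise (f j) (\<lambda>\<omega>. cnj (f j \<omega>)) = 0" "j \<ge> 1"
    for f and j :: nat
    unfolding standard_complex_gaussian_def
  proof (intro conjI)
    show "centered_complex_gaussian white_noise (f j)"
      using that(1) gaussian_span_subset by (intro white_noise_space_gaussian) auto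
    show "(LINT \<omega>|white_noise. (f j \<omega>)\<^sup>2) = 0"
      using that(3) by (simp add: L2_inner_def power2_eq_square)
    show "(LINT \<omega>|white_noise. (cmod (f j \<omega>))\<^sup>2) = 1"
      using L2_orthonormal_norm[OF that(2), of j] that(4) by (simp flip: L2_norm_square)
  qed
  note G = white_noise_space_gaussian_hilbert
  have mem: "\<alpha> j \<in> white_noise_space" "\<beta> j \<in> white_noise_space" for j
    using \<alpha>_span \<beta>_span gaussian_span_subset by auto
  obtain \<Phi> where \<Phi>: "D0_GAF white_noise white_noise_space \<Phi>"
    and \<Phi>s: "AE \<omega> in white_noise. \<forall>z\<in>unit_disk. (\<lambda>j. \<alpha> (Suc j) \<omega> / of_real (sqrt (real (Suc j))) * z ^ Suc j) sums \<Phi> z \<omega>"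
    by (rule D0_GAF_exists[OF G mem(1) std[OF \<alpha>_span \<alpha>_on \<alpha>_circ] gaussian_span_indep[OF \<alpha>_span \<alpha>_on \<alpha>_circ]])
  obtain \<Psi> where \<Psi>: "D0_GAF white_noise white_noise_space \<Psi>"
    and \<Psi>s: "AE \<omega> in white_noise. \<forall>z\<in>unit_disk. (\<lambda>j. \<beta> (Suc j) \<omega> / of_real (sqrt (real (Suc j))) * z ^ Suc j) sums \<Psi> z \<omega>"
    by (rule D0_GAF_exists[OF G mem(2) std[OF \<beta>_span \<beta>_on \<beta>_circ] gaussian_span_indep[OF \<beta>_span \<beta>_on \<beta>_circ]])
  have norm: "L2_norm white_noise (\<alpha> (Suc j)) \<le> 1" "L2_norm white_noise (\<beta> (Suc j)) \<le> 1" for j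
    using L2_orthonormal_norm[OF \<alpha>_on, of "Suc j"] L2_orthonormal_norm[OF \<beta>_on, of "Suc j"] by simp_all
  have corr: "(LINT \<omega>|white_noise. \<alpha> (Suc j) \<omega> * \<beta> (Suc k) \<omega>) = L2_inner disk_area (T (cnj_basis j)) (bergman_basis k)" for j k
  proof -
    have "(LINT \<omega>|white_noise. \<alpha> (Suc j) \<omega> * \<beta> (Suc k) \<omega>) = L2_inner white_noise (v (2 * j)) (v (Suc (2 * k)))"
      by (simp add: \<alpha>_def \<beta>_def L2_inner_def)
    thus ?thesis by (simp only: gram K_mixed)
  qed
  have "correlation_identity white_noise \<Phi> \<Psi> T"
    unfolding correlation_identity_def
  proof (intro ballI)
    fix z w assume z: "z \<in> unit_disk" and w: "w \<in> unit_disk"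
    have \<Phi>z: "AE \<omega> in white_noise. (\<lambda>j. \<alpha> (Suc j) \<omega> / of_real (sqrt (real (Suc j))) * z ^ Suc j) sums \<Phi> z \<omega>"
      using \<Phi>s by eventually_elim (use z in blast)
    have \<Psi>w: "AE \<omega> in white_noise. (\<lambda>j. \<beta> (Suc j) \<omega> / of_real (sqrt (real (Suc j))) * w ^ Suc j) sums \<Psi> w \<omega>"
      using \<Psi>s by eventually_elim (use w in blast)
    have meas: "\<Phi> z \<in> borel_measurable white_noise" "\<Psi> w \<in> borel_measurable white_noise"
      using \<Phi> \<Psi> z w by (auto simp: D0_GAF_def random_analytic_function_def)
    have Ts: "T (\<lambda>\<zeta>. cnj (szego z \<zeta>)) \<in> L2 disk_area"
      using T by (intro L2_linear_operatorD(1)[of _ T] L2_cnj szego_L2_series(1)[OF z])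
        (simp add: norm_contraction_def)
    \<comment> \<open>The outer series expands s_w, the inner one expands cnj s_z under T and is
      paired with e_k.\<close>
    have S: "(\<lambda>k. szego_coeff w k * (\<Sum>j. szego_coeff z j * (LINT \<omega>|white_noise. \<alpha> (Suc j) \<omega> * \<beta> (Suc k) \<omega>)))
        sums L2_inner disk_area (T (\<lambda>\<zeta>. cnj (szego z \<zeta>))) (szego w)"
      using szego_inner_sums[OF w Ts]
      by (simp only: corr sums_unique[OF contraction_cnj_szego_sums[OF T z bergman_basis_L2], symmetric])
    show "(LINT \<omega>|white_noise. \<Phi> z \<omega> * \<Psi> w \<omega>)
        = z * w * L2_inner disk_area (T (\<lambda>\<zeta>. cnj (szego z \<zeta>))) (szego w)"
      by (rule GAF_expectation[where \<alpha> = "\<lambda>j. \<alpha> (Suc j)" and \<beta> = "\<lambda>j. \<beta> (Suc j)" and \<Phi> = \<Phi> and \<Psi> = \<Psi>,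
            OF gaussian_span_L2[OF \<alpha>_span] norm(1) gaussian_span_L2[OF \<beta>_span] norm(2) meas(1) \<Phi>z meas(2) \<Psi>w z w S])
  qed
  thus ?thesis using G \<Phi> \<Psi> unfolding jointly_gaussian_D0_GAFs_def by blast
qed

text \<open>One space, \<open>white_noise\<close>, realizes every contraction, so (b) can fix its
  type of sample points; (a) holds over an arbitrary type.\<close>

theorem theorem1p9p3:
  "(\<forall>(M :: 'a measure) G \<Phi> \<Psi>.
      jointly_gaussian_D0_GAFs M G \<Phi> \<Psi> \<longrightarrow>
      (\<exists>T. norm_contraction disk_area T \<and> correlation_identity M \<Phi> \<Psi> T)) \<and>
   (\<forall>T. norm_contraction disk_area T \<longrightarrow>
      (\<exists>(M :: (nat \<Rightarrow> real) measure) G \<Phi> \<Psi>.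
         jointly_gaussian_D0_GAFs M G \<Phi> \<Psi> \<and> correlation_identity M \<Phi> \<Psi> T))"
  using contraction_of_GAFs GAFs_of_contraction by blast

end
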